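(* Let $\mathcal{H}$ be an infinite dimensional separable Hilbert space and let $N$ and $N_0$ be two contractions on $\mathcal{H}$ such that $N_0$ is normal and $V=N-N_0\in\mathcal{B}_2(\mathcal{H})$. Put $N_s=N_0+sV$, $s\in[0,1]$. Then for every complex polynomial $p$, $$p(N)-p(N_0)-\frac{d}{ds}\Big|_{s=0}p(N_s)\in\mathcal{B}_1(\mathcal{H}),$$ and there exists a function $\eta\in L^1(\mathbb{T})$, unique up to an analytic term (i.e. unique modulo $H^1(\mathbb{T})$), such that for every complex polynomial $p$, $$\operatorname{Tr}\Big\{p(N)-p(N_0)-\frac{d}{ds}\Big|_{s=0}p(N_s)\Big\}=\int_{\mathbb{T}}p''(z)\,\eta(z)\,dz. \qquad ( * )$$ Moreover, for every given $\epsilon>0$, the function $\eta$ satisfying $( * )$ can be chosen so that $$\|\eta\|_{L^1(\mathbb{T})}\le\Big(\frac12+\epsilon\Big)\|V\|_2^2.$$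
   Context: $\mathcal{B}_1(\mathcal{H})$ and $\mathcal{B}_2(\mathcal{H})$ are the trace class and Hilbert-Schmidt operators on $\mathcal{H}$; $\|\cdot\|_2$ is the Hilbert-Schmidt norm. A contraction is a bounded operator of norm at most $1$. The derivative in $s$ is the (G\^ateaux) derivative in operator norm (one-sided at $s=0$ if $s$ is restricted to $[0,1]$). $\mathbb{T}$ is the unit circle; $\int_{\mathbb{T}}f(z)\,dz=\int_0^{2\pi}f(e^{it})\,ie^{it}\,dt$, and $\|f\|_{L^1(\mathbb{T})}=\int_0^{2\pi}|f(e^{it})|\,dt$ (arc length). $H^1(\mathbb{T})=\{f\in L^1(\mathbb{T}):\hat f(n)=0\text{ for all }n<0\}$. *)

theory Defs
  imports "HOL-Analysis.Analysis" "HOL-Computational_Algebra.Polynomial"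
begin

text \<open>The inner product is linear in the first argument. Definiteness follows from
  the axiom \<open>norm_eq_sqrt_cinner\<close>, since the underlying real space is normed.\<close>

class complex_inner_space = real_normed_vector +
  fixes scaleC :: "complex \<Rightarrow> 'a \<Rightarrow> 'a" (infixr "*\<^sub>C" 75)
    and cinner :: "'a \<Rightarrow> 'a \<Rightarrow> complex"
  assumes scaleC_of_real: "complex_of_real r *\<^sub>C x = r *\<^sub>R x"
    and scaleC_add_right: "c *\<^sub>C (x + y) = c *\<^sub>C x + c *\<^sub>C y"
    and scaleC_add_left: "(c + d) *\<^sub>C x = c *\<^sub>C x + d *\<^sub>C x"
    and scaleC_scaleC: "c *\<^sub>C d *\<^sub>C x = (c * d) *\<^sub>C x"
    and cinner_commute: "cinner x y = cnj (cinner y x)"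
    and cinner_add_left: "cinner (x + y) z = cinner x z + cinner y z"
    and cinner_scaleC_left: "cinner (c *\<^sub>C x) y = c * cinner x y"
    and norm_eq_sqrt_cinner: "norm x = sqrt (Re (cinner x x))"

class complex_hilbert_space = complex_inner_space + complete_space

lemma scaleC_one: "1 *\<^sub>C x = (x :: 'a::complex_inner_space)"
  using scaleC_of_real[of 1 x] by simp

global_interpretation complex_space:
  vector_space "scaleC :: complex \<Rightarrow> 'a \<Rightarrow> 'a::complex_inner_space"
  by standard (simp_all add: scaleC_add_right scaleC_add_left scaleC_scaleC scaleC_one)

lemma norm_scaleC: "norm (c *\<^sub>C x) = cmod c * norm (x :: 'a::complex_inner_space)"
proof -
  have "cinner (c *\<^sub>C x) (c *\<^sub>C x) = c * cnj c * cinner x x"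
    by (metis cinner_commute cinner_scaleC_left complex_cnj_mult mult.assoc)
  also have "\<dots> = complex_of_real ((cmod c)\<^sup>2) * cinner x x"
    by (simp only: complex_norm_square)
  finally have "Re (cinner (c *\<^sub>C x) (c *\<^sub>C x)) = (cmod c)\<^sup>2 * Re (cinner x x)"
    by simp
  then show ?thesis
    by (simp add: norm_eq_sqrt_cinner real_sqrt_mult)
qed

lemma bounded_linear_scaleC:
  "bounded_linear (\<lambda>x :: 'a::complex_inner_space. c *\<^sub>C x)"
proof (rule bounded_linear_intro[where K = "cmod c"])
  show "c *\<^sub>C (r *\<^sub>R x) = r *\<^sub>R (c *\<^sub>C x)" for r and x :: 'a
    by (simp flip: scaleC_of_real add: scaleC_scaleC mult.commute)
qed (simp_all add: scaleC_add_right norm_scaleC mult.commute)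

definition infinite_dimensional :: "'a::complex_inner_space itself \<Rightarrow> bool" where
  "infinite_dimensional _ \<longleftrightarrow> \<not> (\<exists>B :: 'a set. finite B \<and> complex_space.span B = UNIV)"

definition is_onb :: "'a::complex_inner_space set \<Rightarrow> bool" where
  "is_onb E \<longleftrightarrow> (\<forall>e\<in>E. \<forall>f\<in>E. cinner e f = (if e = f then 1 else 0)) \<and>
     closure (complex_space.span E) = UNIV"

text \<open>An arbitrary but fixed orthonormal basis. The notions below that are defined through it
  (Hilbert--Schmidt and trace class operators, the Hilbert--Schmidt norm, and the trace of a
  trace class operator) do not depend on the choice.\<close>

definition some_onb :: "'a::complex_hilbert_space set" where
  "some_onb = (SOME E. is_onb E)"

text \<open>The type \<open>'a \<Rightarrow>\<^sub>L 'a\<close> consists of the bounded real-linear maps, and its norm is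
  the operator norm. Bounded operators on a complex Hilbert space are its complex-linear members.\<close>

definition complex_linear :: "('a::complex_inner_space \<Rightarrow>\<^sub>L 'a) \<Rightarrow> bool" where
  "complex_linear A \<longleftrightarrow> (\<forall>c x. A (c *\<^sub>C x) = c *\<^sub>C A x)"

definition adjoint_op :: "('a::complex_hilbert_space \<Rightarrow>\<^sub>L 'a) \<Rightarrow> 'a \<Rightarrow>\<^sub>L 'a" where
  "adjoint_op A = (THE B :: 'a \<Rightarrow>\<^sub>L 'a. \<forall>x y. cinner (A x) y = cinner x (B y))"

definition normal_op :: "('a::complex_hilbert_space \<Rightarrow>\<^sub>L 'a) \<Rightarrow> bool" where
  "normal_op A \<longleftrightarrow> A o\<^sub>L adjoint_op A = adjoint_op A o\<^sub>L A"

definition positive_op :: "('a::complex_hilbert_space \<Rightarrow>\<^sub>L 'a) \<Rightarrow> bool" where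
  "positive_op P \<longleftrightarrow> complex_linear P \<and> (\<forall>x. cinner (P x) x \<in> \<real>\<^sub>\<ge>\<^sub>0)"

definition abs_op :: "('a::complex_hilbert_space \<Rightarrow>\<^sub>L 'a) \<Rightarrow> 'a \<Rightarrow>\<^sub>L 'a" where
  "abs_op A = (THE P. positive_op P \<and> P o\<^sub>L P = adjoint_op A o\<^sub>L A)"

definition hilbert_schmidt :: "('a::complex_hilbert_space \<Rightarrow>\<^sub>L 'a) \<Rightarrow> bool" where
  "hilbert_schmidt A \<longleftrightarrow> complex_linear A \<and> (\<lambda>e. (norm (A e))\<^sup>2) summable_on some_onb"

definition hs_norm :: "('a::complex_hilbert_space \<Rightarrow>\<^sub>L 'a) \<Rightarrow> real" where
  "hs_norm A = sqrt (\<Sum>\<^sub>\<infinity>e\<in>some_onb. (norm (A e))\<^sup>2)"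

definition trace_class :: "('a::complex_hilbert_space \<Rightarrow>\<^sub>L 'a) \<Rightarrow> bool" where
  "trace_class A \<longleftrightarrow> complex_linear A \<and> (\<lambda>e. cinner (abs_op A e) e) summable_on some_onb"

definition trace_op :: "('a::complex_hilbert_space \<Rightarrow>\<^sub>L 'a) \<Rightarrow> complex" where
  "trace_op A = (\<Sum>\<^sub>\<infinity>e\<in>some_onb. cinner (A e) e)"

definition scale_op :: "complex \<Rightarrow> ('a::complex_inner_space \<Rightarrow>\<^sub>L 'a) \<Rightarrow> 'a \<Rightarrow>\<^sub>L 'a" where
  "scale_op c A = Blinfun (\<lambda>x. c *\<^sub>C x) o\<^sub>L A"

lemma scale_op_apply: "scale_op c A x = c *\<^sub>C A x"
  by (simp add: scale_op_def bounded_linear_Blinfun_apply bounded_linear_scaleC)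

definition power_op :: "('a::complex_inner_space \<Rightarrow>\<^sub>L 'a) \<Rightarrow> nat \<Rightarrow> 'a \<Rightarrow>\<^sub>L 'a" where
  "power_op A n = ((\<lambda>B. A o\<^sub>L B) ^^ n) id_blinfun"

definition poly_op :: "complex poly \<Rightarrow> ('a::complex_inner_space \<Rightarrow>\<^sub>L 'a) \<Rightarrow> 'a \<Rightarrow>\<^sub>L 'a" where
  "poly_op p A = (\<Sum>i\<le>degree p. scale_op (coeff p i) (power_op A i))"

definition poly_path ::
  "complex poly \<Rightarrow> ('a::complex_inner_space \<Rightarrow>\<^sub>L 'a) \<Rightarrow> ('a \<Rightarrow>\<^sub>L 'a) \<Rightarrow> real \<Rightarrow> 'a \<Rightarrow>\<^sub>L 'a" where
  "poly_path p N\<^sub>0 V s = poly_op p (N\<^sub>0 + s *\<^sub>R V)"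

definition taylor_remainder ::
  "complex poly \<Rightarrow> ('a::complex_inner_space \<Rightarrow>\<^sub>L 'a) \<Rightarrow> ('a \<Rightarrow>\<^sub>L 'a) \<Rightarrow> 'a \<Rightarrow>\<^sub>L 'a" where
  "taylor_remainder p N N\<^sub>0 = poly_op p N - poly_op p N\<^sub>0 -
     vector_derivative (poly_path p N\<^sub>0 (N - N\<^sub>0)) (at 0 within {0..1})"

text \<open>A function on the unit circle is represented by any function on the complex plane; only its
  values on the circle matter.\<close>

definition L1_circle :: "(complex \<Rightarrow> complex) \<Rightarrow> bool" where
  "L1_circle f \<longleftrightarrow> set_integrable lebesgue {0..2*pi} (\<lambda>t. f (cis t))"

definition L1_norm_circle :: "(complex \<Rightarrow> complex) \<Rightarrow> real" where
  "L1_norm_circle f = (LINT t:{0..2*pi}|lebesgue. cmod (f (cis t)))"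

definition circle_integral :: "(complex \<Rightarrow> complex) \<Rightarrow> complex" where
  "circle_integral f = (LINT t:{0..2*pi}|lebesgue. f (cis t) * (\<i> * cis t))"

definition fourier_coeff :: "(complex \<Rightarrow> complex) \<Rightarrow> int \<Rightarrow> complex" where
  "fourier_coeff f n =
     (LINT t:{0..2*pi}|lebesgue. f (cis t) * cis (- (of_int n * t))) / (2 * pi)"

definition H1_circle :: "(complex \<Rightarrow> complex) \<Rightarrow> bool" where
  "H1_circle f \<longleftrightarrow> L1_circle f \<and> (\<forall>n<0. fourier_coeff f n = 0)"

definition trace_formula ::
  "('a::complex_hilbert_space \<Rightarrow>\<^sub>L 'a) \<Rightarrow> ('a \<Rightarrow>\<^sub>L 'a) \<Rightarrow> (complex \<Rightarrow> complex) \<Rightarrow> bool" where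
  "trace_formula N N\<^sub>0 \<eta> \<longleftrightarrow> (\<forall>p :: complex poly.
     trace_op (taylor_remainder p N N\<^sub>0) =
       circle_integral (\<lambda>z. poly (pderiv (pderiv p)) z * \<eta> z))"

end

theory Submission
  imports Defs
begin

text \<open>Put \<open>T\<^sub>s = N\<^sub>0 + s V\<close>, a contraction. Taylor's formula and the cyclicity of the trace give
  \<open>Tr (z\<^sup>n\<^sup>+\<^sup>2 remainder) = (n + 2) \<integral>\<^sub>0\<^sup>1 (1 - s) \<Sum>\<^sub>a\<^sub>+\<^sub>b\<^sub>=\<^sub>n Tr (V T\<^sub>s\<^sup>a V T\<^sub>s\<^sup>b) ds\<close>. On the Hilbert space of
  Hilbert--Schmidt operators left and right multiplication by \<open>T\<^sub>s\<close> commute, so the inner sum is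
  \<open>(n + 1) \<integral>\<^sub>0\<^sup>1 \<langle>W\<^sub>t\<^sup>n V, V\<^sup>*\<rangle> dt\<close> with the contraction \<open>W\<^sub>t X = t T\<^sub>s X + (1 - t) X T\<^sub>s\<close>. The operator Poisson
  kernel of a contraction is positive with mean 1; the Abel means of the moments are therefore
  densities of \<open>L\<^sup>1\<close> norm at most \<open>\<integral>\<^sub>0\<^sup>1 (1 - s) ds \<parallel>V\<parallel>\<^sub>2\<^sup>2 = \<parallel>V\<parallel>\<^sub>2\<^sup>2 / 2\<close>.

  To obtain a function rather than a measure in the limit, \<open>V\<close> is approximated in the Hilbert--Schmidt
  norm by \<open>V R V\<close>, and the segment is cut at \<open>s = \<delta>\<close>. Strict convexity of the ball makes
  \<open>\<Sum>\<^sub>a \<parallel>V T\<^sub>s\<^sup>a V\<parallel>\<^sub>2\<^sup>2\<close> finite for \<open>0 < s < 1\<close>, so the moments for \<open>V R V\<close> are \<open>O(1 / n)\<close> and come from a square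
  integrable function. The loss of \<open>\<epsilon>\<close> occurs in summing the successive differences.\<close>

section \<open>Complex Hilbert spaces\<close>

text \<open>A bound on the moments as a functional on polynomials yields, by itself, only a measure
  on the circle. But the functionals given by integrable functions form a norm closed set, and those
  with finitely many nonzero moments belong to it with almost the same bound; so it suffices to
  approximate the moments in norm. The cut at \<open>\<delta>\<close> is made because square sums
  along the orbit of \<open>T\<^sub>s\<close> are only bounded by a multiple of 1 / (s (1 - s)). The
  Taylor weight 1 - s compensates at s = 1 and nothing does at s = 0, while the piece s <
  \<open>\<delta>\<close> is small in norm. The form V R V has a factor V at both ends, so that a
  rotation under the trace places each power of \<open>T\<^sub>s\<close> between two factors V: the
  left one gives decay along the orbit, the right one makes the sum over a basis finite. Positivity
  concerns an operator paired with itself, whereas the moments pair V with its adjoint. A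
  Cauchy-Schwarz inequality with a free weight covers mixed pairings at the cost of the product of
  the two norms, which keeps the constant \<open>1/2\<close>.\<close>

lemma scaleC_diff_right: "c *\<^sub>C (x - (y :: 'a::complex_inner_space)) = c *\<^sub>C x - c *\<^sub>C y"
  by (rule complex_space.scale_right_diff_distrib)

lemma scaleC_scaleR: "c *\<^sub>C r *\<^sub>R (x :: 'a::complex_inner_space) = r *\<^sub>R c *\<^sub>C x"
  by (metis scaleC_of_real scaleC_scaleC mult.commute)

lemma cinner_zero_left [simp]: "cinner 0 (x :: 'a::complex_inner_space) = 0"
  by (metis add_cancel_left_left cinner_add_left)

lemma cinner_zero_right [simp]: "cinner (x :: 'a::complex_inner_space) 0 = 0"
  by (metis cinner_commute cinner_zero_left complex_cnj_zero)

lemma cinner_add_right: "cinner x (y + z :: 'a::complex_inner_space) = cinner x y + cinner x z"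
  by (metis cinner_commute cinner_add_left complex_cnj_add)

lemma cinner_scaleC_right: "cinner x (c *\<^sub>C y :: 'a::complex_inner_space) = cnj c * cinner x y"
  by (metis cinner_commute cinner_scaleC_left complex_cnj_mult)

lemma cinner_minus_left: "cinner (- x) (y :: 'a::complex_inner_space) = - cinner x y"
  by (metis add.right_inverse add_eq_0_iff cinner_add_left cinner_zero_left)

lemma cinner_minus_right: "cinner x (- y :: 'a::complex_inner_space) = - cinner x y"
  by (metis cinner_commute cinner_minus_left complex_cnj_minus)

lemma cinner_diff_left: "cinner (x - y) (z :: 'a::complex_inner_space) = cinner x z - cinner y z"
  by (metis add_uminus_conv_diff cinner_add_left cinner_minus_left)

lemma cinner_diff_right: "cinner x (y - z :: 'a::complex_inner_space) = cinner x y - cinner x z"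
  by (metis add_uminus_conv_diff cinner_add_right cinner_minus_right)

lemma cinner_scaleR_left: "cinner (r *\<^sub>R x) (y :: 'a::complex_inner_space) = of_real r * cinner x y"
  by (metis cinner_scaleC_left scaleC_of_real)

lemma cinner_scaleR_right: "cinner x (r *\<^sub>R y :: 'a::complex_inner_space) = of_real r * cinner x y"
  by (metis cinner_scaleC_right scaleC_of_real complex_cnj_complex_of_real)

lemma cinner_sum_right: "cinner x (sum f A :: 'a::complex_inner_space) = (\<Sum>i\<in>A. cinner x (f i))"
  by (induction A rule: infinite_finite_induct) (auto simp: cinner_add_right)

lemma cinner_self: "cinner x (x :: 'a::complex_inner_space) = of_real ((norm x)\<^sup>2)"
proof -
  have "Im (cinner x x) = 0"
    using cinner_commute[of x x] by (metis complex_cnj_cancel_iff cnj.simps(2) equal_neg_zero)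
  moreover have "(norm x)\<^sup>2 = Re (cinner x x)"
    by (smt (verit) norm_eq_sqrt_cinner norm_ge_zero real_sqrt_ge_0_iff real_sqrt_pow2)
  ultimately show ?thesis
    by (simp add: complex_eq_iff)
qed

lemma Re_cinner_commute: "Re (cinner x (y :: 'a::complex_inner_space)) = Re (cinner y x)"
  by (metis cinner_commute complex_cnj cnj.simps(1))

lemma norm_add_square:
  "(norm (x + y :: 'a::complex_inner_space))\<^sup>2 = (norm x)\<^sup>2 + 2 * Re (cinner x y) + (norm y)\<^sup>2"
proof -
  have "cinner (x + y) (x + y) = cinner x x + cinner x y + cnj (cinner x y) + cinner y y"
    by (metis cinner_add_left cinner_add_right cinner_commute add.assoc)
  then have "complex_of_real ((norm (x + y))\<^sup>2) = of_real ((norm x)\<^sup>2) + cinner x y + cnj (cinner x y) + of_real ((norm y)\<^sup>2)"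
    by (simp only: cinner_self)
  from arg_cong[OF this, of Re] show ?thesis by (simp del: of_real_power)
qed

lemma norm_diff_square:
  "(norm (x - y :: 'a::complex_inner_space))\<^sup>2 = (norm x)\<^sup>2 - 2 * Re (cinner x y) + (norm y)\<^sup>2"
  using norm_add_square[of x "- y"] by (simp add: cinner_minus_right)

lemma cauchy_schwarz: "cmod (cinner x (y :: 'a::complex_inner_space)) \<le> norm x * norm y"
proof (cases "y = 0")
  case False
  define c where "c = cinner x y / of_real ((norm y)\<^sup>2)"
  have "0 \<le> (norm (x - c *\<^sub>C y))\<^sup>2" by simp
  also have "\<dots> = (norm x)\<^sup>2 - 2 * Re (cnj c * cinner x y) + (cmod c)\<^sup>2 * (norm y)\<^sup>2"
    by (simp add: norm_diff_square cinner_scaleC_right norm_scaleC power_mult_distrib)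
  also have "cnj c * cinner x y = of_real ((cmod (cinner x y))\<^sup>2 / (norm y)\<^sup>2)"
    unfolding c_def by (simp add: mult.commute flip: complex_norm_square)
  also have "(cmod c)\<^sup>2 * (norm y)\<^sup>2 = (cmod (cinner x y))\<^sup>2 / (norm y)\<^sup>2"
    using False unfolding c_def by (simp add: norm_divide norm_power norm_mult field_simps power2_eq_square)
  finally have "(cmod (cinner x y))\<^sup>2 / (norm y)\<^sup>2 \<le> (norm x)\<^sup>2" by simp
  then have "(cmod (cinner x y))\<^sup>2 \<le> (norm x * norm y)\<^sup>2"
    using False by (simp add: field_simps)
  then show ?thesis
    by (rule power2_le_imp_le) simp
qed simp

lemma bounded_bilinear_cinner:
  "bounded_bilinear (cinner :: 'a::complex_inner_space \<Rightarrow> 'a \<Rightarrow> complex)"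
  by (rule bounded_bilinear.intro)
    (auto simp: cinner_add_left cinner_add_right cinner_scaleR_left cinner_scaleR_right
      scaleR_conv_of_real intro!: exI[of _ 1] cauchy_schwarz)

lemmas bounded_linear_cinner_left = bounded_bilinear.bounded_linear_left[OF bounded_bilinear_cinner]
lemmas bounded_linear_cinner_right = bounded_bilinear.bounded_linear_right[OF bounded_bilinear_cinner]
lemmas tendsto_cinner = bounded_bilinear.tendsto[OF bounded_bilinear_cinner]

lemma cinner_eqI:
  assumes "\<And>z. cinner z x = cinner z (y :: 'a::complex_inner_space)" shows "x = y"
proof -
  have "cinner (x - y) (x - y) = 0" using assms[of "x - y"] by (simp add: cinner_diff_right)
  then show ?thesis by (simp add: cinner_self)
qed

lemma norm_add_orthogonal:
  "cinner x y = 0 \<Longrightarrow> (norm (x + y :: 'a::complex_inner_space))\<^sup>2 = (norm x)\<^sup>2 + (norm y)\<^sup>2"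
  by (simp add: norm_add_square)

section \<open>Orthonormal systems and bases\<close>

definition orthonormal :: "'a::complex_inner_space set \<Rightarrow> bool" where
  "orthonormal E \<longleftrightarrow> (\<forall>e\<in>E. \<forall>f\<in>E. cinner e f = (if e = f then 1 else 0))"

lemma norm_sum_orthonormal:
  assumes "orthonormal E" "finite F" "F \<subseteq> E"
  shows "(norm (\<Sum>e\<in>F. c e *\<^sub>C e))\<^sup>2 = (\<Sum>e\<in>F. (cmod (c e))\<^sup>2)"
  using assms(2,3)
proof (induction F)
  case (insert f F)
  have "cinner (c f *\<^sub>C f) (\<Sum>e\<in>F. c e *\<^sub>C e) = 0"
    using insert assms(1) by (auto simp: cinner_sum_right cinner_scaleC_left cinner_scaleC_right orthonormal_def intro!: sum.neutral)
  moreover have "norm f = 1"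
    using insert assms(1) by (simp add: orthonormal_def norm_eq_sqrt_cinner)
  ultimately show ?case
    using insert by (simp add: norm_add_orthogonal norm_scaleC power_mult_distrib)
qed simp

text \<open>The index set is not enumerated, so convergence is that of the net of finite partial
  sums. Past a finite set F that captures the square sum up to \<open>d\<^sup>2 / 8\<close>,
  Pythagoras bounds the rest of any partial sum by \<open>d / 2\<close>.\<close>

lemma summable_orthonormal:
  fixes E :: "'a::complex_hilbert_space set"
  assumes E: "orthonormal E" and "(\<lambda>e. (cmod (c e))\<^sup>2) summable_on E"
  shows "(\<lambda>e. c e *\<^sub>C e) summable_on E"
proof -
  let ?g = "\<lambda>e. (cmod (c e))\<^sup>2"
  have "convergent_filter (filtermap (sum (\<lambda>e. c e *\<^sub>C e)) (finite_subsets_at_top E))"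
  proof -
    have "cauchy_filter (filtermap (sum (\<lambda>e. c e *\<^sub>C e)) (finite_subsets_at_top E))"
    proof (unfold cauchy_filter_metric_filtermap, intro allI impI)
      fix d :: real assume d: "d > 0"
      from assms(2) have "\<exists>F. finite F \<and> F \<subseteq> E \<and> dist (sum ?g F) (infsum ?g E) \<le> d\<^sup>2 / 8"
        using d by (intro infsum_finite_approximation) auto
      then obtain F where F: "finite F" "F \<subseteq> E" "dist (sum ?g F) (infsum ?g E) \<le> d\<^sup>2 / 8" by blast
      have tail: "norm (sum (\<lambda>e. c e *\<^sub>C e) G - sum (\<lambda>e. c e *\<^sub>C e) F) < d / 2"
        if G: "finite G" "G \<subseteq> E" "F \<subseteq> G" for G
      proof -
        have "sum ?g G \<le> infsum ?g E"
          using G assms(2) by (intro finite_sum_le_infsum) auto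
        moreover have "sum ?g G = sum ?g F + sum ?g (G - F)"
          using G by (metis sum.subset_diff add.commute)
        ultimately have "sum ?g (G - F) \<le> d\<^sup>2 / 8" using F(3) by (simp add: dist_real_def abs_if split: if_splits)
        moreover have "(norm (\<Sum>e\<in>G - F. c e *\<^sub>C e))\<^sup>2 = sum ?g (G - F)"
          using G by (intro norm_sum_orthonormal[OF E]) auto
        ultimately have "(norm (\<Sum>e\<in>G - F. c e *\<^sub>C e))\<^sup>2 < (d / 2)\<^sup>2"
          using d by (simp add: power2_eq_square)
             (smt (verit) zero_less_mult_iff)
        then have "norm (\<Sum>e\<in>G - F. c e *\<^sub>C e) < d / 2"
          by (rule power2_less_imp_less) (use d in simp)
        then show ?thesis using G F by (simp add: sum_diff)
      qed
      show "\<exists>P. eventually P (finite_subsets_at_top E) \<and>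
        (\<forall>x y. P x \<and> P y \<longrightarrow> dist (sum (\<lambda>e. c e *\<^sub>C e) x) (sum (\<lambda>e. c e *\<^sub>C e) y) < d)"
      proof (intro exI conjI allI impI)
        show "\<forall>\<^sub>F G in finite_subsets_at_top E. finite G \<and> F \<subseteq> G \<and> G \<subseteq> E"
          using F unfolding eventually_finite_subsets_at_top by blast
        fix x y assume "(finite x \<and> F \<subseteq> x \<and> x \<subseteq> E) \<and> finite y \<and> F \<subseteq> y \<and> y \<subseteq> E"
        then show "dist (sum (\<lambda>e. c e *\<^sub>C e) x) (sum (\<lambda>e. c e *\<^sub>C e) y) < d"
          using tail[of x] tail[of y] by (smt (verit) dist_norm dist_commute dist_triangle2 field_sum_of_halves)
      qed
    qed
    moreover have "filtermap (sum (\<lambda>e. c e *\<^sub>C e)) (finite_subsets_at_top E) \<noteq> bot"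
      by (simp add: filtermap_bot_iff)
    moreover have "complete (UNIV :: 'a set)" by (rule complete_UNIV)
    ultimately show ?thesis
      using complete_uniform[of "UNIV::'a set"] unfolding convergent_filter_iff by auto
  qed
  then show ?thesis
    unfolding convergent_filter_iff summable_on_def has_sum_def filterlim_def by blast
qed

lemma bessel_inequality:
  assumes "orthonormal E" "finite F" "F \<subseteq> E"
  shows "(\<Sum>e\<in>F. (cmod (cinner x e))\<^sup>2) \<le> (norm (x :: 'a::complex_inner_space))\<^sup>2"
proof -
  define y where "y = (\<Sum>e\<in>F. cinner x e *\<^sub>C e)"
  have "cinner x y = (\<Sum>e\<in>F. of_real ((cmod (cinner x e))\<^sup>2))"
    unfolding y_def by (simp add: cinner_sum_right cinner_scaleC_right mult.commute flip: complex_norm_square)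
  then have 1: "Re (cinner x y) = (\<Sum>e\<in>F. (cmod (cinner x e))\<^sup>2)" by simp
  have "0 \<le> (norm (x - y))\<^sup>2" by simp
  also have "\<dots> = (norm x)\<^sup>2 - (\<Sum>e\<in>F. (cmod (cinner x e))\<^sup>2)"
    unfolding norm_diff_square 1 using norm_sum_orthonormal[OF assms, of "cinner x"] by (simp add: y_def)
  finally show ?thesis by simp
qed

lemma bessel_summable:
  assumes "orthonormal E"
  shows "(\<lambda>e. (cmod (cinner (x :: 'a::complex_inner_space) e))\<^sup>2) summable_on E"
  by (rule nonneg_bdd_above_summable_on)
    (auto intro!: bdd_aboveI2[where M = "(norm x)\<^sup>2"] bessel_inequality[OF assms])

text \<open>Orthogonal projection onto the closed span of E without a minimisation argument: y is
  the Fourier series of x, and continuity of the inner product in its first argument transfers the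
  coefficients.\<close>

lemma orthonormal_remainder:
  fixes E :: "'a::complex_hilbert_space set"
  assumes E: "orthonormal E"
  shows "\<exists>y. ((\<lambda>e. cinner x e *\<^sub>C e) has_sum y) E \<and> (\<forall>e\<in>E. cinner (x - y) e = 0)"
proof -
  obtain y where y: "((\<lambda>e. cinner x e *\<^sub>C e) has_sum y) E"
    using summable_orthonormal[OF E bessel_summable[OF E]] by (auto simp: summable_on_def)
  have "cinner y f = cinner x f" if f: "f \<in> E" for f
  proof -
    have "((\<lambda>e. cinner (cinner x e *\<^sub>C e) f) has_sum cinner y f) E"
      using has_sum_bounded_linear[OF bounded_linear_cinner_left y] .
    moreover have "((\<lambda>e. cinner (cinner x e *\<^sub>C e) f) has_sum cinner x f) E"
    proof (rule has_sum_finite_neutralI[of "{f}"])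
      show "cinner (cinner x e *\<^sub>C e) f = 0" if "e \<in> E - {f}" for e
        using that f E by (auto simp: orthonormal_def cinner_scaleC_left)
    qed (use f E in \<open>auto simp: orthonormal_def cinner_scaleC_left\<close>)
    ultimately show ?thesis by (rule has_sum_unique)
  qed
  then show ?thesis using y by (auto simp: cinner_diff_left)
qed

lemma maximal_orthonormal_exists: "\<exists>E :: 'a::complex_inner_space set. orthonormal E \<and> (\<forall>E'. orthonormal E' \<and> E \<subseteq> E' \<longrightarrow> E' = E)"
proof -
  have "\<exists>M\<in>Collect orthonormal. \<forall>X\<in>Collect (orthonormal :: 'a set \<Rightarrow> bool). M \<subseteq> X \<longrightarrow> X = M"
  proof (rule subset_Zorn_nonempty)
    show "Collect (orthonormal :: 'a set \<Rightarrow> bool) \<noteq> {}"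
      by (auto simp: orthonormal_def intro: exI[of _ "{}"])
    fix C :: "'a set set" assume C: "C \<noteq> {}" "subset.chain (Collect orthonormal) C"
    have "cinner e f = (if e = f then 1 else 0)" if "e \<in> \<Union>C" "f \<in> \<Union>C" for e f
    proof -
      obtain A B where AB: "A \<in> C" "e \<in> A" "B \<in> C" "f \<in> B"
        using \<open>e \<in> \<Union>C\<close> \<open>f \<in> \<Union>C\<close> by blast
      have "A \<subseteq> B \<or> B \<subseteq> A" using AB C(2) by (meson subset.chain_def subset_chain_def)
      then obtain D where D: "D \<in> C" "e \<in> D" "f \<in> D" using AB by blast
      have "orthonormal D" using C(2) D(1) by (auto simp: subset_chain_def)
      then show ?thesis using D by (simp add: orthonormal_def)
    qed
    then show "\<Union>C \<in> Collect orthonormal" by (simp add: orthonormal_def)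
  qed
  then show ?thesis by blast
qed

lemma has_sum_in_closure_span:
  fixes E :: "'a::complex_hilbert_space set"
  assumes "((\<lambda>e. c e *\<^sub>C e) has_sum y) E"
  shows "y \<in> closure (complex_space.span E)"
proof (rule Lim_in_closed_set[OF closed_closure])
  show "(sum (\<lambda>e. c e *\<^sub>C e) \<longlongrightarrow> y) (finite_subsets_at_top E)"
    using assms by (simp add: has_sum_def)
  show "\<forall>\<^sub>F F in finite_subsets_at_top E. (\<Sum>e\<in>F. c e *\<^sub>C e) \<in> closure (complex_space.span E)"
    by (rule eventually_finite_subsets_at_top_weakI)
      (meson closure_subset complex_space.span_base complex_space.span_scale complex_space.span_sum subsetD)
qed simp

text \<open>Shows that the choice in \<open>some_onb\<close> is not vacuous. For a maximal E a
  nonzero remainder \<open>x - y\<close>, once normalised, could be added to E; hence every x is the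
  limit of its Fourier sums.\<close>

lemma onb_exists: "\<exists>E :: 'a::complex_hilbert_space set. is_onb E"
proof -
  obtain E :: "'a set" where E: "orthonormal E" "\<And>E'. orthonormal E' \<Longrightarrow> E \<subseteq> E' \<Longrightarrow> E' = E"
    using maximal_orthonormal_exists by metis
  have "x \<in> closure (complex_space.span E)" for x
  proof -
    obtain y where y: "((\<lambda>e. cinner x e *\<^sub>C e) has_sum y) E" "\<forall>e\<in>E. cinner (x - y) e = 0"
      using orthonormal_remainder[OF E(1)] by blast
    have "x = y"
    proof (rule ccontr)
      assume "x \<noteq> y"
      define z where "z = (1 / norm (x - y)) *\<^sub>R (x - y)"
      have z: "cinner z z = 1"
        using \<open>x \<noteq> y\<close> by (simp add: cinner_self z_def)
      have ze: "cinner z e = 0" "cinner e z = 0" if "e \<in> E" for e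
        using y(2) that cinner_commute[of e z] by (auto simp: z_def cinner_scaleR_left)
      have "orthonormal (insert z E)"
        using E(1) z ze by (auto simp: orthonormal_def)
      then have "z \<in> E" using E(2) by blast
      then show False using z ze by fastforce
    qed
    then show ?thesis using has_sum_in_closure_span[OF y(1)] by simp
  qed
  then have "closure (complex_space.span E) = UNIV" by blast
  then show ?thesis using E(1) unfolding is_onb_def orthonormal_def by blast
qed

lemma is_onb_some: "is_onb (some_onb :: 'a::complex_hilbert_space set)"
  unfolding some_onb_def by (rule someI_ex[OF onb_exists])

lemma orthonormal_some: "orthonormal (some_onb :: 'a::complex_hilbert_space set)"
  using is_onb_some[where 'a = 'a] unfolding is_onb_def orthonormal_def by (rule conjunct1)

lemma orthogonal_some_zero:
  assumes "\<And>e. e \<in> some_onb \<Longrightarrow> cinner x e = 0"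
  shows "x = (0 :: 'a::complex_hilbert_space)"
proof -
  let ?S = "{y. cinner x y = 0}"
  have "closed ?S"
    by (intro closed_Collect_eq continuous_intros linear_continuous_on bounded_linear_cinner_right)
  moreover have "complex_space.span some_onb \<subseteq> ?S"
  proof (rule complex_space.span_minimal)
    show "complex_space.subspace ?S"
      by (simp add: complex_space.subspace_def cinner_add_right cinner_scaleC_right)
  qed (use assms in blast)
  ultimately have "closure (complex_space.span some_onb) \<subseteq> ?S" by (rule closure_minimal[rotated])
  moreover have "closure (complex_space.span some_onb) = (UNIV :: 'a set)"
    using is_onb_some[where 'a = 'a] unfolding is_onb_def by (rule conjunct2)
  ultimately have "cinner x x = 0" by auto
  then show ?thesis by (simp add: cinner_self)
qed

lemma onb_expansion:
  "((\<lambda>e. cinner x e *\<^sub>C e) has_sum (x :: 'a::complex_hilbert_space)) some_onb"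
proof -
  obtain y where y: "((\<lambda>e. cinner x e *\<^sub>C e) has_sum y) some_onb" "\<forall>e\<in>some_onb. cinner (x - y) e = 0"
    using orthonormal_remainder[OF orthonormal_some] by blast
  then have "x - y = 0" by (intro orthogonal_some_zero) auto
  then show ?thesis using y by simp
qed

lemma parseval_cinner:
  "((\<lambda>e. cinner x e * cinner e y) has_sum cinner x (y :: 'a::complex_hilbert_space)) some_onb"
  using has_sum_bounded_linear[OF bounded_linear_cinner_left onb_expansion[of x], of y]
  by (simp add: cinner_scaleC_left)

lemma parseval_norm:
  "((\<lambda>e. (cmod (cinner x e))\<^sup>2) has_sum (norm (x :: 'a::complex_hilbert_space))\<^sup>2) some_onb"
proof -
  have "cinner x e * cinner e x = of_real ((cmod (cinner x e))\<^sup>2)" for e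
    by (metis cinner_commute complex_norm_square)
  with parseval_cinner[of x x] show ?thesis
    by (simp add: cinner_self has_sum_of_real_iff flip: of_real_power)
qed

section \<open>Adjoints and positive square roots\<close>

instance complex_hilbert_space \<subseteq> banach ..

lemma complex_linearD: "complex_linear A \<Longrightarrow> A (c *\<^sub>C x) = c *\<^sub>C A x"
  by (simp add: complex_linear_def)

lemma complex_linear_zero [simp]: "complex_linear 0"
  and complex_linear_id [simp]: "complex_linear id_blinfun"
  by (simp_all add: complex_linear_def)

lemma complex_linear_add [intro]: "complex_linear A \<Longrightarrow> complex_linear B \<Longrightarrow> complex_linear (A + B)"
  and complex_linear_diff [intro]: "complex_linear A \<Longrightarrow> complex_linear B \<Longrightarrow> complex_linear (A - B)"
  and complex_linear_scaleR [intro]: "complex_linear A \<Longrightarrow> complex_linear (r *\<^sub>R A)"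
  and complex_linear_scale_op [intro]: "complex_linear A \<Longrightarrow> complex_linear (scale_op c A)"
  and complex_linear_compose [intro]: "complex_linear A \<Longrightarrow> complex_linear B \<Longrightarrow> complex_linear (A o\<^sub>L B)"
  by (simp_all add: complex_linear_def blinfun.bilinear_simps scaleC_add_right scaleC_diff_right
      scaleC_scaleR scale_op_apply scaleC_scaleC mult.commute)

lemma complex_linear_limit:
  assumes "\<And>n. complex_linear (Y n)" "Y \<longlonglongrightarrow> L" shows "complex_linear L"
  unfolding complex_linear_def
proof (intro allI)
  fix c x
  have "(\<lambda>n. Y n (c *\<^sub>C x)) \<longlonglongrightarrow> L (c *\<^sub>C x)"
    by (intro blinfun.tendsto assms tendsto_const)
  moreover have "(\<lambda>n. c *\<^sub>C Y n x) \<longlonglongrightarrow> c *\<^sub>C L x"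
    by (intro bounded_linear.tendsto[OF bounded_linear_scaleC] blinfun.tendsto assms tendsto_const)
  ultimately show "L (c *\<^sub>C x) = c *\<^sub>C L x"
    using assms(1) by (simp add: complex_linearD LIMSEQ_unique)
qed

text \<open>Bessel's inequality for the representing vector of
  \<open>\<lambda>x. cinner (A x) y\<close> before that vector is known to exist. With z the
  candidate truncated to F, the sum S equals both \<open>(norm z)\<^sup>2\<close> and the pairing of
  y with \<open>A z\<close>, so S is at most \<open>norm A * norm y\<close> times its own square
  root.\<close>

lemma coefficient_bound:
  fixes A :: "'a::complex_hilbert_space \<Rightarrow>\<^sub>L 'a"
  assumes A: "complex_linear A" and F: "finite F" "F \<subseteq> some_onb"
  shows "(\<Sum>e\<in>F. (cmod (cinner y (A e)))\<^sup>2) \<le> (norm A * norm y)\<^sup>2"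
proof -
  define z where "z = (\<Sum>e\<in>F. cinner y (A e) *\<^sub>C e)"
  define S where "S = (\<Sum>e\<in>F. (cmod (cinner y (A e)))\<^sup>2)"
  have "cinner y (A z) = (\<Sum>e\<in>F. of_real ((cmod (cinner y (A e)))\<^sup>2))"
    unfolding z_def
    by (simp add: blinfun.sum_right cinner_sum_right complex_linearD[OF A] cinner_scaleC_right
        mult.commute flip: complex_norm_square)
  then have "cinner y (A z) = of_real S" by (simp add: S_def)
  moreover have "S \<ge> 0" unfolding S_def by (intro sum_nonneg) simp
  ultimately have "S = cmod (cinner y (A z))" by simp
  also have "\<dots> \<le> norm y * norm (A z)" by (rule cauchy_schwarz)
  also have "\<dots> \<le> norm y * (norm A * norm z)" by (intro mult_left_mono norm_blinfun) simp
  finally have 1: "S \<le> norm A * norm y * norm z" by (simp add: mult_ac)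
  have 2: "(norm z)\<^sup>2 = S"
    unfolding z_def S_def by (rule norm_sum_orthonormal[OF orthonormal_some F])
  show ?thesis
  proof (cases "norm z = 0")
    case False
    then have "norm z * norm z \<le> norm A * norm y * norm z" using 1 2 by (simp add: power2_eq_square)
    then have "norm z \<le> norm A * norm y" using False by simp
    then have "(norm z)\<^sup>2 \<le> (norm A * norm y)\<^sup>2" by (intro power_mono) auto
    then show ?thesis using 2 by (simp add: S_def)
  qed (use 2 in \<open>simp add: S_def\<close>)
qed

text \<open>The representing vector is written down as a Fourier series with coefficients
  \<open>cinner y (A e)\<close>, which \<open>coefficient_bound\<close> makes square
  summable.\<close>

lemma adjoint_exists:
  fixes A :: "'a::complex_hilbert_space \<Rightarrow>\<^sub>L 'a"
  assumes A: "complex_linear A"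
  shows "\<exists>B :: 'a \<Rightarrow>\<^sub>L 'a. \<forall>x y. cinner (A x) y = cinner x (B y)"
proof -
  have "\<exists>z. \<forall>x. cinner (A x) y = cinner x z" for y
  proof -
    have "(\<lambda>e. (cmod (cinner y (A e)))\<^sup>2) summable_on some_onb"
      by (rule nonneg_bdd_above_summable_on)
        (auto intro!: bdd_aboveI2 coefficient_bound[OF A])
    then obtain z where z: "((\<lambda>e. cinner y (A e) *\<^sub>C e) has_sum z) some_onb"
      using summable_orthonormal[OF orthonormal_some, of "\<lambda>e. cinner y (A e)"]
      by (auto simp: summable_on_def)
    have "cinner (A x) y = cinner x z" for x
    proof -
      have "((\<lambda>e. A (cinner x e *\<^sub>C e)) has_sum A x) some_onb"
        by (rule has_sum_bounded_linear[OF blinfun.bounded_linear_right onb_expansion])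
      from has_sum_bounded_linear[OF bounded_linear_cinner_left this, of y]
      have "((\<lambda>e. cinner x e * cinner (A e) y) has_sum cinner (A x) y) some_onb"
        by (simp add: complex_linearD[OF A] cinner_scaleC_left)
      moreover have "((\<lambda>e. cinner x e * cinner (A e) y) has_sum cinner x z) some_onb"
        using has_sum_bounded_linear[OF bounded_linear_cinner_right z, of x]
        by (simp add: cinner_scaleC_right mult.commute flip: cinner_commute)
      ultimately show ?thesis by (rule has_sum_unique)
    qed
    then show ?thesis by blast
  qed
  then obtain B where B: "\<And>x y. cinner (A x) y = cinner x (B y)" by metis
  have "bounded_linear B"
  proof (rule bounded_linear_intro)
    show "B (x + y) = B x + B y" for x y
      by (rule cinner_eqI) (simp add: cinner_add_right flip: B)
    show "B (r *\<^sub>R x) = r *\<^sub>R B x" for r x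
      by (rule cinner_eqI) (simp add: cinner_scaleR_right flip: B)
    show "norm (B y) \<le> norm y * norm A" for y
    proof -
      have "(norm (B y))\<^sup>2 = Re (cinner (A (B y)) y)" by (simp add: B cinner_self)
      also have "\<dots> \<le> norm (A (B y)) * norm y"
        by (meson cauchy_schwarz complex_Re_le_cmod order_trans)
      also have "\<dots> \<le> norm A * norm (B y) * norm y" by (intro mult_right_mono norm_blinfun) simp
      finally have "norm (B y) * norm (B y) \<le> (norm y * norm A) * norm (B y)"
        by (simp add: power2_eq_square mult_ac)
      then show ?thesis by (cases "norm (B y) = 0") auto
    qed
  qed
  then show ?thesis using B by (intro exI[of _ "Blinfun B"]) (simp add: bounded_linear_Blinfun_apply)
qed

context
  fixes A :: "'a::complex_hilbert_space \<Rightarrow>\<^sub>L 'a"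
  assumes A: "complex_linear A"
begin

lemma cinner_adjoint_left: "cinner (A x) y = cinner x (adjoint_op A y)"
proof -
  have "\<exists>!B :: 'a \<Rightarrow>\<^sub>L 'a. \<forall>x y. cinner (A x) y = cinner x (B y)"
  proof (rule ex_ex1I[OF adjoint_exists[OF A]])
    fix B C :: "'a \<Rightarrow>\<^sub>L 'a"
    assume "\<forall>x y. cinner (A x) y = cinner x (B y)" "\<forall>x y. cinner (A x) y = cinner x (C y)"
    then show "B = C" by (intro blinfun_eqI cinner_eqI) simp
  qed
  from theI'[OF this] show ?thesis unfolding adjoint_op_def by blast
qed

lemma cinner_adjoint_right: "cinner x (A y) = cinner (adjoint_op A x) y"
  by (metis cinner_adjoint_left cinner_commute)

lemma complex_linear_adjoint: "complex_linear (adjoint_op A)"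
  unfolding complex_linear_def
  by (intro allI cinner_eqI) (simp add: cinner_scaleC_right flip: cinner_adjoint_left)

lemma norm_adjoint_le: "norm (adjoint_op A) \<le> norm A"
proof (rule norm_blinfun_bound)
  fix y
  have "(norm (adjoint_op A y))\<^sup>2 = Re (cinner (A (adjoint_op A y)) y)"
    by (simp add: cinner_adjoint_left cinner_self)
  also have "\<dots> \<le> norm (A (adjoint_op A y)) * norm y"
    by (meson cauchy_schwarz complex_Re_le_cmod order_trans)
  also have "\<dots> \<le> norm A * norm (adjoint_op A y) * norm y"
    by (intro mult_right_mono norm_blinfun) simp
  finally have "norm (adjoint_op A y) * norm (adjoint_op A y) \<le> (norm A * norm y) * norm (adjoint_op A y)"
    by (simp add: power2_eq_square mult_ac)
  then show "norm (adjoint_op A y) \<le> norm A * norm y"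
    by (cases "norm (adjoint_op A y) = 0") auto
qed simp

end

lemma adjoint_unique:
  fixes A B :: "'a::complex_hilbert_space \<Rightarrow>\<^sub>L 'a"
  assumes "complex_linear A" "\<And>x y. cinner (A x) y = cinner x (B y)"
  shows "adjoint_op A = B"
  by (intro blinfun_eqI cinner_eqI) (simp add: assms(2) flip: cinner_adjoint_left[OF assms(1)])

lemma adjoint_adjoint: "complex_linear A \<Longrightarrow> adjoint_op (adjoint_op A) = A"
  by (rule adjoint_unique) (simp_all add: complex_linear_adjoint flip: cinner_adjoint_right)

lemma adjoint_add:
  "complex_linear A \<Longrightarrow> complex_linear B \<Longrightarrow> adjoint_op (A + B) = adjoint_op A + adjoint_op B"
  by (rule adjoint_unique)
    (auto simp: blinfun.bilinear_simps cinner_add_left cinner_add_right cinner_adjoint_left)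

lemma adjoint_diff:
  "complex_linear A \<Longrightarrow> complex_linear B \<Longrightarrow> adjoint_op (A - B) = adjoint_op A - adjoint_op B"
  by (rule adjoint_unique)
    (auto simp: blinfun.bilinear_simps cinner_diff_left cinner_diff_right cinner_adjoint_left)

lemma adjoint_scale: "complex_linear A \<Longrightarrow> adjoint_op (scale_op c A) = scale_op (cnj c) (adjoint_op A)"
  by (rule adjoint_unique)
    (auto simp: scale_op_apply cinner_scaleC_left cinner_scaleC_right cinner_adjoint_left)

lemma adjoint_compose:
  "complex_linear A \<Longrightarrow> complex_linear B \<Longrightarrow> adjoint_op (A o\<^sub>L B) = adjoint_op B o\<^sub>L adjoint_op A"
  by (rule adjoint_unique) (auto simp: cinner_adjoint_left)

section \<open>Positive operators and their square roots\<close>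

lemma positive_op_complex_linear: "positive_op P \<Longrightarrow> complex_linear P"
  by (simp add: positive_op_def)

lemma positive_op_Re: "positive_op P \<Longrightarrow> Re (cinner (P x) x) \<ge> 0"
  and positive_op_Im: "positive_op P \<Longrightarrow> Im (cinner (P x) x) = 0"
  by (auto simp: positive_op_def complex_nonneg_Reals_iff)

text \<open>Polarisation over the complex numbers: real values of the form at \<open>x + y\<close>
  give the imaginary part of the identity, and at \<open>\<i> *\<^sub>C x + y\<close> the real
  part.\<close>

lemma positive_op_selfadjoint:
  assumes P: "positive_op P"
  shows "cinner (P x) y = cinner x (P y)"
proof -
  have im: "Im (cinner (P x) y) + Im (cinner (P y) x) = 0" for x y
    using positive_op_Im[OF P, of "x + y"] positive_op_Im[OF P, of x] positive_op_Im[OF P, of y]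
    by (simp add: blinfun.bilinear_simps cinner_add_left cinner_add_right)
  have "Re (cinner (P x) y) = Re (cinner (P y) x)"
    using im[of "\<i> *\<^sub>C x" y]
    by (simp add: complex_linearD[OF positive_op_complex_linear[OF P]] cinner_scaleC_left cinner_scaleC_right)
  then have "cinner (P x) y = cnj (cinner (P y) x)"
    using im[of x y] by (simp add: complex_eq_iff)
  then show ?thesis by (simp flip: cinner_commute)
qed

lemma positive_opI:
  assumes "complex_linear P" "\<And>x y. cinner (P x) y = cinner x (P y)" "\<And>x. Re (cinner (P x) x) \<ge> 0"
  shows "positive_op P"
proof -
  have "Im (cinner (P x) x) = 0" for x
    using assms(2)[of x x] cinner_commute[of x "P x"] by (simp add: complex_eq_iff)
  then show ?thesis using assms by (simp add: positive_op_def complex_nonneg_Reals_iff)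
qed

text \<open>The inequality \<open>P\<^sup>2 \<le> P\<close>, obtained from positivity of P at the
  vector \<open>x - P x\<close>, before square roots are available. It also lets a bound on the form
  bound the norm.\<close>

lemma positive_contraction_norm_square:
  assumes P: "positive_op P" and "\<And>x. Re (cinner (P x) x) \<le> (norm x)\<^sup>2"
  shows "(norm (P x))\<^sup>2 \<le> Re (cinner (P x) x)"
proof -
  have "0 \<le> Re (cinner (P (x - P x)) (x - P x))" by (rule positive_op_Re[OF P])
  also have "\<dots> = Re (cinner (P x) x) - 2 * (norm (P x))\<^sup>2 + Re (cinner (P (P x)) (P x))"
    using positive_op_selfadjoint[OF P, of "P x" x]
    by (simp add: blinfun.bilinear_simps cinner_diff_left cinner_diff_right cinner_self)
  also have "\<dots> \<le> Re (cinner (P x) x) - 2 * (norm (P x))\<^sup>2 + (norm (P x))\<^sup>2"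
    using assms(2)[of "P x"] by simp
  finally show ?thesis by simp
qed

lemma Re_cinner_le:
  fixes A :: "'a::complex_inner_space \<Rightarrow>\<^sub>L 'a"
  shows "Re (cinner (A x) x) \<le> norm A * (norm x)\<^sup>2"
proof -
  have "Re (cinner (A x) x) \<le> norm (A x) * norm x"
    by (meson cauchy_schwarz complex_Re_le_cmod order_trans)
  also have "\<dots> \<le> norm A * norm x * norm x" by (intro mult_right_mono norm_blinfun) simp
  finally show ?thesis by (simp add: power2_eq_square mult_ac)
qed

lemma positive_op_one_minus:
  assumes P: "positive_op P" and "norm P \<le> 1"
  shows "positive_op (id_blinfun - P)" "Re (cinner ((id_blinfun - P) x) x) \<le> (norm x)\<^sup>2"
proof -
  have "Re (cinner (P x) x) \<le> (norm x)\<^sup>2" for x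
    using Re_cinner_le[of P x] mult_right_mono[OF assms(2), of "(norm x)\<^sup>2"] by simp
  then show "positive_op (id_blinfun - P)"
    using positive_op_complex_linear[OF P]
    by (intro positive_opI)
      (auto simp: blinfun.bilinear_simps cinner_diff_left cinner_diff_right cinner_self positive_op_selfadjoint[OF P])
  show "Re (cinner ((id_blinfun - P) x) x) \<le> (norm x)\<^sup>2"
    using positive_op_Re[OF P, of x] by (simp add: blinfun.bilinear_simps cinner_diff_left cinner_self)
qed

lemma positive_op_scaleR: "positive_op P \<Longrightarrow> r \<ge> 0 \<Longrightarrow> positive_op (r *\<^sub>R P)"
  using positive_op_Re[of P] by (intro positive_opI)
   (auto simp: positive_op_complex_linear blinfun.bilinear_simps
     cinner_scaleR_left cinner_scaleR_right simp flip: positive_op_selfadjoint[of P])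

lemma positive_op_adjoint_compose:
  "complex_linear A \<Longrightarrow> positive_op (adjoint_op A o\<^sub>L A)"
  by (intro positive_opI) (auto simp: complex_linear_adjoint cinner_self simp flip: cinner_adjoint_left cinner_adjoint_right)

text \<open>For \<open>0 \<le> B \<le> 1\<close> the iteration \<open>Y \<mapsto> (B + Y\<^sup>2) / 2\<close> started at 0 converges to \<open>1 - \<surd>(1 - B)\<close>. It is
  dominated by the same iteration for the number 1.\<close>

primrec sqrt_iter :: "('a::real_normed_vector \<Rightarrow>\<^sub>L 'a) \<Rightarrow> nat \<Rightarrow> 'a \<Rightarrow>\<^sub>L 'a" where
  "sqrt_iter B 0 = 0"
| "sqrt_iter B (Suc n) = (1/2) *\<^sub>R (B + (sqrt_iter B n o\<^sub>L sqrt_iter B n))"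

primrec sqrt_iter_real :: "nat \<Rightarrow> real" where
  "sqrt_iter_real 0 = 0"
| "sqrt_iter_real (Suc n) = (1 + (sqrt_iter_real n)\<^sup>2) / 2"

lemma sqrt_iter_real_bounds: "0 \<le> sqrt_iter_real n \<and> sqrt_iter_real n \<le> 1"
  by (induction n) (auto simp: power_le_one)

lemma sqrt_iter_real_incseq: "incseq sqrt_iter_real"
proof (rule incseq_SucI)
  fix n
  have "0 \<le> (1 - sqrt_iter_real n)\<^sup>2" by simp
  then show "sqrt_iter_real n \<le> sqrt_iter_real (Suc n)" by (simp add: power2_diff)
qed

lemma norm_sqrt_iter:
  assumes "norm B \<le> 1" shows "norm (sqrt_iter B n) \<le> sqrt_iter_real n"
proof (induction n)
  case (Suc n)
  have "norm (sqrt_iter B n o\<^sub>L sqrt_iter B n) \<le> norm (sqrt_iter B n) * norm (sqrt_iter B n)"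
    by (rule norm_blinfun_compose)
  also have "\<dots> \<le> (sqrt_iter_real n)\<^sup>2"
    unfolding power2_eq_square using Suc sqrt_iter_real_bounds by (intro mult_mono) auto
  finally have "norm (B + (sqrt_iter B n o\<^sub>L sqrt_iter B n)) \<le> 1 + (sqrt_iter_real n)\<^sup>2"
    using assms norm_triangle_ineq[of B "sqrt_iter B n o\<^sub>L sqrt_iter B n"] by linarith
  then show ?case by simp
qed simp

text \<open>The factorisation X^2 - Y^2 = X (X - Y) + (X - Y) Y requires no commutation and reads
  the same for numbers, so each increment is dominated by the scalar one. The scalar sequence is
  increasing and bounded, which makes the iteration Cauchy in operator norm.\<close>

lemma norm_sqrt_iter_diff:
  assumes "norm B \<le> 1"
  shows "norm (sqrt_iter B (Suc n) - sqrt_iter B n) \<le> sqrt_iter_real (Suc n) - sqrt_iter_real n"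
proof (induction n)
  case (Suc n)
  define X where "X = sqrt_iter B (Suc n)" 
  define Y where "Y = sqrt_iter B n"
  define x where "x = sqrt_iter_real (Suc n)"
  define y where "y = sqrt_iter_real n"
  have b: "norm X \<le> x" "norm Y \<le> y" "norm (X - Y) \<le> x - y"
    unfolding X_def Y_def x_def y_def by (rule norm_sqrt_iter[OF assms] Suc)+
  have nn: "0 \<le> x" "0 \<le> x - y"
    using b norm_ge_zero order_trans by blast+
  have "sqrt_iter B (Suc (Suc n)) - sqrt_iter B (Suc n) = (1/2) *\<^sub>R ((X o\<^sub>L X) - (Y o\<^sub>L Y))"
  proof -
    have "sqrt_iter B (Suc (Suc n)) = (1/2) *\<^sub>R (B + (X o\<^sub>L X))" by (simp add: X_def)
    moreover have "sqrt_iter B (Suc n) = (1/2) *\<^sub>R (B + (Y o\<^sub>L Y))" by (simp add: Y_def)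
    ultimately show ?thesis by (simp only: flip: scaleR_diff_right) simp
  qed
  also have "(X o\<^sub>L X) - (Y o\<^sub>L Y) = (X o\<^sub>L (X - Y)) + ((X - Y) o\<^sub>L Y)"
    by (intro blinfun_eqI) (simp add: blinfun.bilinear_simps)
  also have "norm ((1/2) *\<^sub>R ((X o\<^sub>L (X - Y)) + ((X - Y) o\<^sub>L Y))) \<le> (norm X * norm (X - Y) + norm (X - Y) * norm Y) / 2"
    using norm_blinfun_compose[of X "X - Y"] norm_blinfun_compose[of "X - Y" Y]
      norm_triangle_ineq[of "X o\<^sub>L (X - Y)" "(X - Y) o\<^sub>L Y"] by simp
  also have "\<dots> \<le> (x * (x - y) + (x - y) * y) / 2"
  proof -
    have "norm X * norm (X - Y) \<le> x * (x - y)"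
      using b nn by (intro mult_mono) auto
    moreover have "norm (X - Y) * norm Y \<le> (x - y) * y"
      using b nn by (intro mult_mono) auto
    ultimately show ?thesis by simp
  qed
  also have "\<dots> = sqrt_iter_real (Suc (Suc n)) - sqrt_iter_real (Suc n)"
  proof -
    have "sqrt_iter_real (Suc (Suc n)) = (1 + x\<^sup>2) / 2" by (simp add: x_def)
    moreover have "sqrt_iter_real (Suc n) = (1 + y\<^sup>2) / 2" by (simp add: y_def)
    ultimately show ?thesis by (simp del: sqrt_iter_real.simps add: field_simps power2_eq_square)
  qed
  finally show ?case .
qed (use assms in simp)

lemma sqrt_iter_convergent:
  fixes B :: "'a::complex_hilbert_space \<Rightarrow>\<^sub>L 'a"
  assumes "norm B \<le> 1" shows "convergent (sqrt_iter B)"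
proof -
  have d: "norm (sqrt_iter B (n + k) - sqrt_iter B n) \<le> sqrt_iter_real (n + k) - sqrt_iter_real n" for n k
  proof (induction k)
    case (Suc k)
    have "norm (sqrt_iter B (n + Suc k) - sqrt_iter B n) \<le>
        norm (sqrt_iter B (Suc (n + k)) - sqrt_iter B (n + k)) + norm (sqrt_iter B (n + k) - sqrt_iter B n)"
      by (metis add_Suc_right diff_add_cancel norm_triangle_ineq add_diff_eq)
    then show ?case using norm_sqrt_iter_diff[OF assms, of "n + k"] Suc by (simp del: sqrt_iter.simps sqrt_iter_real.simps)
  qed simp
  have "Bseq sqrt_iter_real"
    using sqrt_iter_real_bounds by (intro BseqI'[of _ 1]) (auto simp: abs_le_iff intro: order_trans)
  then have "Cauchy sqrt_iter_real"
    using sqrt_iter_real_incseq by (simp add: Bseq_monoseq_convergent convergent_Cauchy incseq_imp_monoseq)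
  have "Cauchy (sqrt_iter B)"
  proof (rule CauchyI')
    fix \<epsilon> :: real assume "\<epsilon> > 0"
    then obtain M where M: "\<And>m n. m \<ge> M \<Longrightarrow> n \<ge> M \<Longrightarrow> dist (sqrt_iter_real m) (sqrt_iter_real n) < \<epsilon>"
      using \<open>Cauchy sqrt_iter_real\<close> unfolding Cauchy_def by blast
    have "dist (sqrt_iter B m) (sqrt_iter B n) < \<epsilon>" if "m \<ge> M" "n > m" for m n
    proof -
      obtain k where k: "n = m + k" using \<open>n > m\<close> less_imp_add_positive by blast
      have "dist (sqrt_iter B m) (sqrt_iter B n) \<le> sqrt_iter_real n - sqrt_iter_real m"
        using d[of m k] by (simp add: k dist_norm norm_minus_commute)
      then show ?thesis using M[of n m] that by (auto simp: dist_real_def)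
    qed
    then show "\<exists>M. \<forall>m\<ge>M. \<forall>n>m. dist (sqrt_iter B m) (sqrt_iter B n) < \<epsilon>" by blast
  qed
  then show ?thesis by (rule Cauchy_convergent)
qed

text \<open>Commutation with everything that commutes with A passes from the iterates, polynomials
  in \<open>id_blinfun - A\<close>, to the limit; uniqueness of the square root rests on it.\<close>

lemma positive_sqrt_exists_contraction:
  fixes A :: "'a::complex_hilbert_space \<Rightarrow>\<^sub>L 'a"
  assumes A: "positive_op A" "norm A \<le> 1"
  shows "\<exists>P. positive_op P \<and> P o\<^sub>L P = A \<and> (\<forall>C. C o\<^sub>L A = A o\<^sub>L C \<longrightarrow> C o\<^sub>L P = P o\<^sub>L C)"
proof -
  define B where "B = id_blinfun - A"
  have B: "positive_op B" "\<And>x. Re (cinner (B x) x) \<le> (norm x)\<^sup>2"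
    unfolding B_def using positive_op_one_minus[OF A] by auto
  have nB: "norm B \<le> 1"
  proof (rule norm_blinfun_bound)
    fix x
    have "(norm (B x))\<^sup>2 \<le> (norm x)\<^sup>2"
      using positive_contraction_norm_square[OF B, of x] B(2)[of x] by linarith
    then have "norm (B x) \<le> norm x" by (rule power2_le_imp_le) simp
    then show "norm (B x) \<le> 1 * norm x" by simp
  qed simp
  let ?Y = "sqrt_iter B"
  obtain Y where Y: "?Y \<longlonglongrightarrow> Y" using sqrt_iter_convergent[OF nB] by (auto simp: convergent_def)
  have Yeq: "Y = (1/2) *\<^sub>R (B + (Y o\<^sub>L Y))"
  proof (rule LIMSEQ_unique)
    show "(\<lambda>n. ?Y (Suc n)) \<longlonglongrightarrow> Y" using Y by (rule LIMSEQ_Suc)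
    show "(\<lambda>n. ?Y (Suc n)) \<longlonglongrightarrow> (1/2) *\<^sub>R (B + (Y o\<^sub>L Y))"
      unfolding sqrt_iter.simps
      by (intro tendsto_intros Y bounded_bilinear.tendsto[OF bounded_bilinear_blinfun_compose])
  qed
  have "norm (?Y n) \<le> 1" for n using norm_sqrt_iter[OF nB, of n] sqrt_iter_real_bounds[of n] by simp
  then have nY: "norm Y \<le> 1" using Y by (intro LIMSEQ_le_const2[OF tendsto_norm[OF Y]]) auto
  have "complex_linear (?Y n)" for n
    by (induction n) (use positive_op_complex_linear[OF B(1)] in auto)
  then have clY: "complex_linear Y" using Y by (rule complex_linear_limit)
  have saYn: "cinner (?Y n x) y = cinner x (?Y n y)" for n x y
    by (induction n arbitrary: x y)
      (auto simp: positive_op_selfadjoint[OF B(1)] blinfun.bilinear_simps cinner_scaleR_left cinner_scaleR_right cinner_add_left cinner_add_right)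
  have saY: "cinner (Y x) y = cinner x (Y y)" for x y
  proof (rule LIMSEQ_unique)
    show "(\<lambda>n. cinner (?Y n x) y) \<longlonglongrightarrow> cinner (Y x) y"
      by (intro tendsto_cinner blinfun.tendsto Y tendsto_const)
    show "(\<lambda>n. cinner (?Y n x) y) \<longlonglongrightarrow> cinner x (Y y)"
      unfolding saYn by (intro tendsto_cinner blinfun.tendsto Y tendsto_const)
  qed
  \<comment> \<open>The fixed point equation 2 Y = B + Y^2 says (1 - Y)^2 = 1 - B = A, and
    \<open>norm Y \<le> 1\<close> gives positivity.\<close>
  define P where "P = id_blinfun - Y"
  have "positive_op P"
  proof (rule positive_opI)
    show "complex_linear P" unfolding P_def using clY by auto
    show "cinner (P x) y = cinner x (P y)" for x y
      by (simp add: P_def blinfun.bilinear_simps cinner_diff_left cinner_diff_right saY)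
    show "Re (cinner (P x) x) \<ge> 0" for x
      using Re_cinner_le[of Y x] mult_right_mono[OF nY, of "(norm x)\<^sup>2"]
      by (simp add: P_def blinfun.bilinear_simps cinner_diff_left cinner_self)
  qed
  moreover have "P o\<^sub>L P = A"
  proof -
    have "2 *\<^sub>R Y = B + (Y o\<^sub>L Y)" by (subst Yeq) (simp add: scaleR_add_right)
    then have "2 *\<^sub>R Y x = B x + Y (Y x)" for x
      by (metis blinfun.add_left blinfun.scaleR_left blinfun_apply_blinfun_compose)
    then show ?thesis
      by (intro blinfun_eqI) (simp add: P_def blinfun.bilinear_simps B_def scaleR_2 algebra_simps)
  qed
  moreover have "C o\<^sub>L P = P o\<^sub>L C" if "C o\<^sub>L A = A o\<^sub>L C" for C
  proof -
    have CA: "C (A x) = A (C x)" for x using that by (metis blinfun_apply_blinfun_compose)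
    have "C (?Y n x) = ?Y n (C x)" for n x
      by (induction n arbitrary: x) (auto simp: B_def blinfun.bilinear_simps CA)
    then have c: "C o\<^sub>L ?Y n = ?Y n o\<^sub>L C" for n by (intro blinfun_eqI) simp
    have "C o\<^sub>L Y = Y o\<^sub>L C"
    proof (rule LIMSEQ_unique)
      show "(\<lambda>n. C o\<^sub>L ?Y n) \<longlonglongrightarrow> (C o\<^sub>L Y)"
        by (intro Y tendsto_const bounded_bilinear.tendsto[OF bounded_bilinear_blinfun_compose])
      show "(\<lambda>n. C o\<^sub>L ?Y n) \<longlonglongrightarrow> (Y o\<^sub>L C)"
        unfolding c by (intro Y tendsto_const bounded_bilinear.tendsto[OF bounded_bilinear_blinfun_compose])
    qed
    then have "C (Y x) = Y (C x)" for x by (metis blinfun_apply_blinfun_compose)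
    then show ?thesis by (intro blinfun_eqI) (simp add: P_def blinfun.bilinear_simps)
  qed
  ultimately show ?thesis by blast
qed

lemma positive_sqrt_exists:
  fixes A :: "'a::complex_hilbert_space \<Rightarrow>\<^sub>L 'a"
  assumes A: "positive_op A"
  shows "\<exists>P. positive_op P \<and> P o\<^sub>L P = A \<and> (\<forall>C. C o\<^sub>L A = A o\<^sub>L C \<longrightarrow> C o\<^sub>L P = P o\<^sub>L C)"
proof -
  \<comment> \<open>The summand 1 keeps the scaling factor positive when A = 0.\<close>
  define c where "c = norm A + 1"
  have c: "c > 0" by (simp add: c_def add_nonneg_pos)
  define A' where "A' = (1 / c) *\<^sub>R A"
  have "positive_op A'" unfolding A'_def using A c by (intro positive_op_scaleR) auto
  moreover have "norm A' \<le> 1" using c by (simp add: A'_def c_def field_simps)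
  ultimately obtain P where P: "positive_op P" "P o\<^sub>L P = A'" "\<And>C. C o\<^sub>L A' = A' o\<^sub>L C \<Longrightarrow> C o\<^sub>L P = P o\<^sub>L C"
    using positive_sqrt_exists_contraction by blast
  have "(sqrt c *\<^sub>R P) o\<^sub>L (sqrt c *\<^sub>R P) = c *\<^sub>R (P o\<^sub>L P)"
    using c by (intro blinfun_eqI) (simp add: blinfun.bilinear_simps)
  then have "(sqrt c *\<^sub>R P) o\<^sub>L (sqrt c *\<^sub>R P) = A" using c by (simp add: P(2) A'_def)
  moreover have "C o\<^sub>L (sqrt c *\<^sub>R P) = (sqrt c *\<^sub>R P) o\<^sub>L C" if "C o\<^sub>L A = A o\<^sub>L C" for C
  proof -
    have "C o\<^sub>L A' = (1/c) *\<^sub>R (C o\<^sub>L A)" "A' o\<^sub>L C = (1/c) *\<^sub>R (A o\<^sub>L C)"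
      by (auto intro!: blinfun_eqI simp: A'_def blinfun.bilinear_simps)
    then have "C o\<^sub>L P = P o\<^sub>L C" using that P(3) by simp
    moreover have "C o\<^sub>L (sqrt c *\<^sub>R P) = sqrt c *\<^sub>R (C o\<^sub>L P)" "(sqrt c *\<^sub>R P) o\<^sub>L C = sqrt c *\<^sub>R (P o\<^sub>L C)"
      by (auto intro!: blinfun_eqI simp: blinfun.bilinear_simps)
    ultimately show ?thesis by simp
  qed
  moreover have "positive_op (sqrt c *\<^sub>R P)" using P(1) c by (intro positive_op_scaleR) auto
  ultimately show ?thesis by (intro exI[of _ "sqrt c *\<^sub>R P"] conjI allI impI)
qed

lemma positive_op_cinner_zero:
  fixes P :: "'a::complex_hilbert_space \<Rightarrow>\<^sub>L 'a"
  assumes P: "positive_op P" and 0: "Re (cinner (P x) x) = 0"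
  shows "P x = 0"
proof -
  obtain S where S: "positive_op S" "S o\<^sub>L S = P" using positive_sqrt_exists[OF P] by blast
  have SS: "P x = S (S x)" for x using S(2) by (metis blinfun_apply_blinfun_compose)
  have "Re (cinner (P x) x) = (norm (S x))\<^sup>2"
    unfolding SS by (simp add: positive_op_selfadjoint[OF S(1), of "S x"] cinner_self)
  then show ?thesis using 0 by (simp add: SS)
qed

text \<open>S commutes with whatever commutes with its square, hence with any other positive root R,
  and (R + S) (R - S) = 0. At y = (R - S) x both forms are nonnegative with sum 0, so R y = S y = 0
  and y vanishes. This makes the description in \<open>abs_op\<close> definite.\<close>

lemma positive_sqrt_unique:
  fixes P :: "'a::complex_hilbert_space \<Rightarrow>\<^sub>L 'a"
  assumes P: "positive_op P" and Q: "positive_op Q" and PQ: "P o\<^sub>L P = Q o\<^sub>L Q"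
  shows "P = Q"
proof -
  let ?A = "Q o\<^sub>L Q"
  have "positive_op ?A"
  proof (rule positive_opI)
    show "complex_linear ?A" using positive_op_complex_linear[OF Q] by auto
    show "cinner (?A x) y = cinner x (?A y)" for x y
      by (simp add: positive_op_selfadjoint[OF Q])
    show "Re (cinner (?A x) x) \<ge> 0" for x
      using positive_op_selfadjoint[OF Q, of "Q x" x] by (simp add: cinner_self)
  qed
  then obtain S where S: "positive_op S" "S o\<^sub>L S = ?A" "\<And>C. C o\<^sub>L ?A = ?A o\<^sub>L C \<Longrightarrow> C o\<^sub>L S = S o\<^sub>L C"
    using positive_sqrt_exists by blast
  have eq: "R = S" if R: "positive_op R" "R o\<^sub>L R = ?A" for R
  proof (intro blinfun_eqI)
    fix x
    have RR: "R (R y) = S (S y)" for y using R(2) S(2) by (metis blinfun_apply_blinfun_compose)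
    have "R o\<^sub>L ?A = ?A o\<^sub>L R" unfolding R(2)[symmetric] by (intro blinfun_eqI) simp
    then have RS: "R (S y) = S (R y)" for y using S(3) by (metis blinfun_apply_blinfun_compose)
    define y where "y = R x - S x"
    have "R y + S y = 0" by (simp add: y_def blinfun.bilinear_simps RR RS)
    then have "cinner (R y) y + cinner (S y) y = 0" by (metis cinner_add_left cinner_zero_left)
    then have "Re (cinner (R y) y) + Re (cinner (S y) y) = 0" by (metis plus_complex.sel(1) zero_complex.sel(1))
    then have "Re (cinner (R y) y) = 0" "Re (cinner (S y) y) = 0"
      using positive_op_Re[OF R(1), of y] positive_op_Re[OF S(1), of y] by linarith+
    then have "R y = 0" "S y = 0" using positive_op_cinner_zero R(1) S(1) by blast+
    then have "cinner (R x - S x) y = 0"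
      by (simp add: cinner_diff_left positive_op_selfadjoint[OF R(1)] positive_op_selfadjoint[OF S(1)])
    then show "R x = S x" by (simp add: y_def cinner_self)
  qed
  show ?thesis using eq[OF P PQ] eq[OF Q refl] by simp
qed

lemma abs_op:
  fixes A :: "'a::complex_hilbert_space \<Rightarrow>\<^sub>L 'a"
  assumes A: "complex_linear A"
  shows positive_abs_op: "positive_op (abs_op A)"
    and abs_op_square: "abs_op A o\<^sub>L abs_op A = adjoint_op A o\<^sub>L A"
proof -
  obtain P where P: "positive_op P" "P o\<^sub>L P = adjoint_op A o\<^sub>L A"
    using positive_sqrt_exists[OF positive_op_adjoint_compose[OF A]] by (elim exE conjE) (rule that)
  have ex: "\<exists>!P. positive_op P \<and> P o\<^sub>L P = adjoint_op A o\<^sub>L A"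
  proof (rule ex1I)
    show "positive_op P \<and> P o\<^sub>L P = adjoint_op A o\<^sub>L A" using P by (rule conjI)
    fix Q assume Q: "positive_op Q \<and> Q o\<^sub>L Q = adjoint_op A o\<^sub>L A"
    show "Q = P" by (rule positive_sqrt_unique) (simp_all only: Q P)
  qed
  show "positive_op (abs_op A)"
    unfolding abs_op_def by (rule theI'[OF ex, THEN conjunct1])
  show "abs_op A o\<^sub>L abs_op A = adjoint_op A o\<^sub>L A"
    unfolding abs_op_def by (rule theI'[OF ex, THEN conjunct2])
qed

section \<open>Hilbert--Schmidt and trace class operators\<close>

lemma hilbert_schmidt_complex_linear: "hilbert_schmidt A \<Longrightarrow> complex_linear A"
  by (simp add: hilbert_schmidt_def)

lemma hs_norm_nonneg [simp]: "hs_norm A \<ge> 0"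
  by (simp add: hs_norm_def infsum_nonneg)

lemma hs_norm_has_sum:
  assumes "hilbert_schmidt A" shows "((\<lambda>e. (norm (A e))\<^sup>2) has_sum (hs_norm A)\<^sup>2) some_onb"
proof -
  have "(hs_norm A)\<^sup>2 = (\<Sum>\<^sub>\<infinity>e\<in>some_onb. (norm (A e))\<^sup>2)"
    unfolding hs_norm_def by (intro real_sqrt_pow2 infsum_nonneg) simp
  then show ?thesis using assms by (simp add: hilbert_schmidt_def)
qed

lemma hs_norm_finite_sum:
  assumes "hilbert_schmidt A" "finite F" "F \<subseteq> some_onb"
  shows "(\<Sum>e\<in>F. (norm (A e))\<^sup>2) \<le> (hs_norm A)\<^sup>2"
  using assms by (intro finite_sum_le_has_sum[OF hs_norm_has_sum]) auto

lemma hilbert_schmidtI: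
  fixes A :: "'a::complex_hilbert_space \<Rightarrow>\<^sub>L 'a"
  assumes "complex_linear A"
    and bound: "\<And>F. finite F \<Longrightarrow> F \<subseteq> some_onb \<Longrightarrow> (\<Sum>e\<in>F. (norm (A e))\<^sup>2) \<le> M\<^sup>2" and "M \<ge> 0"
  shows "hilbert_schmidt A" "hs_norm A \<le> M"
proof -
  have "(\<lambda>e. (norm (A e))\<^sup>2) summable_on some_onb"
    by (rule nonneg_bdd_above_summable_on) (auto intro!: bdd_aboveI2 bound)
  then show hs: "hilbert_schmidt A" using assms(1) by (simp add: hilbert_schmidt_def)
  have "(hs_norm A)\<^sup>2 \<le> M\<^sup>2"
    using bound by (intro has_sum_le_finite_sums[OF hs_norm_has_sum[OF hs]]) auto
  then show "hs_norm A \<le> M" using \<open>M \<ge> 0\<close> by (rule power2_le_imp_le)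
qed

lemma hilbert_schmidt_zero [simp]: "hilbert_schmidt 0" "hs_norm 0 = 0"
  by (simp_all add: hilbert_schmidt_def hs_norm_def)

lemma hilbert_schmidt_compose_left:
  fixes A T :: "'a::complex_hilbert_space \<Rightarrow>\<^sub>L 'a"
  assumes "complex_linear T" "hilbert_schmidt A"
  shows "hilbert_schmidt (T o\<^sub>L A)" "hs_norm (T o\<^sub>L A) \<le> norm T * hs_norm A"
proof -
  have "(\<Sum>e\<in>F. (norm ((T o\<^sub>L A) e))\<^sup>2) \<le> (norm T * hs_norm A)\<^sup>2" if "finite F" "F \<subseteq> some_onb" for F
  proof -
    have "(\<Sum>e\<in>F. (norm ((T o\<^sub>L A) e))\<^sup>2) \<le> (\<Sum>e\<in>F. (norm T)\<^sup>2 * (norm (A e))\<^sup>2)"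
      by (intro sum_mono) (auto simp: norm_blinfun intro!: power_mono simp flip: power_mult_distrib)
    also have "\<dots> = (norm T)\<^sup>2 * (\<Sum>e\<in>F. (norm (A e))\<^sup>2)" by (simp add: sum_distrib_left)
    also have "\<dots> \<le> (norm T)\<^sup>2 * (hs_norm A)\<^sup>2"
      using hs_norm_finite_sum[OF assms(2) that] by (intro mult_left_mono) auto
    finally show ?thesis by (simp add: power_mult_distrib)
  qed
  moreover have "complex_linear (T o\<^sub>L A)"
    using assms(1) hilbert_schmidt_complex_linear[OF assms(2)] by (rule complex_linear_compose)
  ultimately show "hilbert_schmidt (T o\<^sub>L A)" "hs_norm (T o\<^sub>L A) \<le> norm T * hs_norm A"
    by (auto intro!: hilbert_schmidtI[of _ "norm T * hs_norm A"])
qed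

lemma has_sum_finite_sum:
  fixes g :: "'i \<Rightarrow> 'b \<Rightarrow> 'c::topological_comm_monoid_add"
  assumes "finite F" "\<And>f. f \<in> F \<Longrightarrow> (g f has_sum s f) A"
  shows "((\<lambda>e. \<Sum>f\<in>F. g f e) has_sum (\<Sum>f\<in>F. s f)) A"
  using assms by (induction F rule: finite_induct) (auto intro: has_sum_add)

text \<open>Parseval expands each \<open>(norm (adjoint_op A f))\<^sup>2\<close> over the basis, and
  Bessel bounds the inner sum over the finite set F; so only a finite sum is exchanged with an
  infinite one. Equality of the norms follows from \<open>adjoint_adjoint\<close>.\<close>

lemma hilbert_schmidt_adjoint_aux:
  fixes A :: "'a::complex_hilbert_space \<Rightarrow>\<^sub>L 'a"
  assumes A: "hilbert_schmidt A"
  shows "hilbert_schmidt (adjoint_op A) \<and> hs_norm (adjoint_op A) \<le> hs_norm A"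
proof -
  note cl = hilbert_schmidt_complex_linear[OF A]
  have "(\<Sum>f\<in>F. (norm (adjoint_op A f))\<^sup>2) \<le> (hs_norm A)\<^sup>2" if F: "finite F" "F \<subseteq> some_onb" for F
  proof -
    have "((\<lambda>e. (cmod (cinner (A e) f))\<^sup>2) has_sum (norm (adjoint_op A f))\<^sup>2) some_onb" for f
      using parseval_norm[of "adjoint_op A f"]
      by (simp add: cinner_adjoint_left[OF cl]) (metis (no_types, lifting) cinner_commute complex_mod_cnj has_sum_cong)
    then have "((\<lambda>e. \<Sum>f\<in>F. (cmod (cinner (A e) f))\<^sup>2) has_sum (\<Sum>f\<in>F. (norm (adjoint_op A f))\<^sup>2)) some_onb"
      by (intro has_sum_finite_sum F(1))
    then show ?thesis
      by (rule has_sum_mono[OF _ hs_norm_has_sum[OF A]]) (rule bessel_inequality[OF orthonormal_some F])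
  qed
  then show ?thesis
    using hilbert_schmidtI[OF complex_linear_adjoint[OF cl], of "hs_norm A"] by auto
qed

lemma hilbert_schmidt_adjoint:
  assumes "hilbert_schmidt A"
  shows "hilbert_schmidt (adjoint_op A)" "hs_norm (adjoint_op A) = hs_norm A"
  using hilbert_schmidt_adjoint_aux[OF assms] hilbert_schmidt_adjoint_aux[of "adjoint_op A"]
  by (auto simp: adjoint_adjoint[OF hilbert_schmidt_complex_linear[OF assms]])

text \<open>Reduced to left multiplication: A T is the adjoint of
  \<open>adjoint_op T o\<^sub>L adjoint_op A\<close>.\<close>

lemma hilbert_schmidt_compose_right:
  fixes A T :: "'a::complex_hilbert_space \<Rightarrow>\<^sub>L 'a"
  assumes T: "complex_linear T" and A: "hilbert_schmidt A"
  shows "hilbert_schmidt (A o\<^sub>L T)" "hs_norm (A o\<^sub>L T) \<le> hs_norm A * norm T"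
proof -
  let ?B = "adjoint_op T o\<^sub>L adjoint_op A"
  note clA = hilbert_schmidt_complex_linear[OF A]
  have B: "hilbert_schmidt ?B" "hs_norm ?B \<le> norm (adjoint_op T) * hs_norm A"
    using hilbert_schmidt_compose_left[OF complex_linear_adjoint[OF T] hilbert_schmidt_adjoint(1)[OF A]]
      hilbert_schmidt_adjoint(2)[OF A] by auto
  have "adjoint_op ?B = A o\<^sub>L T"
    using T clA by (simp add: adjoint_compose complex_linear_adjoint adjoint_adjoint)
  then show "hilbert_schmidt (A o\<^sub>L T)" "hs_norm (A o\<^sub>L T) \<le> hs_norm A * norm T"
    using hilbert_schmidt_adjoint[OF B(1)] B(2) mult_right_mono[OF norm_adjoint_le[OF T] hs_norm_nonneg[of A]]
    by (auto simp: mult.commute)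
qed

lemma hilbert_schmidt_scale:
  "hilbert_schmidt A \<Longrightarrow> hilbert_schmidt (scale_op c A)"
  unfolding hilbert_schmidt_def
  by (auto simp: scale_op_apply norm_scaleC power_mult_distrib intro: summable_on_cmult_right)

lemma hilbert_schmidt_add:
  fixes A B :: "'a::complex_hilbert_space \<Rightarrow>\<^sub>L 'a"
  assumes A: "hilbert_schmidt A" and B: "hilbert_schmidt B" shows "hilbert_schmidt (A + B)"
proof (rule hilbert_schmidtI)
  fix F :: "'a set" assume F: "finite F" "F \<subseteq> some_onb"
  have "(norm ((A + B) e))\<^sup>2 \<le> 2 * (norm (A e))\<^sup>2 + 2 * (norm (B e))\<^sup>2" for e
    using norm_add_square[of "A e" "B e"] norm_diff_square[of "A e" "B e"] zero_le_power2[of "norm (A e - B e)"]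
    by (simp add: blinfun.add_left del: zero_le_power2)
  then have "(\<Sum>e\<in>F. (norm ((A + B) e))\<^sup>2) \<le> 2 * (\<Sum>e\<in>F. (norm (A e))\<^sup>2) + 2 * (\<Sum>e\<in>F. (norm (B e))\<^sup>2)"
    by (simp add: sum_mono sum_distrib_left flip: sum.distrib)
  also have "\<dots> \<le> 2 * (hs_norm A)\<^sup>2 + 2 * (hs_norm B)\<^sup>2"
    using hs_norm_finite_sum[OF A F] hs_norm_finite_sum[OF B F] by simp
  finally show "(\<Sum>e\<in>F. (norm ((A + B) e))\<^sup>2) \<le> (sqrt (2 * (hs_norm A)\<^sup>2 + 2 * (hs_norm B)\<^sup>2))\<^sup>2"
    by simp
qed (use A B in \<open>auto simp: hilbert_schmidt_complex_linear\<close>)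

lemma scale_op_of_real: "scale_op (complex_of_real r) A = r *\<^sub>R A"
  by (intro blinfun_eqI) (simp add: scale_op_apply scaleC_of_real blinfun.scaleR_left)

lemma hilbert_schmidt_scaleR: "hilbert_schmidt A \<Longrightarrow> hilbert_schmidt (r *\<^sub>R A)"
  using hilbert_schmidt_scale[of A "complex_of_real r"] by (simp add: scale_op_of_real)

lemma hs_norm_scale: "hs_norm (scale_op c A) = cmod c * hs_norm A"
  unfolding hs_norm_def
  by (simp add: scale_op_apply norm_scaleC power_mult_distrib infsum_cmult_right' real_sqrt_mult)

lemma hs_norm_scaleR: "hs_norm (r *\<^sub>R A) = \<bar>r\<bar> * hs_norm A"
  using hs_norm_scale[of "of_real r" A] by (simp add: scale_op_of_real)

lemma hilbert_schmidt_diff: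
  fixes A B :: "'a::complex_hilbert_space \<Rightarrow>\<^sub>L 'a"
  shows "hilbert_schmidt A \<Longrightarrow> hilbert_schmidt B \<Longrightarrow> hilbert_schmidt (A - B)"
  using hilbert_schmidt_add[of A "(- 1) *\<^sub>R B"] hilbert_schmidt_scaleR[of B "- 1"] by simp

lemma hilbert_schmidt_sum:
  fixes f :: "'i \<Rightarrow> 'a::complex_hilbert_space \<Rightarrow>\<^sub>L 'a"
  shows "(\<And>i. i \<in> I \<Longrightarrow> hilbert_schmidt (f i)) \<Longrightarrow> hilbert_schmidt (sum f I)"
  by (induction I rule: infinite_finite_induct) (auto intro: hilbert_schmidt_add)

section \<open>The Hilbert-Schmidt inner product\<close>

definition hs_inner :: "('a::complex_hilbert_space \<Rightarrow>\<^sub>L 'a) \<Rightarrow> ('a \<Rightarrow>\<^sub>L 'a) \<Rightarrow> complex" where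
  "hs_inner A B = (\<Sum>\<^sub>\<infinity>e\<in>some_onb. cinner (A e) (B e))"

lemma hs_cauchy_schwarz_finite:
  fixes A B :: "'a::complex_hilbert_space \<Rightarrow>\<^sub>L 'a"
  assumes A: "hilbert_schmidt A" and B: "hilbert_schmidt B" and F: "finite F" "F \<subseteq> some_onb"
  shows "(\<Sum>e\<in>F. cmod (cinner (A e) (B e))) \<le> hs_norm A * hs_norm B"
proof -
  have "(\<Sum>e\<in>F. cmod (cinner (A e) (B e))) \<le> (\<Sum>e\<in>F. \<bar>norm (A e)\<bar> * \<bar>norm (B e)\<bar>)"
    by (intro sum_mono) (simp add: cauchy_schwarz)
  also have "\<dots> \<le> L2_set (\<lambda>e. norm (A e)) F * L2_set (\<lambda>e. norm (B e)) F"
    by (rule L2_set_mult_ineq)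
  also have "\<dots> \<le> hs_norm A * hs_norm B"
    unfolding L2_set_def using hs_norm_finite_sum[OF A F] hs_norm_finite_sum[OF B F]
    by (intro mult_mono real_le_lsqrt) (auto intro: sum_nonneg)
  finally show ?thesis .
qed

lemma hs_inner_abs_summable:
  fixes A B :: "'a::complex_hilbert_space \<Rightarrow>\<^sub>L 'a"
  assumes A: "hilbert_schmidt A" and B: "hilbert_schmidt B"
  shows "(\<lambda>e. cmod (cinner (A e) (B e))) summable_on some_onb"
  by (rule nonneg_bdd_above_summable_on)
    (auto intro!: bdd_aboveI2 hs_cauchy_schwarz_finite[OF A B])

lemma hs_inner_has_sum:
  fixes A B :: "'a::complex_hilbert_space \<Rightarrow>\<^sub>L 'a"
  assumes "hilbert_schmidt A" "hilbert_schmidt B"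
  shows "((\<lambda>e. cinner (A e) (B e)) has_sum hs_inner A B) some_onb"
  unfolding hs_inner_def using abs_summable_summable[OF hs_inner_abs_summable[OF assms]] by simp

lemma hs_cauchy_schwarz:
  fixes A B :: "'a::complex_hilbert_space \<Rightarrow>\<^sub>L 'a"
  assumes "hilbert_schmidt A" "hilbert_schmidt B"
  shows "cmod (hs_inner A B) \<le> hs_norm A * hs_norm B"
proof -
  have "cmod (hs_inner A B) \<le> (\<Sum>\<^sub>\<infinity>e\<in>some_onb. cmod (cinner (A e) (B e)))"
    unfolding hs_inner_def by (rule norm_infsum_bound[OF hs_inner_abs_summable[OF assms]])
  also have "\<dots> \<le> hs_norm A * hs_norm B"
    by (rule infsum_le_finite_sums[OF hs_inner_abs_summable[OF assms]])
      (rule hs_cauchy_schwarz_finite[OF assms])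
  finally show ?thesis .
qed

lemma hs_inner_self: "hilbert_schmidt A \<Longrightarrow> hs_inner A A = of_real ((hs_norm A)\<^sup>2)"
  using has_sum_unique[OF hs_inner_has_sum[of A A]] has_sum_of_real[OF hs_norm_has_sum[of A], where 'a = complex]
  by (simp add: cinner_self)

lemma hs_inner_commute: "hs_inner A B = cnj (hs_inner B A)"
  unfolding hs_inner_def by (subst cinner_commute) simp

lemma hs_inner_add_left:
  fixes A B C :: "'a::complex_hilbert_space \<Rightarrow>\<^sub>L 'a"
  assumes "hilbert_schmidt A" "hilbert_schmidt B" "hilbert_schmidt C"
  shows "hs_inner (A + B) C = hs_inner A C + hs_inner B C"
  using has_sum_unique[OF hs_inner_has_sum[OF hilbert_schmidt_add[OF assms(1,2)] assms(3)]]
    has_sum_add[OF hs_inner_has_sum[OF assms(1,3)] hs_inner_has_sum[OF assms(2,3)]]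
  by (simp add: blinfun.add_left cinner_add_left)

lemma hs_inner_scale_left: "hs_inner (scale_op c A) C = c * hs_inner A C"
  unfolding hs_inner_def by (simp add: scale_op_apply cinner_scaleC_left infsum_cmult_right')

lemma hs_inner_scale_right: "hs_inner C (scale_op c A) = cnj c * hs_inner C A"
  by (metis hs_inner_commute hs_inner_scale_left complex_cnj_mult)

lemma hs_inner_scaleR_left: "hs_inner (r *\<^sub>R A) C = of_real r * hs_inner A C"
  using hs_inner_scale_left[of "of_real r"] by (simp add: scale_op_of_real)

lemma hs_inner_zero [simp]: "hs_inner 0 A = 0" "hs_inner A 0 = 0"
  by (simp_all add: hs_inner_def)

lemma hs_inner_add_right:
  fixes A B C :: "'a::complex_hilbert_space \<Rightarrow>\<^sub>L 'a"
  assumes "hilbert_schmidt A" "hilbert_schmidt B" "hilbert_schmidt C"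
  shows "hs_inner C (A + B) = hs_inner C A + hs_inner C B"
  using hs_inner_add_left[OF assms] by (metis hs_inner_commute complex_cnj_add)

lemma hs_inner_diff_left:
  fixes A B C :: "'a::complex_hilbert_space \<Rightarrow>\<^sub>L 'a"
  assumes "hilbert_schmidt A" "hilbert_schmidt B" "hilbert_schmidt C"
  shows "hs_inner (A - B) C = hs_inner A C - hs_inner B C"
  using hs_inner_add_left[OF assms(1) hilbert_schmidt_scaleR[OF assms(2), of "-1"] assms(3)]
    hs_inner_scaleR_left[of "-1" B C] by simp

lemma hs_inner_diff_right:
  fixes A B C :: "'a::complex_hilbert_space \<Rightarrow>\<^sub>L 'a"
  assumes "hilbert_schmidt A" "hilbert_schmidt B" "hilbert_schmidt C"
  shows "hs_inner C (A - B) = hs_inner C A - hs_inner C B"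
  using hs_inner_diff_left[OF assms] by (metis hs_inner_commute complex_cnj_diff)

lemma hs_inner_sum_left:
  fixes f :: "'i \<Rightarrow> 'a::complex_hilbert_space \<Rightarrow>\<^sub>L 'a"
  assumes "\<And>i. i \<in> I \<Longrightarrow> hilbert_schmidt (f i)" "hilbert_schmidt C"
  shows "hs_inner (sum f I) C = (\<Sum>i\<in>I. hs_inner (f i) C)"
  using assms(1)
proof (induction I rule: infinite_finite_induct)
  case (insert i I)
  then show ?case using hs_inner_add_left[of "f i" "sum f I" C] hilbert_schmidt_sum[of I f] assms(2) by simp
qed auto

lemma hs_norm_add_square:
  fixes A B :: "'a::complex_hilbert_space \<Rightarrow>\<^sub>L 'a"
  assumes A: "hilbert_schmidt A" and B: "hilbert_schmidt B"
  shows "(hs_norm (A + B))\<^sup>2 = (hs_norm A)\<^sup>2 + 2 * Re (hs_inner A B) + (hs_norm B)\<^sup>2"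
proof -
  have "hs_inner (A + B) (A + B) = hs_inner A A + hs_inner A B + (hs_inner B A + hs_inner B B)"
    using assms by (simp add: hs_inner_add_left hs_inner_add_right hilbert_schmidt_add)
  then have "complex_of_real ((hs_norm (A + B))\<^sup>2) = of_real ((hs_norm A)\<^sup>2) + hs_inner A B + (cnj (hs_inner A B) + of_real ((hs_norm B)\<^sup>2))"
    unfolding hs_inner_self[OF hilbert_schmidt_add[OF A B]] hs_inner_self[OF A] hs_inner_self[OF B]
    by (metis hs_inner_commute)
  from arg_cong[OF this, of Re] show ?thesis by (simp del: of_real_power)
qed

text \<open>Taking adjoints preserves the norm and is additive and conjugate linear; polarisation
  then determines its effect on inner products, with no double series. Cyclicity of the trace for
  two Hilbert-Schmidt factors is a restatement.\<close>

lemma hs_inner_adjoint: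
  fixes A B :: "'a::complex_hilbert_space \<Rightarrow>\<^sub>L 'a"
  assumes A: "hilbert_schmidt A" and B: "hilbert_schmidt B"
  shows "hs_inner (adjoint_op A) (adjoint_op B) = hs_inner B A"
proof -
  note clA = hilbert_schmidt_complex_linear[OF A]
  have re: "Re (hs_inner (adjoint_op A) (adjoint_op C)) = Re (hs_inner A C)" if C: "hilbert_schmidt C" for C
  proof -
    have "hs_norm (adjoint_op A + adjoint_op C) = hs_norm (A + C)"
      using hilbert_schmidt_adjoint(2)[OF hilbert_schmidt_add[OF A C]]
      by (simp add: adjoint_add clA hilbert_schmidt_complex_linear[OF C])
    then show ?thesis
      using hs_norm_add_square[OF A C] hs_norm_add_square[OF hilbert_schmidt_adjoint(1)[OF A] hilbert_schmidt_adjoint(1)[OF C]]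
        hilbert_schmidt_adjoint(2)[OF A] hilbert_schmidt_adjoint(2)[OF C] by simp
  qed
  have "Im (hs_inner (adjoint_op A) (adjoint_op B)) = - Im (hs_inner A B)"
    using re[OF hilbert_schmidt_scale[OF B, of \<i>]]
    by (simp add: adjoint_scale[OF hilbert_schmidt_complex_linear[OF B]] hs_inner_scale_right)
  then have "hs_inner (adjoint_op A) (adjoint_op B) = cnj (hs_inner A B)"
    using re[OF B] by (simp add: complex_eq_iff)
  then show ?thesis by (metis hs_inner_commute)
qed

section \<open>Traces and the trace class\<close>

lemma trace_compose:
  fixes A B :: "'a::complex_hilbert_space \<Rightarrow>\<^sub>L 'a"
  assumes A: "hilbert_schmidt A"
  shows "trace_op (A o\<^sub>L B) = hs_inner B (adjoint_op A)"
  unfolding trace_op_def hs_inner_def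
  by (simp add: cinner_adjoint_left[OF hilbert_schmidt_complex_linear[OF A]])

lemma trace_compose_commute:
  fixes A B :: "'a::complex_hilbert_space \<Rightarrow>\<^sub>L 'a"
  assumes A: "hilbert_schmidt A" and B: "hilbert_schmidt B"
  shows "trace_op (A o\<^sub>L B) = trace_op (B o\<^sub>L A)"
  using hs_inner_adjoint[OF hilbert_schmidt_adjoint(1)[OF B] A]
  by (simp add: trace_compose A B adjoint_adjoint hilbert_schmidt_complex_linear)

lemma trace_compose_bound:
  fixes A B :: "'a::complex_hilbert_space \<Rightarrow>\<^sub>L 'a"
  assumes A: "hilbert_schmidt A" and B: "hilbert_schmidt B"
  shows "cmod (trace_op (A o\<^sub>L B)) \<le> hs_norm A * hs_norm B"
  using hs_cauchy_schwarz[OF B hilbert_schmidt_adjoint(1)[OF A]]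
  by (simp add: trace_compose A hilbert_schmidt_adjoint(2) mult.commute)

text \<open>Equivalent to the trace class, but visibly closed under sums. The bound 2 leaves room for the operators
  that approximate the polar decomposition in \<open>trace_class_trace_bounded\<close>.\<close>

definition trace_bound :: "('a::complex_hilbert_space \<Rightarrow>\<^sub>L 'a) \<Rightarrow> real \<Rightarrow> bool" where
  "trace_bound A M \<longleftrightarrow> (\<forall>U F. complex_linear U \<longrightarrow> norm U \<le> 2 \<longrightarrow> finite F \<longrightarrow> F \<subseteq> some_onb \<longrightarrow>
        (\<Sum>e\<in>F. cmod (cinner (A e) (U e))) \<le> M)"

definition trace_bounded :: "('a::complex_hilbert_space \<Rightarrow>\<^sub>L 'a) \<Rightarrow> bool" where
  "trace_bounded A \<longleftrightarrow> complex_linear A \<and> (\<exists>M. trace_bound A M)"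

lemma trace_boundI:
  fixes A :: "'a::complex_hilbert_space \<Rightarrow>\<^sub>L 'a"
  assumes "\<And>(U :: 'a \<Rightarrow>\<^sub>L 'a) F. complex_linear U \<Longrightarrow> norm U \<le> 2 \<Longrightarrow> finite F \<Longrightarrow> F \<subseteq> some_onb \<Longrightarrow>
        (\<Sum>e\<in>F. cmod (cinner (A e) (U e))) \<le> M"
  shows "trace_bound A M"
  using assms unfolding trace_bound_def by simp

lemma trace_boundD:
  assumes "trace_bound A M" "complex_linear U" "norm U \<le> 2" "finite F" "F \<subseteq> some_onb"
  shows "(\<Sum>e\<in>F. cmod (cinner (A e) (U e))) \<le> M"
  using assms unfolding trace_bound_def by simp

lemma trace_bound_compose_left:
  fixes A T :: "'a::complex_hilbert_space \<Rightarrow>\<^sub>L 'a"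
  assumes A: "trace_bound A M" and T: "complex_linear T" "norm T \<le> 1"
  shows "trace_bound (T o\<^sub>L A) M"
proof (rule trace_boundI)
  fix U :: "'a \<Rightarrow>\<^sub>L 'a" and F :: "'a set"
  assume U: "complex_linear U" "norm U \<le> 2" and F: "finite F" "F \<subseteq> some_onb"
  have "norm (adjoint_op T o\<^sub>L U) \<le> 1 * 2"
    using norm_adjoint_le[OF T(1)] T(2) U(2) by (intro order_trans[OF norm_blinfun_compose] mult_mono) auto
  then have "(\<Sum>e\<in>F. cmod (cinner (A e) ((adjoint_op T o\<^sub>L U) e))) \<le> M"
    using U T F complex_linear_adjoint by (intro trace_boundD[OF A]) auto
  then show "(\<Sum>e\<in>F. cmod (cinner ((T o\<^sub>L A) e) (U e))) \<le> M"
    by (simp add: cinner_adjoint_left[OF T(1)])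
qed

lemma trace_bound_add:
  fixes A B :: "'a::complex_hilbert_space \<Rightarrow>\<^sub>L 'a"
  assumes A: "trace_bound A M1" and B: "trace_bound B M2"
  shows "trace_bound (A + B) (M1 + M2)"
proof (rule trace_boundI)
  fix U :: "'a \<Rightarrow>\<^sub>L 'a" and F :: "'a set"
  assume U: "complex_linear U" "norm U \<le> 2" "finite F" "F \<subseteq> some_onb"
  have "(\<Sum>e\<in>F. cmod (cinner ((A + B) e) (U e))) \<le> (\<Sum>e\<in>F. cmod (cinner (A e) (U e)) + cmod (cinner (B e) (U e)))"
    by (intro sum_mono) (simp add: blinfun.add_left cinner_add_left norm_triangle_ineq)
  then show "(\<Sum>e\<in>F. cmod (cinner ((A + B) e) (U e))) \<le> M1 + M2"
    using trace_boundD[OF A U] trace_boundD[OF B U] by (simp add: sum.distrib)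
qed

text \<open>Moving B to the other side leaves the Hilbert-Schmidt pairing of C with
  \<open>adjoint_op B o\<^sub>L U\<close>; the 2 is the bound on U.\<close>

lemma trace_bound_compose:
  fixes B C :: "'a::complex_hilbert_space \<Rightarrow>\<^sub>L 'a"
  assumes B: "hilbert_schmidt B" and C: "hilbert_schmidt C"
  shows "trace_bound (B o\<^sub>L C) (2 * hs_norm B * hs_norm C)"
proof (rule trace_boundI)
  fix U :: "'a \<Rightarrow>\<^sub>L 'a" and F :: "'a set"
  assume U: "complex_linear U" "norm U \<le> 2" and F: "finite F" "F \<subseteq> some_onb"
  note clB = hilbert_schmidt_complex_linear[OF B]
  let ?D = "adjoint_op B o\<^sub>L U"
  have D: "hilbert_schmidt ?D" "hs_norm ?D \<le> hs_norm B * norm U"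
    using hilbert_schmidt_compose_right[OF U(1) hilbert_schmidt_adjoint(1)[OF B]] hilbert_schmidt_adjoint(2)[OF B] by auto
  have "(\<Sum>e\<in>F. cmod (cinner ((B o\<^sub>L C) e) (U e))) = (\<Sum>e\<in>F. cmod (cinner (C e) (?D e)))"
    by (simp add: cinner_adjoint_left[OF clB])
  also have "\<dots> \<le> hs_norm C * hs_norm ?D" by (rule hs_cauchy_schwarz_finite[OF C D(1) F])
  also have "\<dots> \<le> hs_norm C * (hs_norm B * 2)"
    using D(2) mult_left_mono[OF U(2) hs_norm_nonneg[of B]] by (intro mult_left_mono) auto
  finally show "(\<Sum>e\<in>F. cmod (cinner ((B o\<^sub>L C) e) (U e))) \<le> 2 * hs_norm B * hs_norm C"
    by (simp add: mult_ac)
qed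

lemma trace_bounded_compose:
  fixes B C :: "'a::complex_hilbert_space \<Rightarrow>\<^sub>L 'a"
  shows "hilbert_schmidt B \<Longrightarrow> hilbert_schmidt C \<Longrightarrow> trace_bounded (B o\<^sub>L C)"
  using trace_bound_compose[of B C] by (auto simp: trace_bounded_def hilbert_schmidt_complex_linear)

lemma trace_bounded_add: "trace_bounded A \<Longrightarrow> trace_bounded B \<Longrightarrow> trace_bounded (A + B)"
  by (auto simp: trace_bounded_def intro: trace_bound_add)

lemma trace_bounded_zero [simp]: "trace_bounded 0"
  by (auto simp: trace_bounded_def trace_bound_def)

lemma trace_bounded_scale:
  fixes A :: "'a::complex_hilbert_space \<Rightarrow>\<^sub>L 'a"
  assumes A: "trace_bounded A" shows "trace_bounded (scale_op c A)"
proof -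
  obtain M where M: "trace_bound A M" using A by (auto simp: trace_bounded_def)
  have "(\<Sum>e\<in>F. cmod (cinner (scale_op c A e) (U e))) \<le> cmod c * M"
    if "complex_linear U" "norm U \<le> 2" "finite F" "F \<subseteq> some_onb" for U :: "'a \<Rightarrow>\<^sub>L 'a" and F
    using mult_left_mono[OF trace_boundD[OF M that], of "cmod c"]
    by (simp add: scale_op_apply cinner_scaleC_left norm_mult sum_distrib_left)
  then have "trace_bound (scale_op c A) (cmod c * M)" by (rule trace_boundI)
  then show ?thesis using A by (auto simp: trace_bounded_def)
qed

lemma trace_bounded_scaleR: "trace_bounded A \<Longrightarrow> trace_bounded (r *\<^sub>R A)"
  using trace_bounded_scale[of A "of_real r"] by (simp add: scale_op_of_real)

lemma trace_bounded_sum: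
  fixes f :: "'i \<Rightarrow> 'a::complex_hilbert_space \<Rightarrow>\<^sub>L 'a"
  shows "(\<And>i. i \<in> I \<Longrightarrow> trace_bounded (f i)) \<Longrightarrow> trace_bounded (sum f I)"
  by (induction I rule: infinite_finite_induct) (auto intro: trace_bounded_add)

lemma trace_bound_diagonal:
  fixes A :: "'a::complex_hilbert_space \<Rightarrow>\<^sub>L 'a"
  assumes A: "trace_bound A M" and F: "finite F" "F \<subseteq> some_onb"
  shows "(\<Sum>e\<in>F. cmod (cinner (A e) e)) \<le> M"
proof -
  have "norm (id_blinfun :: 'a \<Rightarrow>\<^sub>L 'a) \<le> 2"
    by (rule order_trans[OF norm_blinfun_id_le]) simp
  then show ?thesis using trace_boundD[OF A _ _ F, of id_blinfun] by simp
qed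

lemma trace_bound_summable:
  fixes A :: "'a::complex_hilbert_space \<Rightarrow>\<^sub>L 'a"
  assumes "trace_bound A M"
  shows "(\<lambda>e. cmod (cinner (A e) e)) summable_on some_onb"
  by (intro nonneg_bdd_above_summable_on) (auto intro!: bdd_aboveI2 trace_bound_diagonal[OF assms])

lemma trace_bound_trace:
  fixes A :: "'a::complex_hilbert_space \<Rightarrow>\<^sub>L 'a"
  assumes A: "trace_bound A M"
  shows "cmod (trace_op A) \<le> M"
proof -
  have "cmod (trace_op A) \<le> (\<Sum>\<^sub>\<infinity>e\<in>some_onb. cmod (cinner (A e) e))"
    unfolding trace_op_def by (rule norm_infsum_bound[OF trace_bound_summable[OF A]])
  also have "\<dots> \<le> M" by (rule infsum_le_finite_sums[OF trace_bound_summable[OF A] trace_bound_diagonal[OF A]])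
  finally show ?thesis .
qed

lemma trace_has_sum:
  fixes A :: "'a::complex_hilbert_space \<Rightarrow>\<^sub>L 'a"
  assumes A: "trace_bounded A"
  shows "((\<lambda>e. cinner (A e) e) has_sum trace_op A) some_onb"
proof -
  obtain M where "trace_bound A M" using A by (auto simp: trace_bounded_def)
  from abs_summable_summable[OF trace_bound_summable[OF this]] show ?thesis unfolding trace_op_def by simp
qed

lemma trace_op_add:
  fixes A B :: "'a::complex_hilbert_space \<Rightarrow>\<^sub>L 'a"
  assumes "trace_bounded A" "trace_bounded B"
  shows "trace_op (A + B) = trace_op A + trace_op B"
  using has_sum_unique[OF trace_has_sum[OF trace_bounded_add[OF assms]]]
    has_sum_add[OF trace_has_sum[OF assms(1)] trace_has_sum[OF assms(2)]]
  by (simp add: blinfun.add_left cinner_add_left)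

lemma trace_op_scale: "trace_op (scale_op c A) = c * trace_op A"
  unfolding trace_op_def by (simp add: scale_op_apply cinner_scaleC_left infsum_cmult_right')

lemma trace_op_scaleR: "trace_op (r *\<^sub>R A) = of_real r * trace_op A"
  using trace_op_scale[of "of_real r"] by (simp add: scale_op_of_real)

lemma trace_op_zero [simp]: "trace_op 0 = 0"
  by (simp add: trace_op_def)

lemma trace_op_sum:
  fixes f :: "'i \<Rightarrow> 'a::complex_hilbert_space \<Rightarrow>\<^sub>L 'a"
  assumes "\<And>i. i \<in> I \<Longrightarrow> trace_bounded (f i)"
  shows "trace_op (sum f I) = (\<Sum>i\<in>I. trace_op (f i))"
  using assms
proof (induction I rule: infinite_finite_induct)
  case (insert i I)
  then show ?case using trace_op_add[of "f i" "sum f I"] trace_bounded_sum[of I f] by simp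
qed auto

text \<open>For \<open>0 \<le> T \<le> 1\<close> one has \<open>\<parallel>T z\<parallel>\<^sup>2 \<le> \<langle>T z, z\<rangle>\<close>, so that the left-hand side telescopes along \<open>z = T\<^sup>k x\<close>.\<close>

lemma positive_contraction_orbit:
  fixes T :: "'a::complex_hilbert_space \<Rightarrow>\<^sub>L 'a"
  assumes T: "positive_op T" "\<And>x. Re (cinner (T x) x) \<le> (norm x)\<^sup>2"
  defines "z \<equiv> \<lambda>k x. (blinfun_apply T ^^ k) x"
  shows "(\<lambda>k. (norm (z k x))\<^sup>2 - Re (cinner (T (z k x)) (z k x))) \<longlonglongrightarrow> 0" (is "?a \<longlonglongrightarrow> 0")
proof -
  let ?n = "\<lambda>k. (norm (z k x))\<^sup>2"
  have step: "?a k \<le> ?n k - ?n (Suc k)" "?a k \<ge> 0" for k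
    using positive_contraction_norm_square[OF T, of "z k x"] T(2)[of "z k x"] by (auto simp: z_def)
  have "decseq ?n"
  proof (rule decseq_SucI)
    fix k show "?n (Suc k) \<le> ?n k" using step[of k] by linarith
  qed
  then obtain L where "?n \<longlonglongrightarrow> L" using decseq_convergent[of ?n 0] by auto
  then have "(\<lambda>k. ?n k - ?n (Suc k)) \<longlonglongrightarrow> L - L" by (intro tendsto_diff LIMSEQ_Suc)
  then have "(\<lambda>k. ?n k - ?n (Suc k)) \<longlonglongrightarrow> 0" by simp
  then show ?thesis
    by (rule tendsto_sandwich[OF always_eventually always_eventually tendsto_const, rotated 2])
      (use step in auto)
qed

text \<open>With the partial isometry U of a polar decomposition, \<open>cinner (A x) (U x)\<close>
  would be the form of \<open>abs_op A\<close>. Such a U is approximated instead: \<open>S k\<close>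
  is a truncated Neumann series for the inverse of P / c, and \<open>U k\<close>, which is A
  composed with it and divided by c, satisfies \<open>norm (U k x) = norm (x - z k x)\<close> with
  \<open>z k x\<close> the orbit of x under 1 - P / c. Hence the bound 2, and the form of P appears
  as the limit.\<close>

lemma trace_class_trace_bounded:
  fixes A :: "'a::complex_hilbert_space \<Rightarrow>\<^sub>L 'a"
  assumes A: "trace_bounded A" shows "trace_class A"
proof -
  have cl: "complex_linear A" using A by (simp add: trace_bounded_def)
  define P where "P = abs_op A"
  have P: "positive_op P" unfolding P_def by (rule positive_abs_op[OF cl])
  have PA: "cinner (A x) (A y) = cinner (P x) (P y)" for x y
  proof -
    have "P (P x) = adjoint_op A (A x)"
      using abs_op_square[OF cl] unfolding P_def by (metis blinfun_apply_blinfun_compose)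
    then show ?thesis
      by (metis cinner_adjoint_right[OF cl] positive_op_selfadjoint[OF P])
  qed
  then have nPA: "norm (A x) = norm (P x)" for x
    by (simp add: norm_eq_sqrt_cinner)
  define c where "c = norm P + 1"
  have c: "c > 0" by (simp add: c_def add_nonneg_pos)
  define T where "T = id_blinfun - (1 / c) *\<^sub>R P"
  have p: "positive_op ((1 / c) *\<^sub>R P)" "norm ((1 / c) *\<^sub>R P) \<le> 1"
    using P c by (auto intro: positive_op_scaleR simp: c_def field_simps)
  have T: "positive_op T" "\<And>x. Re (cinner (T x) x) \<le> (norm x)\<^sup>2"
    unfolding T_def using positive_op_one_minus[OF p] by auto
  have Tc: "norm (T x) \<le> norm x" for x
  proof (rule power2_le_imp_le)
    show "(norm (T x))\<^sup>2 \<le> (norm x)\<^sup>2"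
      using positive_contraction_norm_square[OF T, of x] T(2)[of x] by linarith
  qed simp
  define z where "z = (\<lambda>k x. (blinfun_apply T ^^ k) x)"
  have zc: "norm (z k x) \<le> norm x" for k x
    by (induction k) (use Tc order_trans in \<open>auto simp: z_def\<close>)
  define S where "S = rec_nat 0 (\<lambda>k Sk. id_blinfun + (T o\<^sub>L Sk))"
  have S0: "S 0 = 0" and SS: "S (Suc k) = id_blinfun + (T o\<^sub>L S k)" for k
    by (simp_all add: S_def)
  have PS: "(1 / c) *\<^sub>R P (S k x) = x - z k x" for k x
  proof (induction k)
    case (Suc k)
    have "(1 / c) *\<^sub>R P y = y - T y" for y by (simp add: T_def blinfun.bilinear_simps)
    then have "S k x - T (S k x) = x - z k x" using Suc by simp
    then have "T (S k x) - T (T (S k x)) = T x - z (Suc k) x"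
      by (simp add: z_def flip: blinfun.diff_right)
    then have *: "T (S k x) - T (T (S k x)) - T x = - z (Suc k) x" by simp
    have "(1 / c) *\<^sub>R P (S (Suc k) x) = S (Suc k) x - T (S (Suc k) x)"
      by (rule \<open>\<And>y. (1 / c) *\<^sub>R P y = y - T y\<close>)
    also have "\<dots> = x + (T (S k x) - T (T (S k x)) - T x)" by (simp add: SS blinfun.bilinear_simps)
    finally show ?case unfolding * by simp
  qed (simp add: S0 z_def)
  have clS: "complex_linear (S k)" for k
    by (induction k) (use positive_op_complex_linear[OF T(1)] in \<open>auto simp: S0 SS\<close>)
  define U where "U = (\<lambda>k. (1 / c) *\<^sub>R (A o\<^sub>L S k))"
  have clU: "complex_linear (U k)" for k unfolding U_def using cl clS by auto
  have nU: "norm (U k) \<le> 2" for k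
  proof (rule norm_blinfun_bound)
    fix x
    have "norm (U k x) = norm ((1 / c) *\<^sub>R P (S k x))" by (simp add: U_def blinfun.bilinear_simps nPA)
    also have "\<dots> \<le> 2 * norm x"
      unfolding PS using zc[of k x] norm_triangle_ineq4[of x "z k x"] by simp
    finally show "norm (U k x) \<le> 2 * norm x" .
  qed simp
  have AU: "cinner (A x) (U k x) = cinner (P x) x - cinner (P x) (z k x)" for k x
  proof -
    have "cinner (A x) (U k x) = cinner (P x) ((1 / c) *\<^sub>R P (S k x))"
      by (simp add: U_def blinfun.bilinear_simps cinner_scaleR_right PA)
    then show ?thesis by (simp add: PS cinner_diff_right)
  qed
  \<comment> \<open>Since P = c (1 - T), \<open>P (z k x)\<close> is a multiple of the increment of
    the orbit, which tends to 0 by \<open>positive_contraction_orbit\<close>.\<close>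
  have lim: "(\<lambda>k. cinner (P x) (z k x)) \<longlonglongrightarrow> 0" for x
  proof (rule Lim_null_comparison)
    have Pz: "P (z k x) = c *\<^sub>R (z k x - T (z k x))" for k using c by (simp add: T_def blinfun.bilinear_simps)
    have bound: "(cmod (cinner (P x) (z k x)))\<^sup>2 \<le> (norm x)\<^sup>2 * c\<^sup>2 * ((norm (z k x))\<^sup>2 - Re (cinner (T (z k x)) (z k x)))" for k
    proof -
      let ?y = "z k x"
      have "(norm (?y - T ?y))\<^sup>2 = (norm ?y)\<^sup>2 - 2 * Re (cinner (T ?y) ?y) + (norm (T ?y))\<^sup>2"
        by (simp add: norm_diff_square Re_cinner_commute)
      also have "\<dots> \<le> (norm ?y)\<^sup>2 - Re (cinner (T ?y) ?y)"
        using positive_contraction_norm_square[OF T, of ?y] by simp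
      finally have 1: "(norm (?y - T ?y))\<^sup>2 \<le> (norm ?y)\<^sup>2 - Re (cinner (T ?y) ?y)" .
      have "(cmod (cinner (P x) ?y))\<^sup>2 \<le> (norm x * norm (P ?y))\<^sup>2"
        unfolding positive_op_selfadjoint[OF P] by (intro power_mono cauchy_schwarz) simp
      also have "\<dots> = (norm x)\<^sup>2 * c\<^sup>2 * (norm (?y - T ?y))\<^sup>2" unfolding Pz by (simp add: power_mult_distrib)
      also have "\<dots> \<le> (norm x)\<^sup>2 * c\<^sup>2 * ((norm ?y)\<^sup>2 - Re (cinner (T ?y) ?y))"
        using 1 by (intro mult_left_mono) auto
      finally show ?thesis .
    qed
    show "\<forall>\<^sub>F k in sequentially. norm (cinner (P x) (z k x)) \<le>
        sqrt ((norm x)\<^sup>2 * c\<^sup>2 * ((norm (z k x))\<^sup>2 - Re (cinner (T (z k x)) (z k x))))"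
      using bound by (intro always_eventually allI real_le_rsqrt)
    have "(\<lambda>k. sqrt ((norm x)\<^sup>2 * c\<^sup>2 * ((norm (z k x))\<^sup>2 - Re (cinner (T (z k x)) (z k x))))) \<longlonglongrightarrow> sqrt ((norm x)\<^sup>2 * c\<^sup>2 * 0)"
      unfolding z_def by (intro tendsto_intros positive_contraction_orbit[OF T])
    then show "(\<lambda>k. sqrt ((norm x)\<^sup>2 * c\<^sup>2 * ((norm (z k x))\<^sup>2 - Re (cinner (T (z k x)) (z k x))))) \<longlonglongrightarrow> 0"
      by simp
  qed
  obtain M where M: "trace_bound A M" using A by (auto simp: trace_bounded_def)
  have "(\<Sum>e\<in>F. cmod (cinner (P e) e)) \<le> M" if F: "finite F" "F \<subseteq> some_onb" for F
  proof (rule LIMSEQ_le_const2)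
    have "(\<lambda>k. \<Sum>e\<in>F. cmod (cinner (A e) (U k e))) \<longlonglongrightarrow> (\<Sum>e\<in>F. cmod (cinner (P e) e - 0))"
      unfolding AU by (intro tendsto_intros lim)
    then show "(\<lambda>k. \<Sum>e\<in>F. cmod (cinner (A e) (U k e))) \<longlonglongrightarrow> (\<Sum>e\<in>F. cmod (cinner (P e) e))" by simp
    show "\<exists>N. \<forall>n\<ge>N. (\<Sum>e\<in>F. cmod (cinner (A e) (U n e))) \<le> M" using trace_boundD[OF M clU nU F] by blast
  qed
  then have "(\<lambda>e. cmod (cinner (P e) e)) summable_on some_onb"
    by (intro nonneg_bdd_above_summable_on) (auto intro!: bdd_aboveI2)
  from abs_summable_summable[OF this] show ?thesis using cl by (simp add: trace_class_def P_def)
qed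

section \<open>Taylor remainders of powers\<close>

lemma power_op_0 [simp]: "power_op A 0 = id_blinfun"
  and power_op_Suc: "power_op A (Suc n) = A o\<^sub>L power_op A n"
  by (simp_all add: power_op_def)

lemma power_op_apply: "power_op A n x = (blinfun_apply A ^^ n) x"
  by (induction n) (auto simp: power_op_Suc)

lemma power_op_add: "power_op A (m + n) = power_op A m o\<^sub>L power_op A n"
  by (intro blinfun_eqI) (simp add: power_op_apply funpow_add)

lemma power_op_add_apply: "power_op A m (power_op A n x) = power_op A (m + n) x"
  by (simp add: power_op_add)

lemma complex_linear_power [intro]: "complex_linear A \<Longrightarrow> complex_linear (power_op A n)"
  by (induction n) (auto simp: power_op_Suc)

lemma norm_power_op: "norm A \<le> 1 \<Longrightarrow> norm (power_op A n) \<le> 1"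
proof (induction n)
  case (Suc n)
  then show ?case
    unfolding power_op_Suc
    by (intro order_trans[OF norm_blinfun_compose] mult_le_one) auto
qed (simp add: norm_blinfun_id_le)

text \<open>The product rule for A A^n; this form runs parallel to \<open>power_op_Suc\<close> in
  inductions, and \<open>power_deriv_sum\<close> is the closed form.\<close>

primrec power_deriv :: "('a::complex_inner_space \<Rightarrow>\<^sub>L 'a) \<Rightarrow> ('a \<Rightarrow>\<^sub>L 'a) \<Rightarrow> nat \<Rightarrow> 'a \<Rightarrow>\<^sub>L 'a" where
  "power_deriv A V 0 = 0"
| "power_deriv A V (Suc n) = (A o\<^sub>L power_deriv A V n) + (V o\<^sub>L power_op A n)"

lemma blinfun_compose_id: "id_blinfun o\<^sub>L A = A"
  by (intro blinfun_eqI) simp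

lemma blinfun_compose_assoc: "(A o\<^sub>L B) o\<^sub>L C = A o\<^sub>L (B o\<^sub>L C)"
  by (intro blinfun_eqI) simp

lemma compose_sum_right: "A o\<^sub>L (sum f I) = (\<Sum>i\<in>I. A o\<^sub>L f i)"
  by (intro blinfun_eqI) (simp add: blinfun.sum_left blinfun.sum_right)

lemma power_deriv_sum: "power_deriv A V n = (\<Sum>j<n. power_op A j o\<^sub>L (V o\<^sub>L power_op A (n - 1 - j)))"
proof (induction n)
  case (Suc n)
  have "(\<Sum>j<Suc n. power_op A j o\<^sub>L (V o\<^sub>L power_op A (Suc n - 1 - j))) =
      (id_blinfun o\<^sub>L (V o\<^sub>L power_op A n)) + (\<Sum>j<n. power_op A (Suc j) o\<^sub>L (V o\<^sub>L power_op A (n - Suc j)))"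
    by (subst sum.lessThan_Suc_shift) simp
  also have "(\<Sum>j<n. power_op A (Suc j) o\<^sub>L (V o\<^sub>L power_op A (n - Suc j))) = A o\<^sub>L power_deriv A V n"
    unfolding Suc compose_sum_right
    by (intro sum.cong refl blinfun_eqI) (simp add: power_op_Suc)
  finally show ?case by (simp add: add.commute blinfun_compose_id)
qed simp

lemma complex_linear_power_deriv [intro]:
  "complex_linear A \<Longrightarrow> complex_linear V \<Longrightarrow> complex_linear (power_deriv A V n)"
  by (induction n) auto

lemma power_deriv_scaleR: "power_deriv A (r *\<^sub>R V) n = r *\<^sub>R power_deriv A V n"
  by (induction n) (auto intro!: blinfun_eqI simp: blinfun.bilinear_simps scaleR_add_right)

lemma power_path_has_derivative:
  "((\<lambda>s. power_op (A + s *\<^sub>R V) n) has_vector_derivative power_deriv A V n) (at 0 within S)"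
proof (induction n)
  case (Suc n)
  have "((\<lambda>s. A + s *\<^sub>R V) has_vector_derivative V) (at 0 within S)"
    by (auto intro!: derivative_eq_intros)
  from bounded_bilinear.has_vector_derivative[OF bounded_bilinear_blinfun_compose this Suc]
  show ?case by (simp add: power_op_Suc)
qed simp

section \<open>The segment from \<open>N\<^sub>0\<close> to \<open>N\<close> and Taylor's formula
  for traces\<close>

definition segment_op :: "('a::complex_hilbert_space \<Rightarrow>\<^sub>L 'a) \<Rightarrow> ('a \<Rightarrow>\<^sub>L 'a) \<Rightarrow> real \<Rightarrow> 'a \<Rightarrow>\<^sub>L 'a" where
  "segment_op N\<^sub>0 V s = N\<^sub>0 + s *\<^sub>R V"

lemma hs_norm_add_le:
  fixes A B :: "'a::complex_hilbert_space \<Rightarrow>\<^sub>L 'a"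
  assumes "hilbert_schmidt A" "hilbert_schmidt B"
  shows "hs_norm (A + B) \<le> hs_norm A + hs_norm B"
proof (rule power2_le_imp_le)
  have "Re (hs_inner A B) \<le> hs_norm A * hs_norm B"
    using hs_cauchy_schwarz[OF assms] complex_Re_le_cmod order_trans by blast
  then show "(hs_norm (A + B))\<^sup>2 \<le> (hs_norm A + hs_norm B)\<^sup>2"
    by (simp add: hs_norm_add_square[OF assms] power2_sum)
qed simp

lemma hs_norm_compose_contraction:
  fixes A T :: "'a::complex_hilbert_space \<Rightarrow>\<^sub>L 'a"
  assumes "complex_linear T" "norm T \<le> 1" "hilbert_schmidt A"
  shows "hs_norm (T o\<^sub>L A) \<le> hs_norm A" "hs_norm (A o\<^sub>L T) \<le> hs_norm A"
  using hilbert_schmidt_compose_left(2)[OF assms(1,3)] hilbert_schmidt_compose_right(2)[OF assms(1,3)]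
    mult_right_mono[OF assms(2) hs_norm_nonneg[of A]] mult_left_mono[OF assms(2) hs_norm_nonneg[of A]]
  by auto

context
  fixes A B :: "'a::complex_hilbert_space \<Rightarrow>\<^sub>L 'a"
  assumes A: "complex_linear A" "norm A \<le> 1" and B: "complex_linear B" "norm B \<le> 1"
    and V: "hilbert_schmidt (A - B)"
begin

lemma power_op_diff_Suc:
  "power_op A (Suc n) - power_op B (Suc n) = (B o\<^sub>L (power_op A n - power_op B n)) + ((A - B) o\<^sub>L power_op A n)"
  by (intro blinfun_eqI) (simp add: power_op_Suc blinfun.bilinear_simps)

lemma power_op_diff_hs:
  "hilbert_schmidt (power_op A n - power_op B n) \<and>
   hs_norm (power_op A n - power_op B n) \<le> real n * hs_norm (A - B)"
proof (induction n)
  case (Suc n)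
  let ?D = "power_op A n - power_op B n"
  have clP: "complex_linear (power_op A n)" using A(1) by auto
  have 1: "hilbert_schmidt (B o\<^sub>L ?D)" "hs_norm (B o\<^sub>L ?D) \<le> hs_norm ?D"
    using hilbert_schmidt_compose_left(1) hs_norm_compose_contraction(1) B Suc by blast+
  have 2: "hilbert_schmidt ((A - B) o\<^sub>L power_op A n)" "hs_norm ((A - B) o\<^sub>L power_op A n) \<le> hs_norm (A - B)"
    using hilbert_schmidt_compose_right(1)[OF clP V] hs_norm_compose_contraction(2)[OF clP norm_power_op[OF A(2)] V] by auto
  show ?case
    unfolding power_op_diff_Suc
    using hilbert_schmidt_add[OF 1(1) 2(1)] hs_norm_add_le[OF 1(1) 2(1)] 1(2) 2(2) Suc
    by (simp add: algebra_simps)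
qed simp

text \<open>The remainders satisfy R_(n+1) = B R_n + (A - B) (A^n - B^n): each step adds a product
  of two Hilbert-Schmidt operators, although the single terms of a remainder need not be trace
  class. As n^2 + 2 n <= (n + 1)^2, the bound closes; being quadratic in A - B, it later yields
  derivatives in s.\<close>

lemma power_remainder_trace_bound:
  "complex_linear (power_op A n - power_op B n - power_deriv B (A - B) n) \<and>
   trace_bound (power_op A n - power_op B n - power_deriv B (A - B) n) ((real n * hs_norm (A - B))\<^sup>2)"
proof (induction n)
  case 0
  then show ?case by (simp add: trace_bound_def)
next
  case (Suc n)
  let ?R = "\<lambda>n. power_op A n - power_op B n - power_deriv B (A - B) n"
  let ?D = "power_op A n - power_op B n"
  have eq: "?R (Suc n) = (B o\<^sub>L ?R n) + ((A - B) o\<^sub>L ?D)"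
    by (intro blinfun_eqI) (simp add: power_op_Suc blinfun.bilinear_simps)
  have D: "hilbert_schmidt ?D" "hs_norm ?D \<le> real n * hs_norm (A - B)" using power_op_diff_hs by auto
  have "trace_bound (?R (Suc n)) ((real n * hs_norm (A - B))\<^sup>2 + 2 * hs_norm (A - B) * hs_norm ?D)"
    unfolding eq using Suc by (intro trace_bound_add trace_bound_compose_left B trace_bound_compose V D) auto
  moreover have "(real n * hs_norm (A - B))\<^sup>2 + 2 * hs_norm (A - B) * hs_norm ?D \<le> (real (Suc n) * hs_norm (A - B))\<^sup>2"
  proof -
    have "(real (Suc n) * hs_norm (A - B))\<^sup>2 =
        (real n * hs_norm (A - B))\<^sup>2 + 2 * hs_norm (A - B) * (real n * hs_norm (A - B)) + (hs_norm (A - B))\<^sup>2"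
      by (simp add: power2_eq_square algebra_simps)
    moreover have "2 * hs_norm (A - B) * hs_norm ?D \<le> 2 * hs_norm (A - B) * (real n * hs_norm (A - B))"
      using D(2) by (intro mult_left_mono) auto
    ultimately show ?thesis using zero_le_power2[of "hs_norm (A - B)"] by linarith
  qed
  moreover have "complex_linear (?R (Suc n))"
    using A B by (intro complex_linear_diff complex_linear_power complex_linear_power_deriv)
  ultimately show ?case unfolding trace_bound_def by (meson order_trans)
qed

lemma power_remainder_trace_bounded:
  "trace_bounded (power_op A n - power_op B n - power_deriv B (A - B) n)"
  using power_remainder_trace_bound unfolding trace_bounded_def by blast

text \<open>The two terms of D need not have traces. Changing A to B in one outer power at a time
  gives two products of Hilbert-Schmidt operators; each is rotated under the trace, and the rotated
  pieces recombine to the difference of the full powers.\<close>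

lemma trace_conjugation_diff:
  fixes W :: "'a \<Rightarrow>\<^sub>L 'a" and j l :: nat
  assumes W: "hilbert_schmidt W"
  defines "D \<equiv> (power_op A j o\<^sub>L (W o\<^sub>L power_op A l)) - (power_op B j o\<^sub>L (W o\<^sub>L power_op B l))"
  shows "trace_bounded D"
    and "trace_op D = trace_op (W o\<^sub>L (power_op A (j + l) - power_op B (j + l)))"
proof -
  let ?J = "power_op A j - power_op B j"
  let ?L = "power_op A l - power_op B l"
  have cl: "complex_linear (power_op A n)" "complex_linear (power_op B n)" for n using A B by auto
  have J: "hilbert_schmidt ?J" and L: "hilbert_schmidt ?L" using power_op_diff_hs by auto
  have WA: "hilbert_schmidt (W o\<^sub>L power_op A l)" using W cl by (intro hilbert_schmidt_compose_right)
  have BW: "hilbert_schmidt (power_op B j o\<^sub>L W)" using W cl by (intro hilbert_schmidt_compose_left)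
  have LB: "hilbert_schmidt (?L o\<^sub>L power_op B j)" using L cl by (intro hilbert_schmidt_compose_right)
  have AJ: "hilbert_schmidt (power_op A l o\<^sub>L ?J)" using J cl by (intro hilbert_schmidt_compose_left)
  have D: "D = (?J o\<^sub>L (W o\<^sub>L power_op A l)) + ((power_op B j o\<^sub>L W) o\<^sub>L ?L)"
    unfolding D_def by (intro blinfun_eqI) (simp add: blinfun.bilinear_simps)
  show "trace_bounded D"
    unfolding D by (intro trace_bounded_add trace_bounded_compose J WA BW L)
  have "trace_op D = trace_op (?J o\<^sub>L (W o\<^sub>L power_op A l)) + trace_op ((power_op B j o\<^sub>L W) o\<^sub>L ?L)"
    unfolding D by (intro trace_op_add trace_bounded_compose J WA BW L)
  also have "trace_op (?J o\<^sub>L (W o\<^sub>L power_op A l)) = trace_op (W o\<^sub>L (power_op A l o\<^sub>L ?J))"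
    using trace_compose_commute[OF J WA] by (simp add: blinfun_compose_assoc)
  also have "trace_op ((power_op B j o\<^sub>L W) o\<^sub>L ?L) = trace_op ((?L o\<^sub>L power_op B j) o\<^sub>L W)"
    using trace_compose_commute[OF BW L] by (simp add: blinfun_compose_assoc)
  also have "\<dots> = trace_op (W o\<^sub>L (?L o\<^sub>L power_op B j))"
    by (rule trace_compose_commute[OF LB W])
  also have "trace_op (W o\<^sub>L (power_op A l o\<^sub>L ?J)) + trace_op (W o\<^sub>L (?L o\<^sub>L power_op B j)) =
      trace_op ((W o\<^sub>L (power_op A l o\<^sub>L ?J)) + (W o\<^sub>L (?L o\<^sub>L power_op B j)))"
    by (intro trace_op_add[symmetric] trace_bounded_compose W AJ LB)
  also have "(W o\<^sub>L (power_op A l o\<^sub>L ?J)) + (W o\<^sub>L (?L o\<^sub>L power_op B j)) =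
      W o\<^sub>L (power_op A (j + l) - power_op B (j + l))"
    unfolding add.commute[of j l]
    by (intro blinfun_eqI) (simp add: blinfun.bilinear_simps power_op_add_apply)
  finally show "trace_op D = trace_op (W o\<^sub>L (power_op A (j + l) - power_op B (j + l)))" .
qed

text \<open>After rotation the terms of \<open>power_deriv_sum\<close> depend on j + (n - 1 - j)
  only, so all n of them contribute the same trace.\<close>

lemma trace_power_deriv_diff:
  assumes W: "hilbert_schmidt W"
  shows "trace_bounded (power_deriv A W n - power_deriv B W n)"
    and "trace_op (power_deriv A W n - power_deriv B W n) =
       of_nat n * trace_op (W o\<^sub>L (power_op A (n - 1) - power_op B (n - 1)))"
proof -
  have eq: "power_deriv A W n - power_deriv B W n = (\<Sum>j<n.
     (power_op A j o\<^sub>L (W o\<^sub>L power_op A (n - 1 - j))) - (power_op B j o\<^sub>L (W o\<^sub>L power_op B (n - 1 - j))))"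
    by (simp add: power_deriv_sum sum_subtractf)
  show "trace_bounded (power_deriv A W n - power_deriv B W n)"
    unfolding eq by (intro trace_bounded_sum trace_conjugation_diff W)
  have "trace_op (power_deriv A W n - power_deriv B W n) =
      (\<Sum>j<n. trace_op (W o\<^sub>L (power_op A (j + (n - 1 - j)) - power_op B (j + (n - 1 - j)))))"
    unfolding eq by (subst trace_op_sum) (simp_all add: trace_conjugation_diff W)
  also have "\<dots> = (\<Sum>j<n. trace_op (W o\<^sub>L (power_op A (n - 1) - power_op B (n - 1))))"
    by (intro sum.cong) auto
  finally show "trace_op (power_deriv A W n - power_deriv B W n) =
       of_nat n * trace_op (W o\<^sub>L (power_op A (n - 1) - power_op B (n - 1)))" by simp
qed

end

lemma has_vector_derivative_quadratic:
  fixes f :: "real \<Rightarrow> 'b::real_normed_vector"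
  assumes "\<And>y. y \<in> S \<Longrightarrow> norm (f y - f x - (y - x) *\<^sub>R f') \<le> C * (y - x)\<^sup>2"
  shows "(f has_vector_derivative f') (at x within S)"
  unfolding has_vector_derivative_def has_derivative_within_alt
proof (intro conjI allI impI)
  show "bounded_linear (\<lambda>h. h *\<^sub>R f')" by (rule bounded_linear_scaleR_left)
  fix e :: real assume e: "e > 0"
  show "\<exists>d>0. \<forall>y\<in>S. norm (y - x) < d \<longrightarrow> norm (f y - f x - (y - x) *\<^sub>R f') \<le> e * norm (y - x)"
  proof (intro exI conjI ballI impI)
    show "e / (\<bar>C\<bar> + 1) > 0" using e by simp
    fix y assume y: "y \<in> S" "norm (y - x) < e / (\<bar>C\<bar> + 1)"
    have "norm (f y - f x - (y - x) *\<^sub>R f') \<le> C * (y - x)\<^sup>2" by (rule assms[OF y(1)])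
    also have "\<dots> \<le> (\<bar>C\<bar> + 1) * (y - x)\<^sup>2" by (intro mult_right_mono) auto
    also have "\<dots> = ((\<bar>C\<bar> + 1) * \<bar>y - x\<bar>) * \<bar>y - x\<bar>" by (simp add: power2_eq_square)
    also have "\<dots> \<le> e * \<bar>y - x\<bar>" using y(2) by (intro mult_right_mono) (auto simp: field_simps)
    finally show "norm (f y - f x - (y - x) *\<^sub>R f') \<le> e * norm (y - x)" by simp
  qed
qed

lemma norm_segment_le:
  assumes "norm N \<le> 1" "norm N\<^sub>0 \<le> 1" "s \<in> {0..1}"
  shows "norm (segment_op N\<^sub>0 (N - N\<^sub>0) s) \<le> 1"
proof -
  have "segment_op N\<^sub>0 (N - N\<^sub>0) s = (1 - s) *\<^sub>R N\<^sub>0 + s *\<^sub>R N"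
    by (simp add: segment_op_def algebra_simps)
  also have "norm \<dots> \<le> (1 - s) * norm N\<^sub>0 + s * norm N"
    using assms(3) by (intro order_trans[OF norm_triangle_ineq]) auto
  also have "\<dots> \<le> (1 - s) * 1 + s * 1"
    using assms by (intro add_mono mult_left_mono) auto
  finally show ?thesis by simp
qed

context
  fixes N N\<^sub>0 V :: "'a::complex_hilbert_space \<Rightarrow>\<^sub>L 'a" and T :: "real \<Rightarrow> 'a \<Rightarrow>\<^sub>L 'a"
  assumes N: "complex_linear N" "norm N \<le> 1" and N0: "complex_linear N\<^sub>0" "norm N\<^sub>0 \<le> 1"
    and Vdef: "V = N - N\<^sub>0" and V: "hilbert_schmidt V"
    and T_def: "T = segment_op N\<^sub>0 V"
begin

lemma segment_contraction: "s \<in> {0..1} \<Longrightarrow> norm (T s) \<le> 1"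
  unfolding T_def Vdef by (rule norm_segment_le[OF N(2) N0(2)])

lemma segment_complex_linear: "complex_linear (T s)"
  unfolding T_def segment_op_def using N0 hilbert_schmidt_complex_linear[OF V] by auto

lemma segment_diff: "T s - T r = (s - r) *\<^sub>R V"
  by (simp add: T_def segment_op_def algebra_simps)

lemma segment_diff_hs: "hilbert_schmidt (T s - T r)"
  unfolding segment_diff by (rule hilbert_schmidt_scaleR[OF V])

lemma segment_remainder:
  fixes s r :: real and n :: nat
  assumes "s \<in> {0..1}" "r \<in> {0..1}"
  defines "R \<equiv> power_op (T s) n - power_op (T r) n - (s - r) *\<^sub>R power_deriv (T r) V n"
  shows "trace_bounded R" "trace_bound R ((real n * hs_norm V)\<^sup>2 * (s - r)\<^sup>2)" "complex_linear R"
proof -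
  have R: "R = power_op (T s) n - power_op (T r) n - power_deriv (T r) (T s - T r) n"
    by (simp add: R_def segment_diff power_deriv_scaleR)
  note * = segment_complex_linear[of s] segment_contraction[OF assms(1)]
    segment_complex_linear[of r] segment_contraction[OF assms(2)] segment_diff_hs[of s r]
  show "trace_bounded R" unfolding R by (rule power_remainder_trace_bounded[OF *])
  have "(real n * hs_norm (T s - T r))\<^sup>2 = (real n * hs_norm V)\<^sup>2 * (s - r)\<^sup>2"
    by (simp add: segment_diff hs_norm_scaleR power_mult_distrib)
  then show "trace_bound R ((real n * hs_norm V)\<^sup>2 * (s - r)\<^sup>2)" "complex_linear R"
    unfolding R using power_remainder_trace_bound[OF *, of n] by auto
qed

text \<open>Taylor's formula with integral remainder, carried out on scalars. The function
  \<open>?\<phi>\<close> is the trace of the whole remainder at s and \<open>?\<chi>\<close> the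
  trace of a difference of derivatives, because the single operators need not have traces; both are
  differentiated through quadratic error bounds.\<close>

lemma trace_power_remainder_integral:
  "((\<lambda>s. of_real (1 - s) * (of_nat (n + 1) * trace_op (V o\<^sub>L power_deriv (T s) V n))) has_integral
     trace_op (power_op N (n + 1) - power_op N\<^sub>0 (n + 1) - power_deriv N\<^sub>0 V (n + 1))) {0..1}"
proof -
  let ?m = "n + 1"
  let ?\<phi> = "\<lambda>s. trace_op (power_op (T s) ?m - power_op (T 0) ?m - s *\<^sub>R power_deriv (T 0) V ?m)"
  let ?\<chi> = "\<lambda>s. trace_op (power_deriv (T s) V ?m - power_deriv (T 0) V ?m)"
  let ?g = "\<lambda>s. of_nat ?m * trace_op (V o\<^sub>L power_deriv (T s) V n)"
  have T0: "T 0 = N\<^sub>0" and T1: "T 1 = N" by (simp_all add: T_def segment_op_def Vdef)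
  have tb: "trace_bounded (power_op (T s) ?m - power_op (T 0) ?m - s *\<^sub>R power_deriv (T 0) V ?m)" if "s \<in> {0..1}" for s
    using segment_remainder(1)[of s 0 ?m] that by simp
  note seg = segment_complex_linear segment_contraction segment_complex_linear segment_contraction segment_diff_hs V
  have \<phi>': "(?\<phi> has_vector_derivative ?\<chi> r) (at r within {0..1})" if r: "r \<in> {0..1}" for r
  proof (rule has_vector_derivative_quadratic)
    fix s :: real assume s: "s \<in> {0..1}"
    let ?R = "power_op (T s) ?m - power_op (T r) ?m - (s - r) *\<^sub>R power_deriv (T r) V ?m"
    have tbD: "trace_bounded (power_deriv (T r) V ?m - power_deriv (T 0) V ?m)"
      using r by (intro trace_power_deriv_diff(1) seg) auto
    have eq: "power_op (T s) ?m - power_op (T 0) ?m - s *\<^sub>R power_deriv (T 0) V ?m =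
       (?R + (s - r) *\<^sub>R (power_deriv (T r) V ?m - power_deriv (T 0) V ?m)) +
       (power_op (T r) ?m - power_op (T 0) ?m - r *\<^sub>R power_deriv (T 0) V ?m)"
      by (simp add: algebra_simps)
    have "?\<phi> s = trace_op ?R + of_real (s - r) * ?\<chi> r + ?\<phi> r"
      unfolding eq
      by (subst trace_op_add trace_op_scaleR | intro trace_bounded_add trace_bounded_scaleR segment_remainder(1) tb s r tbD refl)+
    then have "?\<phi> s - ?\<phi> r - (s - r) *\<^sub>R ?\<chi> r = trace_op ?R" by (simp add: scaleR_conv_of_real)
    then show "norm (?\<phi> s - ?\<phi> r - (s - r) *\<^sub>R ?\<chi> r) \<le> (real ?m * hs_norm V)\<^sup>2 * (s - r)\<^sup>2"
      using trace_bound_trace[OF segment_remainder(2)[OF s r, of ?m]] by simp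
  qed
  have \<chi>': "(?\<chi> has_vector_derivative ?g r) (at r within {0..1})" if r: "r \<in> {0..1}" for r
  proof (rule has_vector_derivative_quadratic)
    fix s :: real assume s: "s \<in> {0..1}"
    let ?R = "power_op (T s) n - power_op (T r) n - (s - r) *\<^sub>R power_deriv (T r) V n"
    have tbD: "trace_bounded (power_deriv (T s) V ?m - power_deriv (T r) V ?m)"
      "trace_bounded (power_deriv (T r) V ?m - power_deriv (T 0) V ?m)"
      using r s by (intro trace_power_deriv_diff(1) seg; simp)+
    have "?\<chi> s = trace_op ((power_deriv (T s) V ?m - power_deriv (T r) V ?m) + (power_deriv (T r) V ?m - power_deriv (T 0) V ?m))"
      by (simp only: diff_add_cancel add_diff_eq)
    also have "\<dots> = trace_op (power_deriv (T s) V ?m - power_deriv (T r) V ?m) + ?\<chi> r"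
      by (rule trace_op_add[OF tbD])
    also have "trace_op (power_deriv (T s) V ?m - power_deriv (T r) V ?m) =
        of_nat ?m * trace_op (V o\<^sub>L (power_op (T s) (?m - 1) - power_op (T r) (?m - 1)))"
      using s r by (intro trace_power_deriv_diff(2) seg) auto
    also have "V o\<^sub>L (power_op (T s) (?m - 1) - power_op (T r) (?m - 1)) =
        (V o\<^sub>L ?R) + (s - r) *\<^sub>R (V o\<^sub>L power_deriv (T r) V n)"
      by (intro blinfun_eqI) (simp add: blinfun.bilinear_simps)
    also have "trace_op \<dots> = trace_op (V o\<^sub>L ?R) + of_real (s - r) * trace_op (V o\<^sub>L power_deriv (T r) V n)"
    proof -
      have "hilbert_schmidt (power_op (T s) n - power_op (T r) n)"
        using power_op_diff_hs[OF segment_complex_linear segment_contraction[OF s] segment_complex_linear segment_contraction[OF r] segment_diff_hs] by blast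
      moreover have pd: "hilbert_schmidt (power_deriv (T r) V n)"
        unfolding power_deriv_sum using segment_complex_linear
        by (intro hilbert_schmidt_sum hilbert_schmidt_compose_left hilbert_schmidt_compose_right V complex_linear_power)
      ultimately have "hilbert_schmidt ?R" by (rule hilbert_schmidt_diff[OF _ hilbert_schmidt_scaleR])
      then show ?thesis
        using trace_op_add[OF trace_bounded_compose[OF V] trace_bounded_scaleR[OF trace_bounded_compose[OF V pd]]]
        by (simp add: trace_op_scaleR)
    qed
    finally have "?\<chi> s - ?\<chi> r - (s - r) *\<^sub>R ?g r = of_nat ?m * trace_op (V o\<^sub>L ?R)"
      by (simp add: scaleR_conv_of_real algebra_simps)
    moreover have "cmod (trace_op (V o\<^sub>L ?R)) \<le> 2 * ((real n * hs_norm V)\<^sup>2 * (s - r)\<^sup>2)"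
    proof -
      \<comment> \<open>\<open>trace_bound_compose_left\<close> asks for a contraction, so V is
        halved.\<close>
      have "norm V \<le> 2"
        unfolding Vdef using N(2) N0(2) norm_triangle_ineq4[of N N\<^sub>0] by linarith
      then have "norm ((1/2) *\<^sub>R V) \<le> 1" by simp
      then have "trace_bound (((1/2) *\<^sub>R V) o\<^sub>L ?R) ((real n * hs_norm V)\<^sup>2 * (s - r)\<^sup>2)"
        using hilbert_schmidt_complex_linear[OF V]
        by (intro trace_bound_compose_left segment_remainder(2) s r complex_linear_scaleR)
      then have "cmod (trace_op (((1/2) *\<^sub>R V) o\<^sub>L ?R)) \<le> (real n * hs_norm V)\<^sup>2 * (s - r)\<^sup>2"
        by (rule trace_bound_trace)
      moreover have "((1/2) *\<^sub>R V) o\<^sub>L ?R = (1/2) *\<^sub>R (V o\<^sub>L ?R)"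
        by (intro blinfun_eqI) (simp only: blinfun_apply_blinfun_compose blinfun.scaleR_left)
      ultimately show ?thesis by (simp add: trace_op_scaleR norm_mult)
    qed
    ultimately show "norm (?\<chi> s - ?\<chi> r - (s - r) *\<^sub>R ?g r) \<le> (real ?m * (2 * (real n * hs_norm V)\<^sup>2)) * (s - r)\<^sup>2"
      by (simp only: norm_mult norm_of_nat mult.assoc) (intro mult_left_mono; simp)
  qed
  \<comment> \<open>Integration by parts in advance: the derivative of \<open>?F\<close> is 1 - s
    times that of \<open>?\<chi>\<close>. At 0 both traces vanish, and at 1 only
    \<open>?\<phi>\<close> remains.\<close>
  let ?F = "\<lambda>s. of_real (1 - s) * ?\<chi> s + ?\<phi> s"
  have "(?F has_vector_derivative of_real (1 - r) * ?g r) (at r within {0..1})" if r: "r \<in> {0..1}" for r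
  proof -
    have "((\<lambda>s. complex_of_real (1 - s)) has_vector_derivative - 1) (at r within {0..1})"
      by (auto intro!: derivative_eq_intros simp: has_vector_derivative_def scaleR_conv_of_real)
    from has_vector_derivative_add[OF has_vector_derivative_mult[OF this \<chi>'[OF r]] \<phi>'[OF r]]
    show ?thesis by simp
  qed
  then have "((\<lambda>s. of_real (1 - s) * ?g s) has_integral (?F 1 - ?F 0)) {0..1}"
    by (intro fundamental_theorem_of_calculus) auto
  then show ?thesis by (simp add: T0 T1)
qed

end

section \<open>Positivity of the Poisson kernel of a contraction\<close>

text \<open>The value is independent of j. Thus the average over t of (t L + (1 - t) R)^n, for
  commuting L and R, is the sum of all L^j R^(n-j) divided by n + 1.\<close>

lemma Bernstein_has_integral:
  assumes "j \<le> n"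
  shows "(Bernstein n j has_integral 1 / (real n + 1)) {0..1}"
proof -
  have "((\<lambda>t. t powr (real (j + 1) - 1) * (1 - t) powr (real (n - j + 1) - 1)) has_integral
      Beta (real (j + 1)) (real (n - j + 1))) {0..1}"
    by (rule has_integral_Beta_real) auto
  \<comment> \<open>On the open interval \<open>powr\<close> agrees with the power; at the endpoints
    \<open>0 powr 0 = 0\<close> but \<open>0 ^ 0 = 1\<close>.\<close>
  then have "((\<lambda>t. t powr (real (j + 1) - 1) * (1 - t) powr (real (n - j + 1) - 1)) has_integral
      Beta (real (j + 1)) (real (n - j + 1))) {0<..<1}"
    by (simp only: has_integral_Icc_iff_Ioo)
  then have "((\<lambda>t. t ^ j * (1 - t) ^ (n - j)) has_integral Beta (real (j + 1)) (real (n - j + 1))) {0<..<1}"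
    by (rule has_integral_eq[rotated]) (simp add: powr_realpow)
  then have "((\<lambda>t. t ^ j * (1 - t) ^ (n - j)) has_integral Beta (real (j + 1)) (real (n - j + 1))) {0..1}"
    by (simp only: has_integral_Icc_iff_Ioo)
  then have 1: "((\<lambda>t. real (n choose j) * (t ^ j * (1 - t) ^ (n - j))) has_integral
      real (n choose j) * Beta (real (j + 1)) (real (n - j + 1))) {0..1}"
    by (rule has_integral_mult_right)
  have G: "Gamma (real (k + 1)) = fact k" for k
    using Gamma_fact[of k, where 'a = real] by (simp add: add.commute)
  have "Beta (real (j + 1)) (real (n - j + 1)) = Gamma (real (j + 1)) * Gamma (real (n - j + 1)) / Gamma (real (Suc n + 1))"
    using assms by (simp add: Beta_def of_nat_diff add_ac)
  also have "\<dots> = fact j * fact (n - j) / fact (Suc n)"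
    unfolding G by simp
  finally have "real (n choose j) * Beta (real (j + 1)) (real (n - j + 1)) = fact n / fact (Suc n)"
    using binomial_fact[OF assms, where 'a = real] by simp
  also have "\<dots> = 1 / (real n + 1)" by (subst fact_Suc) (simp add: add.commute)
  finally have 2: "real (n choose j) * Beta (real (j + 1)) (real (n - j + 1)) = 1 / (real n + 1)" .
  have 3: "Bernstein n j = (\<lambda>t. real (n choose j) * (t ^ j * (1 - t) ^ (n - j)))"
    by (intro ext) (simp add: Bernstein_def mult.assoc)
  show ?thesis using 1 unfolding 2 3 .
qed

lemma power_deriv_Suc_sum:
  "power_deriv A x (Suc n) = (\<Sum>j\<le>n. power_op A j o\<^sub>L (x o\<^sub>L power_op A (n - j)))"
  by (simp add: power_deriv_sum lessThan_Suc_atMost del: power_deriv.simps)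

lemma compose_sum_left: "(sum f I) o\<^sub>L A = (\<Sum>i\<in>I. f i o\<^sub>L A)"
  by (intro blinfun_eqI) (simp add: blinfun.sum_left)

lemma power_op_Suc_right: "power_op A (Suc n) = power_op A n o\<^sub>L A"
  by (intro blinfun_eqI) (simp add: power_op_apply funpow_swap1)

text \<open>\<open>mixed_power A t x n\<close> is \<open>W\<^sup>n x\<close> for \<open>W x = t A x + (1 - t) x A\<close>; left and right multiplication by \<open>A\<close>
  commute, which is why Bernstein polynomials appear.\<close>

definition mixed_power :: "('a::complex_inner_space \<Rightarrow>\<^sub>L 'a) \<Rightarrow> real \<Rightarrow> ('a \<Rightarrow>\<^sub>L 'a) \<Rightarrow> nat \<Rightarrow> 'a \<Rightarrow>\<^sub>L 'a" where
  "mixed_power A t x n = (\<Sum>j\<le>n. Bernstein n j t *\<^sub>R (power_op A j o\<^sub>L (x o\<^sub>L power_op A (n - j))))"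

lemma Bernstein_Suc_Suc:
  "Bernstein (Suc n) (Suc j) t = t * Bernstein n j t + (1 - t) * Bernstein n (Suc j) t"
proof (cases "j < n")
  case True
  then have "n - j = Suc (n - Suc j)" by simp
  then show ?thesis by (simp add: Bernstein_def algebra_simps)
qed (auto simp: Bernstein_def not_less le_less binomial_eq_0)

lemma Bernstein_Suc_0: "Bernstein (Suc n) 0 t = (1 - t) * Bernstein n 0 t"
  by (simp add: Bernstein_def)

lemma mixed_power_0: "mixed_power A t x 0 = x"
  by (simp add: mixed_power_def Bernstein_def) (intro blinfun_eqI; simp)

lemma mixed_power_Suc:
  "mixed_power A t x (Suc n) = t *\<^sub>R (A o\<^sub>L mixed_power A t x n) + (1 - t) *\<^sub>R (mixed_power A t x n o\<^sub>L A)"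
proof -
  let ?X = "\<lambda>j l. power_op A j o\<^sub>L (x o\<^sub>L power_op A l)"
  have "mixed_power A t x (Suc n) = Bernstein (Suc n) 0 t *\<^sub>R ?X 0 (Suc n) +
      (\<Sum>j\<le>n. Bernstein (Suc n) (Suc j) t *\<^sub>R ?X (Suc j) (n - j))"
    unfolding mixed_power_def by (subst sum.atMost_Suc_shift) simp
  also have "(\<Sum>j\<le>n. Bernstein (Suc n) (Suc j) t *\<^sub>R ?X (Suc j) (n - j)) =
      (\<Sum>j\<le>n. t *\<^sub>R (Bernstein n j t *\<^sub>R ?X (Suc j) (n - j))) +
      (\<Sum>j\<le>n. (1 - t) *\<^sub>R (Bernstein n (Suc j) t *\<^sub>R ?X (Suc j) (n - j)))"
    by (simp add: Bernstein_Suc_Suc scaleR_add_left sum.distrib)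
  also have "(\<Sum>j\<le>n. t *\<^sub>R (Bernstein n j t *\<^sub>R ?X (Suc j) (n - j))) = t *\<^sub>R (A o\<^sub>L mixed_power A t x n)"
    unfolding mixed_power_def scaleR_sum_right compose_sum_right
    by (intro sum.cong refl blinfun_eqI) (simp add: power_op_Suc blinfun.bilinear_simps)
  also have "Bernstein (Suc n) 0 t *\<^sub>R ?X 0 (Suc n) + (t *\<^sub>R (A o\<^sub>L mixed_power A t x n) +
      (\<Sum>j\<le>n. (1 - t) *\<^sub>R (Bernstein n (Suc j) t *\<^sub>R ?X (Suc j) (n - j)))) =
      t *\<^sub>R (A o\<^sub>L mixed_power A t x n) +
      ((1 - t) *\<^sub>R (Bernstein n 0 t *\<^sub>R ?X 0 (Suc n)) +
      (\<Sum>j\<le>n. (1 - t) *\<^sub>R (Bernstein n (Suc j) t *\<^sub>R ?X (Suc j) (n - j))))"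
    by (simp add: Bernstein_Suc_0)
  also have "(1 - t) *\<^sub>R (Bernstein n 0 t *\<^sub>R ?X 0 (Suc n)) +
      (\<Sum>j\<le>n. (1 - t) *\<^sub>R (Bernstein n (Suc j) t *\<^sub>R ?X (Suc j) (n - j))) =
      (\<Sum>j\<le>Suc n. (1 - t) *\<^sub>R (Bernstein n j t *\<^sub>R ?X j (Suc n - j)))"
    by (subst sum.atMost_Suc_shift) simp
  \<comment> \<open>The term j = n + 1 drops out because its binomial coefficient is 0.\<close>
  also have "\<dots> = (\<Sum>j\<le>n. (1 - t) *\<^sub>R (Bernstein n j t *\<^sub>R ?X j (Suc n - j)))"
    by (simp add: Bernstein_def)
  also have "\<dots> = (1 - t) *\<^sub>R (mixed_power A t x n o\<^sub>L A)"
    unfolding mixed_power_def scaleR_sum_right compose_sum_left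
    by (intro sum.cong refl blinfun_eqI) (simp add: Suc_diff_le power_op_Suc_right blinfun.bilinear_simps)
  finally show ?thesis .
qed

lemma hs_norm_power_conjugation:
  fixes A x :: "'a::complex_hilbert_space \<Rightarrow>\<^sub>L 'a"
  assumes A: "complex_linear A" "norm A \<le> 1" and x: "hilbert_schmidt x"
  shows "hilbert_schmidt (power_op A j o\<^sub>L (x o\<^sub>L power_op A l))"
    and "hs_norm (power_op A j o\<^sub>L (x o\<^sub>L power_op A l)) \<le> hs_norm x"
proof -
  have p: "complex_linear (power_op A n)" "norm (power_op A n) \<le> 1" for n
    using A norm_power_op by auto
  note 1 = hilbert_schmidt_compose_right(1)[OF p(1)[of l] x]
  show "hilbert_schmidt (power_op A j o\<^sub>L (x o\<^sub>L power_op A l))"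
    by (rule hilbert_schmidt_compose_left(1)[OF p(1) 1])
  show "hs_norm (power_op A j o\<^sub>L (x o\<^sub>L power_op A l)) \<le> hs_norm x"
    using hs_norm_compose_contraction(1)[OF p[of j] 1] hs_norm_compose_contraction(2)[OF p[of l] x] by linarith
qed

lemma hilbert_schmidt_power_deriv:
  fixes A x :: "'a::complex_hilbert_space \<Rightarrow>\<^sub>L 'a"
  assumes A: "complex_linear A" "norm A \<le> 1" and x: "hilbert_schmidt x"
  shows "hilbert_schmidt (power_deriv A x n)" "hs_norm (power_deriv A x n) \<le> real n * hs_norm x"
proof -
  show hs: "hilbert_schmidt (power_deriv A x n)" for n
    unfolding power_deriv_sum by (intro hilbert_schmidt_sum hs_norm_power_conjugation A x)
  show "hs_norm (power_deriv A x n) \<le> real n * hs_norm x"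
  proof (induction n)
    case (Suc n)
    have 1: "hilbert_schmidt (A o\<^sub>L power_deriv A x n)" "hs_norm (A o\<^sub>L power_deriv A x n) \<le> hs_norm (power_deriv A x n)"
      using hilbert_schmidt_compose_left(1)[OF A(1) hs] hs_norm_compose_contraction(1)[OF A hs] by auto
    have 2: "hilbert_schmidt (x o\<^sub>L power_op A n)" "hs_norm (x o\<^sub>L power_op A n) \<le> hs_norm x"
      using hs_norm_power_conjugation[OF A x, of 0 n] by (auto simp: blinfun_compose_id)
    show ?case using hs_norm_add_le[OF 1(1) 2(1)] 1(2) 2(2) Suc by (simp add: algebra_simps)
  qed simp
qed

lemma hilbert_schmidt_mixed_power:
  fixes A x :: "'a::complex_hilbert_space \<Rightarrow>\<^sub>L 'a"
  assumes "complex_linear A" "norm A \<le> 1" "hilbert_schmidt x"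
  shows "hilbert_schmidt (mixed_power A t x n)"
  unfolding mixed_power_def
  by (intro hilbert_schmidt_sum hilbert_schmidt_scaleR hs_norm_power_conjugation assms)

lemma hs_inner_mixed_power_integral:
  fixes A x y :: "'a::complex_hilbert_space \<Rightarrow>\<^sub>L 'a"
  assumes A: "complex_linear A" "norm A \<le> 1" and x: "hilbert_schmidt x" and y: "hilbert_schmidt y"
  shows "((\<lambda>t. hs_inner (mixed_power A t x n) y) has_integral
     hs_inner (power_deriv A x (Suc n)) y / (of_nat n + 1)) {0..1}"
proof -
  let ?X = "\<lambda>j. hs_inner (power_op A j o\<^sub>L (x o\<^sub>L power_op A (n - j))) y"
  have X: "hilbert_schmidt (power_op A j o\<^sub>L (x o\<^sub>L power_op A l))" for j l
    by (rule hs_norm_power_conjugation(1)[OF A x])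
  have "((\<lambda>t. \<Sum>j\<le>n. Bernstein n j t *\<^sub>R ?X j) has_integral (\<Sum>j\<le>n. (1 / (real n + 1)) *\<^sub>R ?X j)) {0..1}"
    by (intro has_integral_sum has_integral_scaleR_left Bernstein_has_integral) auto
  moreover have "(\<Sum>j\<le>n. Bernstein n j t *\<^sub>R ?X j) = hs_inner (mixed_power A t x n) y" for t
    unfolding mixed_power_def
    by (subst hs_inner_sum_left) (auto intro!: hilbert_schmidt_scaleR X y simp: hs_inner_scaleR_left scaleR_conv_of_real)
  moreover have "(\<Sum>j\<le>n. (1 / (real n + 1)) *\<^sub>R ?X j) = hs_inner (power_deriv A x (Suc n)) y / (of_nat n + 1)"
    unfolding power_deriv_Suc_sum
    by (subst hs_inner_sum_left) (auto intro!: X y simp: sum_divide_distrib scaleR_conv_of_real)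
  ultimately show ?thesis by simp
qed

text \<open>Young's inequality with weight k = 1 - r^2: since (1 + k) r^2 = 1 - k^2 <= 1, the
  coefficient of a^2 remains 1. The large factor will only meet a term b that tends to 0.\<close>

lemma weighted_square_le:
  fixes a b r :: real
  assumes "0 \<le> a" "0 \<le> b" "0 \<le> r" "r < 1"
  shows "(r * a + b)\<^sup>2 \<le> a\<^sup>2 + (1 + 1 / (1 - r\<^sup>2)) * b\<^sup>2"
proof -
  define k where "k = 1 - r\<^sup>2"
  have k: "k > 0" using assms(3,4) by (simp add: k_def abs_square_less_1)
  have "0 \<le> (k * (r * a) - b)\<^sup>2" by simp
  then have "2 * (k * (r * a) * b) \<le> (k * (r * a))\<^sup>2 + b\<^sup>2" by (simp add: power2_diff)
  then have "2 * (r * a * b) \<le> k * (r * a)\<^sup>2 + b\<^sup>2 / k"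
    using k by (simp add: field_simps power2_eq_square)
  moreover have "(1 + k) * (r * a)\<^sup>2 \<le> a\<^sup>2"
  proof -
    have "(1 + k) * r\<^sup>2 = 1 - k\<^sup>2" by (simp add: k_def power2_eq_square algebra_simps)
    then have "(1 + k) * r\<^sup>2 \<le> 1" by simp
    then have "(1 + k) * r\<^sup>2 * a\<^sup>2 \<le> 1 * a\<^sup>2" by (intro mult_right_mono) auto
    then show ?thesis by (simp add: power_mult_distrib mult.assoc)
  qed
  ultimately show ?thesis by (simp add: power2_sum algebra_simps k_def[symmetric])
qed

text \<open>A truncated form of the inequality \<open>Re ((1 + X) (1 - X)\<^sup>-\<^sup>1) \<ge> 0\<close> for the strict contraction
  \<open>X = \<zeta> W\<close>, proved without inverting \<open>1 - X\<close>: with \<open>u\<close> the truncated Neumann series of \<open>y\<close>,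
  \<open>u - y\<close> is \<open>X u\<close> up to the small term \<open>X\<^sup>K y\<close>.\<close>

lemma herglotz_truncated:
  fixes w :: "nat \<Rightarrow> 'a::complex_hilbert_space \<Rightarrow>\<^sub>L 'a" and W :: "('a \<Rightarrow>\<^sub>L 'a) \<Rightarrow> 'a \<Rightarrow>\<^sub>L 'a"
  assumes w: "\<And>n. hilbert_schmidt (w n)" "\<And>n. w (Suc n) = W (w n)"
    and W: "\<And>z. hilbert_schmidt z \<Longrightarrow> hs_norm (W z) \<le> hs_norm z"
    and W_sum: "\<And>c. W (\<Sum>n<K. scale_op (c n) (w n)) = (\<Sum>n<K. scale_op (c n) (W (w n)))"
    and \<zeta>: "cmod \<zeta> < 1"
  shows "2 * Re (\<Sum>n<K. \<zeta> ^ n * hs_inner (w n) (w 0)) - (hs_norm (w 0))\<^sup>2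
    \<ge> - ((1 + 1 / (1 - (cmod \<zeta>)\<^sup>2)) * (cmod \<zeta> ^ K * hs_norm (w 0))\<^sup>2)"
proof -
  let ?y = "w 0"
  define u where "u = (\<Sum>n<K. scale_op (\<zeta> ^ n) (w n))"
  define d where "d = scale_op (\<zeta> ^ K) (w K)"
  have u: "hilbert_schmidt u" unfolding u_def by (intro hilbert_schmidt_sum hilbert_schmidt_scale w)
  have d: "hilbert_schmidt d" unfolding d_def by (intro hilbert_schmidt_scale w)
  have "hs_norm (w n) \<le> hs_norm ?y" for n
    by (induction n) (use w W order_trans in \<open>auto intro: order_trans\<close>)
  then have nd: "hs_norm d \<le> cmod \<zeta> ^ K * hs_norm ?y"
    unfolding d_def hs_norm_scale by (simp add: norm_power mult_left_mono)
  \<comment> \<open>Splitting the sum over n <= K at its last or at its first term gives u + d = y +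
    \<open>\<zeta>\<close> W u, the resolvent equation with defect d.\<close>
  have "(\<Sum>n<Suc K. scale_op (\<zeta> ^ n) (w n)) = ?y + (\<Sum>n<K. scale_op (\<zeta> ^ Suc n) (w (Suc n)))"
  proof (subst sum.lessThan_Suc_shift)
    have "scale_op (\<zeta> ^ 0) ?y = ?y" by (intro blinfun_eqI) (simp add: scale_op_apply scaleC_one)
    then show "scale_op (\<zeta> ^ 0) (w 0) + (\<Sum>n<K. scale_op (\<zeta> ^ Suc n) (w (Suc n))) = ?y + (\<Sum>n<K. scale_op (\<zeta> ^ Suc n) (w (Suc n)))"
      by simp
  qed
  moreover have "(\<Sum>n<K. scale_op (\<zeta> ^ Suc n) (w (Suc n))) = scale_op \<zeta> (W u)"
    unfolding u_def W_sum w(2)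
    by (intro blinfun_eqI)
      (simp add: scale_op_apply blinfun.sum_left complex_space.scale_sum_right scaleC_scaleC)
  ultimately have eq: "u + d = ?y + scale_op \<zeta> (W u)" by (simp add: u_def d_def)
  define X where "X = u - ?y"
  have X: "hilbert_schmidt X" unfolding X_def by (intro hilbert_schmidt_diff u w)
  have "X + d = scale_op \<zeta> (W u)" using eq by (simp add: X_def algebra_simps)
  then have "hs_norm (X + d) \<le> cmod \<zeta> * hs_norm u"
    using W[OF u] by (simp add: hs_norm_scale mult_left_mono)
  moreover have "hs_norm X \<le> hs_norm (X + d) + hs_norm d"
    using hs_norm_add_le[of "X + d" "(-1) *\<^sub>R d"] X d hs_norm_scaleR[of "-1" d]
    hilbert_schmidt_scaleR[OF d, of "-1"]
    by (simp add: hilbert_schmidt_add)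
  ultimately have "hs_norm X \<le> cmod \<zeta> * hs_norm u + cmod \<zeta> ^ K * hs_norm ?y" using nd by linarith
  then have "(hs_norm X)\<^sup>2 \<le> (cmod \<zeta> * hs_norm u + cmod \<zeta> ^ K * hs_norm ?y)\<^sup>2" by (intro power_mono) auto
  also have "\<dots> \<le> (hs_norm u)\<^sup>2 + (1 + 1 / (1 - (cmod \<zeta>)\<^sup>2)) * (cmod \<zeta> ^ K * hs_norm ?y)\<^sup>2"
    using \<zeta> by (intro weighted_square_le) auto
  finally have 1: "(hs_norm X)\<^sup>2 \<le> (hs_norm u)\<^sup>2 + (1 + 1 / (1 - (cmod \<zeta>)\<^sup>2)) * (cmod \<zeta> ^ K * hs_norm ?y)\<^sup>2" .
  \<comment> \<open>By this expansion \<open>(hs_norm u)\<^sup>2 - (hs_norm X)\<^sup>2\<close> is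
    exactly \<open>2 * Re (hs_inner u ?y) - (hs_norm ?y)\<^sup>2\<close>, and X is longer than u by
    at most the small error.\<close>
  have "(hs_norm u)\<^sup>2 = (hs_norm X)\<^sup>2 + 2 * Re (hs_inner X ?y) + (hs_norm ?y)\<^sup>2"
    using hs_norm_add_square[OF X w(1), of 0] by (simp add: X_def)
  moreover have "hs_inner X ?y = hs_inner u ?y - of_real ((hs_norm ?y)\<^sup>2)"
    unfolding X_def using hs_inner_diff_left[OF u w(1) w(1)] hs_inner_self[OF w(1)] by simp
  moreover have "hs_inner u ?y = (\<Sum>n<K. \<zeta> ^ n * hs_inner (w n) ?y)"
    unfolding u_def by (subst hs_inner_sum_left) (auto intro: hilbert_schmidt_scale w simp: hs_inner_scale_left)
  ultimately show ?thesis using 1 by simp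
qed

text \<open>For fixed t the map X -> t A X + (1 - t) X A is a contraction in the Hilbert-Schmidt
  norm, so \<open>herglotz_truncated\<close> applies to its powers; averaging over t replaces them
  by \<open>power_deriv\<close>.\<close>

lemma herglotz_power_deriv:
  fixes A y :: "'a::complex_hilbert_space \<Rightarrow>\<^sub>L 'a"
  assumes A: "complex_linear A" "norm A \<le> 1" and y: "hilbert_schmidt y" and \<zeta>: "cmod \<zeta> < 1"
  shows "2 * Re (\<Sum>n<K. \<zeta> ^ n * (hs_inner (power_deriv A y (Suc n)) y / (of_nat n + 1))) - (hs_norm y)\<^sup>2
    \<ge> - ((1 + 1 / (1 - (cmod \<zeta>)\<^sup>2)) * (cmod \<zeta> ^ K * hs_norm y)\<^sup>2)" (is "_ \<ge> - ?C")
proof -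
  have pos: "2 * Re (\<Sum>n<K. \<zeta> ^ n * hs_inner (mixed_power A t y n) y) - (hs_norm y)\<^sup>2 \<ge> - ?C"
    if t: "t \<in> {0..1}" for t
  proof -
    define W where "W = (\<lambda>z. t *\<^sub>R (A o\<^sub>L z) + (1 - t) *\<^sub>R (z o\<^sub>L A))"
    have hs: "hilbert_schmidt (mixed_power A t y n)" for n by (rule hilbert_schmidt_mixed_power[OF A y])
    have "2 * Re (\<Sum>n<K. \<zeta> ^ n * hs_inner (mixed_power A t y n) (mixed_power A t y 0)) - (hs_norm (mixed_power A t y 0))\<^sup>2
      \<ge> - ((1 + 1 / (1 - (cmod \<zeta>)\<^sup>2)) * (cmod \<zeta> ^ K * hs_norm (mixed_power A t y 0))\<^sup>2)"
    proof (rule herglotz_truncated[where W = W])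
      show "mixed_power A t y (Suc n) = W (mixed_power A t y n)" for n by (simp add: mixed_power_Suc W_def)
      show "hs_norm (W z) \<le> hs_norm z" if z: "hilbert_schmidt z" for z
      proof -
        have "hs_norm (W z) \<le> t * hs_norm (A o\<^sub>L z) + (1 - t) * hs_norm (z o\<^sub>L A)"
          unfolding W_def
          using t hs_norm_add_le[OF hilbert_schmidt_scaleR[OF hilbert_schmidt_compose_left(1)[OF A(1) z], of t]
              hilbert_schmidt_scaleR[OF hilbert_schmidt_compose_right(1)[OF A(1) z], of "1 - t"]]
          by (simp add: hs_norm_scaleR)
        also have "\<dots> \<le> t * hs_norm z + (1 - t) * hs_norm z"
          using t hs_norm_compose_contraction[OF A z] by (intro add_mono mult_left_mono) auto
        finally show ?thesis by (simp add: algebra_simps)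
      qed
      have Wadd: "W (a + b) = W a + W b" for a b
        unfolding W_def by (intro blinfun_eqI) (simp add: blinfun.bilinear_simps scaleR_add_right)
      have W0: "W 0 = 0" unfolding W_def by (intro blinfun_eqI) simp
      have Wscale: "W (scale_op c a) = scale_op c (W a)" for c a
        unfolding W_def
        by (intro blinfun_eqI)
          (simp add: blinfun.bilinear_simps scale_op_apply complex_linearD[OF A(1)] scaleC_add_right scaleC_scaleR)
      show "W (\<Sum>n<K. scale_op (c n) (mixed_power A t y n)) = (\<Sum>n<K. scale_op (c n) (W (mixed_power A t y n)))" for c
        by (induction K) (simp_all add: W0 Wadd Wscale)
    qed (use hs \<zeta> in auto)
    then show ?thesis by (simp add: mixed_power_0)
  qed
  have 1: "((\<lambda>t. 2 * Re (\<Sum>n<K. \<zeta> ^ n * hs_inner (mixed_power A t y n) y) - (hs_norm y)\<^sup>2) has_integral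
     (2 * Re (\<Sum>n<K. \<zeta> ^ n * (hs_inner (power_deriv A y (Suc n)) y / (of_nat n + 1))) - (hs_norm y)\<^sup>2)) {0..1}"
  proof -
    have "((\<lambda>t. \<Sum>n<K. \<zeta> ^ n * hs_inner (mixed_power A t y n) y) has_integral
        (\<Sum>n<K. \<zeta> ^ n * (hs_inner (power_deriv A y (Suc n)) y / (of_nat n + 1)))) {0..1}"
      by (intro has_integral_sum has_integral_mult_right hs_inner_mixed_power_integral A y) auto
    from has_integral_linear[OF this bounded_linear_Re]
    have "((\<lambda>t. Re (\<Sum>n<K. \<zeta> ^ n * hs_inner (mixed_power A t y n) y)) has_integral
        Re (\<Sum>n<K. \<zeta> ^ n * (hs_inner (power_deriv A y (Suc n)) y / (of_nat n + 1)))) {0..1}"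
      by (simp only: o_def)
    from has_integral_diff[OF has_integral_mult_right[OF this, of 2] has_integral_const_real[of "(hs_norm y)\<^sup>2" 0 1]]
    show ?thesis by simp
  qed
  have 2: "((\<lambda>t. - ?C) has_integral - ?C) {0..1::real}" using has_integral_const_real[of "- ?C" 0 1] by simp
  show ?thesis by (rule has_integral_le[OF 2 1 pos])
qed

section \<open>Moments averaged over the segment\<close>

lemma power_op_lipschitz:
  assumes "norm A \<le> 1" "norm B \<le> 1"
  shows "norm (power_op A n - power_op B n) \<le> real n * norm (A - B)"
proof (induction n)
  case (Suc n)
  have "power_op A (Suc n) - power_op B (Suc n) = (A o\<^sub>L (power_op A n - power_op B n)) + ((A - B) o\<^sub>L power_op B n)"
    by (intro blinfun_eqI) (simp add: power_op_Suc blinfun.bilinear_simps)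
  moreover have "norm (A o\<^sub>L (power_op A n - power_op B n)) \<le> 1 * norm (power_op A n - power_op B n)"
    using assms by (intro order_trans[OF norm_blinfun_compose] mult_right_mono) auto
  moreover have "norm ((A - B) o\<^sub>L power_op B n) \<le> norm (A - B) * 1"
    using norm_power_op[OF assms(2)] by (intro order_trans[OF norm_blinfun_compose] mult_left_mono) auto
  ultimately show ?case
    using Suc norm_triangle_ineq[of "A o\<^sub>L (power_op A n - power_op B n)" "(A - B) o\<^sub>L power_op B n"]
    by (simp add: algebra_simps)
qed simp

text \<open>Gives continuity in s of the integrand of \<open>segment_kernel\<close>; the operator
  norm of A - B is enough since x carries the Hilbert-Schmidt norm.\<close>

lemma power_deriv_lipschitz:
  fixes A B x :: "'a::complex_hilbert_space \<Rightarrow>\<^sub>L 'a"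
  assumes A: "complex_linear A" "norm A \<le> 1" and B: "complex_linear B" "norm B \<le> 1"
    and x: "hilbert_schmidt x"
  shows "hs_norm (power_deriv A x n - power_deriv B x n) \<le> (real n)\<^sup>2 * (norm (A - B) * hs_norm x)"
proof (induction n)
  case (Suc n)
  note pA = hilbert_schmidt_power_deriv[OF A x] and pB = hilbert_schmidt_power_deriv[OF B x]
  let ?L = "norm (A - B) * hs_norm x"
  define D where "D = power_deriv A x n - power_deriv B x n"
  have D: "hilbert_schmidt D" "hs_norm D \<le> (real n)\<^sup>2 * ?L"
    unfolding D_def using Suc hilbert_schmidt_diff[OF pA(1) pB(1)] by auto
  have clAB: "complex_linear (A - B)" "complex_linear (power_op A n - power_op B n)" using A B by auto
  have eq: "power_deriv A x (Suc n) - power_deriv B x (Suc n) =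
      (A o\<^sub>L D) + (((A - B) o\<^sub>L power_deriv B x n) + (x o\<^sub>L (power_op A n - power_op B n)))"
    unfolding D_def by (intro blinfun_eqI) (simp add: blinfun.bilinear_simps)
  have 1: "hilbert_schmidt (A o\<^sub>L D)" "hs_norm (A o\<^sub>L D) \<le> (real n)\<^sup>2 * ?L"
    using hilbert_schmidt_compose_left(1)[OF A(1) D(1)] hs_norm_compose_contraction(1)[OF A D(1)] D(2) by auto
  have 2: "hilbert_schmidt ((A - B) o\<^sub>L power_deriv B x n)"
    by (rule hilbert_schmidt_compose_left(1)[OF clAB(1) pB(1)])
  have "hs_norm ((A - B) o\<^sub>L power_deriv B x n) \<le> norm (A - B) * (real n * hs_norm x)"
    using hilbert_schmidt_compose_left(2)[OF clAB(1) pB(1)[of n]] mult_left_mono[OF pB(2)[of n] norm_ge_zero[of "A - B"]] by linarith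
  then have b2: "hs_norm ((A - B) o\<^sub>L power_deriv B x n) \<le> real n * ?L" by (simp add: mult_ac)
  have 3: "hilbert_schmidt (x o\<^sub>L (power_op A n - power_op B n))"
    by (rule hilbert_schmidt_compose_right(1)[OF clAB(2) x])
  have "hs_norm (x o\<^sub>L (power_op A n - power_op B n)) \<le> hs_norm x * (real n * norm (A - B))"
    using hilbert_schmidt_compose_right(2)[OF clAB(2) x] mult_left_mono[OF power_op_lipschitz[OF A(2) B(2), of n] hs_norm_nonneg[of x]] by linarith
  then have b3: "hs_norm (x o\<^sub>L (power_op A n - power_op B n)) \<le> real n * ?L" by (simp add: mult_ac)
  have "hs_norm (power_deriv A x (Suc n) - power_deriv B x (Suc n)) \<le> (real n)\<^sup>2 * ?L + (real n * ?L + real n * ?L)"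
    unfolding eq using hs_norm_add_le[OF 1(1) hilbert_schmidt_add[OF 2 3]] hs_norm_add_le[OF 2 3] 1(2) b2 b3 by linarith
  also have "\<dots> \<le> (real (Suc n))\<^sup>2 * ?L" by (simp add: power2_eq_square algebra_simps)
  finally show ?case .
qed simp

lemma power_deriv_diff_right: "power_deriv A (x - y) n = power_deriv A x n - power_deriv A y n"
proof (induction n)
  case (Suc n)
  have "power_deriv A (x - y) (Suc n) v = (power_deriv A x (Suc n) - power_deriv A y (Suc n)) v" for v
    by (simp add: Suc blinfun.diff_left blinfun.add_left blinfun.diff_right)
  then show ?case by (rule blinfun_eqI)
qed simp

lemma power_deriv_scale: "complex_linear A \<Longrightarrow> power_deriv A (scale_op c x) n = scale_op c (power_deriv A x n)"
proof (induction n)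
  case 0
  show ?case by (intro blinfun_eqI) (simp add: scale_op_apply)
next
  case (Suc n)
  then show ?case by (intro blinfun_eqI) (simp add: blinfun.bilinear_simps scale_op_apply complex_linearD scaleC_add_right)
qed

text \<open>The double operator integral of the divided difference of \<open>z\<^sup>n\<^sup>+\<^sup>1 / (n + 1)\<close>, averaged over the segment
  with the weight \<open>1 - s\<close> of the Taylor remainder.\<close>

definition segment_kernel ::
  "(real \<Rightarrow> 'a::complex_hilbert_space \<Rightarrow>\<^sub>L 'a) \<Rightarrow> real \<Rightarrow> real \<Rightarrow> nat \<Rightarrow> ('a \<Rightarrow>\<^sub>L 'a) \<Rightarrow> ('a \<Rightarrow>\<^sub>L 'a) \<Rightarrow> complex" where
  "segment_kernel T a b n x y = integral {a..b}
     (\<lambda>s. of_real (1 - s) * (hs_inner (power_deriv (T s) x (Suc n)) y / (of_nat n + 1)))"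

context
  fixes T :: "real \<Rightarrow> 'a::complex_hilbert_space \<Rightarrow>\<^sub>L 'a" and L a b :: real
  assumes T_lin: "\<And>s. s \<in> {0..1} \<Longrightarrow> complex_linear (T s)"
    and T_norm: "\<And>s. s \<in> {0..1} \<Longrightarrow> norm (T s) \<le> 1"
    and T_lip: "\<And>s r. s \<in> {0..1} \<Longrightarrow> r \<in> {0..1} \<Longrightarrow> norm (T s - T r) \<le> L * \<bar>s - r\<bar>"
    and ab: "0 \<le> a" "a \<le> b" "b \<le> 1"
begin

lemma power_deriv_inner_bound:
  assumes x: "hilbert_schmidt x" and y: "hilbert_schmidt y" and s: "s \<in> {0..1}"
  shows "cmod (hs_inner (power_deriv (T s) x (Suc n)) y / (of_nat n + 1)) \<le> hs_norm x * hs_norm y"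
proof -
  note p = hilbert_schmidt_power_deriv[OF T_lin[OF s] T_norm[OF s] x]
  have "cmod (hs_inner (power_deriv (T s) x (Suc n)) y) \<le> hs_norm (power_deriv (T s) x (Suc n)) * hs_norm y"
    by (rule hs_cauchy_schwarz[OF p(1) y])
  also have "\<dots> \<le> (real (Suc n) * hs_norm x) * hs_norm y" by (intro mult_right_mono p(2)) simp
  finally have "cmod (hs_inner (power_deriv (T s) x (Suc n)) y) \<le> hs_norm x * hs_norm y * (real n + 1)"
    by (simp add: mult_ac add.commute del: power_deriv.simps)
  moreover have "cmod (complex_of_nat n + 1) = real n + 1"
    using norm_of_nat[of "Suc n", where 'a = complex] by (simp add: add.commute)
  ultimately show ?thesis by (simp only: norm_divide) (simp add: pos_divide_le_eq)
qed

lemma segment_kernel_integrable: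
  assumes x: "hilbert_schmidt x" and y: "hilbert_schmidt y"
  shows "(\<lambda>s. of_real (1 - s) * (hs_inner (power_deriv (T s) x (Suc n)) y / (of_nat n + 1))) integrable_on {a..b}"
proof (rule integrable_continuous_real)
  let ?C = "(real (Suc n))\<^sup>2 * L * hs_norm x * hs_norm y"
  have "dist (hs_inner (power_deriv (T s) x (Suc n)) y) (hs_inner (power_deriv (T r) x (Suc n)) y) \<le> ?C * dist s r"
    if s: "s \<in> {0..1}" and r: "r \<in> {0..1}" for s r
  proof -
    note p = hilbert_schmidt_power_deriv(1)[OF T_lin[OF s] T_norm[OF s] x, of "Suc n"]
      hilbert_schmidt_power_deriv(1)[OF T_lin[OF r] T_norm[OF r] x, of "Suc n"]
    have "dist (hs_inner (power_deriv (T s) x (Suc n)) y) (hs_inner (power_deriv (T r) x (Suc n)) y) =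
        cmod (hs_inner (power_deriv (T s) x (Suc n) - power_deriv (T r) x (Suc n)) y)"
      by (simp only: dist_norm hs_inner_diff_left[OF p y])
    also have "\<dots> \<le> hs_norm (power_deriv (T s) x (Suc n) - power_deriv (T r) x (Suc n)) * hs_norm y"
      by (rule hs_cauchy_schwarz[OF hilbert_schmidt_diff[OF p] y])
    also have "\<dots> \<le> ((real (Suc n))\<^sup>2 * (norm (T s - T r) * hs_norm x)) * hs_norm y"
      by (intro mult_right_mono power_deriv_lipschitz T_lin T_norm s r x) simp
    also have "\<dots> \<le> ((real (Suc n))\<^sup>2 * ((L * \<bar>s - r\<bar>) * hs_norm x)) * hs_norm y"
      by (intro mult_right_mono mult_left_mono T_lip s r) auto
    finally show ?thesis by (simp add: dist_real_def mult_ac del: of_nat_Suc)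
  qed
  moreover have "?C \<ge> 0"
  proof -
    have "norm (T 0 - T 1) \<le> L" using T_lip[of 0 1] by simp
    then have "L \<ge> 0" using norm_ge_zero order_trans by blast
    then show ?thesis by (intro mult_nonneg_nonneg) auto
  qed
  ultimately have "?C-lipschitz_on {0..1} (\<lambda>s. hs_inner (power_deriv (T s) x (Suc n)) y)"
    by (intro lipschitz_onI)
  then have "continuous_on {0..1} (\<lambda>s. hs_inner (power_deriv (T s) x (Suc n)) y)"
    by (rule lipschitz_on_continuous_on)
  then have "continuous_on {a..b} (\<lambda>s. hs_inner (power_deriv (T s) x (Suc n)) y)"
    by (rule continuous_on_subset) (use ab in auto)
  then show "continuous_on {a..b} (\<lambda>s. of_real (1 - s) * (hs_inner (power_deriv (T s) x (Suc n)) y / (of_nat n + 1)))"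
    by (auto intro!: continuous_intros simp del: power_deriv.simps simp: complex_eq_iff)
qed

lemmas segment_kernel_has_integral =
  integrable_integral[OF segment_kernel_integrable, folded segment_kernel_def]

lemma segment_kernel_bound:
  assumes x: "hilbert_schmidt x" and y: "hilbert_schmidt y"
  shows "cmod (segment_kernel T a b n x y) \<le> (b - a) * (hs_norm x * hs_norm y)"
proof -
  have "cmod (segment_kernel T a b n x y) \<le> hs_norm x * hs_norm y * measure lborel (cbox a b)"
  proof (rule has_integral_bound)
    show "((\<lambda>s. of_real (1 - s) * (hs_inner (power_deriv (T s) x (Suc n)) y / (of_nat n + 1))) has_integral
        segment_kernel T a b n x y) (cbox a b)"
      using segment_kernel_has_integral[OF x y] by simp
    fix s assume "s \<in> cbox a b"
    then have s: "s \<in> {0..1}" using ab by auto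
    have "cmod (of_real (1 - s) * (hs_inner (power_deriv (T s) x (Suc n)) y / (of_nat n + 1))) \<le> 1 * (hs_norm x * hs_norm y)"
    proof -
      have "cmod (complex_of_real (1 - s)) \<le> 1" unfolding norm_of_real using s by auto
      then show ?thesis
        unfolding norm_mult by (intro mult_mono power_deriv_inner_bound x y s) auto
    qed
    then show "cmod (of_real (1 - s) * (hs_inner (power_deriv (T s) x (Suc n)) y / (of_nat n + 1))) \<le> hs_norm x * hs_norm y"
      by simp
  qed simp
  then show ?thesis using ab by (simp add: mult.commute)
qed

lemma segment_kernel_diff_left:
  assumes x: "hilbert_schmidt x" and x': "hilbert_schmidt x'" and y: "hilbert_schmidt y"
  shows "segment_kernel T a b n (x - x') y = segment_kernel T a b n x y - segment_kernel T a b n x' y"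
  unfolding segment_kernel_def
proof (subst integral_diff[symmetric, OF segment_kernel_integrable[OF x y] segment_kernel_integrable[OF x' y]],
    rule integral_cong)
  fix s assume "s \<in> {a..b}"
  then have s: "s \<in> {0..1}" using ab by auto
  note p = hilbert_schmidt_power_deriv(1)[OF T_lin[OF s] T_norm[OF s], of _ "Suc n"]
  show "of_real (1 - s) * (hs_inner (power_deriv (T s) (x - x') (Suc n)) y / (of_nat n + 1)) =
     of_real (1 - s) * (hs_inner (power_deriv (T s) x (Suc n)) y / (of_nat n + 1)) -
     of_real (1 - s) * (hs_inner (power_deriv (T s) x' (Suc n)) y / (of_nat n + 1))"
    unfolding power_deriv_diff_right hs_inner_diff_left[OF p[OF x] p[OF x'] y]
    by (simp only: diff_divide_distrib right_diff_distrib)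
qed

lemma segment_kernel_diff_right:
  assumes x: "hilbert_schmidt x" and y: "hilbert_schmidt y" and y': "hilbert_schmidt y'"
  shows "segment_kernel T a b n x (y - y') = segment_kernel T a b n x y - segment_kernel T a b n x y'"
  unfolding segment_kernel_def
proof (subst integral_diff[symmetric, OF segment_kernel_integrable[OF x y] segment_kernel_integrable[OF x y']],
    rule integral_cong)
  fix s assume "s \<in> {a..b}"
  then have s: "s \<in> {0..1}" using ab by auto
  note p = hilbert_schmidt_power_deriv(1)[OF T_lin[OF s] T_norm[OF s] x, of "Suc n"]
  show "of_real (1 - s) * (hs_inner (power_deriv (T s) x (Suc n)) (y - y') / (of_nat n + 1)) =
     of_real (1 - s) * (hs_inner (power_deriv (T s) x (Suc n)) y / (of_nat n + 1)) -
     of_real (1 - s) * (hs_inner (power_deriv (T s) x (Suc n)) y' / (of_nat n + 1))"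
    unfolding hs_inner_diff_right[OF y y' p]
    by (simp only: diff_divide_distrib right_diff_distrib)
qed

lemma segment_kernel_scale_left:
  "segment_kernel T a b n (scale_op c x) y = c * segment_kernel T a b n x y"
proof -
  have "segment_kernel T a b n (scale_op c x) y = integral {a..b}
     (\<lambda>s. c * (of_real (1 - s) * (hs_inner (power_deriv (T s) x (Suc n)) y / (of_nat n + 1))))"
    unfolding segment_kernel_def
  proof (rule integral_cong)
    fix s assume "s \<in> {a..b}"
    then have s: "s \<in> {0..1}" using ab by auto
    show "of_real (1 - s) * (hs_inner (power_deriv (T s) (scale_op c x) (Suc n)) y / (of_nat n + 1)) =
       c * (of_real (1 - s) * (hs_inner (power_deriv (T s) x (Suc n)) y / (of_nat n + 1)))"
      unfolding power_deriv_scale[OF T_lin[OF s]] hs_inner_scale_left by (simp del: power_deriv.simps)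
  qed
  then show ?thesis by (simp only: integral_mult_right segment_kernel_def)
qed

lemma segment_kernel_scale_right:
  "segment_kernel T a b n x (scale_op c y) = cnj c * segment_kernel T a b n x y"
proof -
  have "segment_kernel T a b n x (scale_op c y) = integral {a..b}
     (\<lambda>s. cnj c * (of_real (1 - s) * (hs_inner (power_deriv (T s) x (Suc n)) y / (of_nat n + 1))))"
    unfolding segment_kernel_def hs_inner_scale_right by (simp add: mult_ac del: power_deriv.simps)
  then show ?thesis by (simp only: integral_mult_right segment_kernel_def)
qed

text \<open>At n = 0 the integrand does not see the operators \<open>T s\<close>, so the total mass
  of the positive densities is known exactly. This is the source of the constant
  \<open>1/2\<close>.\<close>

lemma segment_kernel_0:
  "segment_kernel T a b 0 x y = of_real (integral {a..b} (\<lambda>s. 1 - s)) * hs_inner x y"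
proof -
  have i: "(\<lambda>s::real. 1 - s) integrable_on {a..b}" by (intro integrable_continuous_real continuous_intros)
  have pd: "power_deriv (T s) x (Suc 0) = x" for s by (intro blinfun_eqI) simp
  have "segment_kernel T a b 0 x y = integral {a..b} (\<lambda>s. of_real (1 - s) * hs_inner x y)"
    unfolding segment_kernel_def pd by simp
  also have "\<dots> = of_real (integral {a..b} (\<lambda>s. 1 - s)) * hs_inner x y"
    using has_integral_mult_left[OF has_integral_of_real[OF integrable_integral[OF i]], of "hs_inner x y"]
    by (intro integral_unique) auto
  finally show ?thesis .
qed

lemma segment_kernel_power_summable:
  assumes x: "hilbert_schmidt x" and y: "hilbert_schmidt y" and \<zeta>: "cmod \<zeta> < 1"
  shows "summable (\<lambda>n. \<zeta> ^ n * segment_kernel T a b n x y)"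
proof (rule summable_comparison_test')
  show "summable (\<lambda>n. cmod \<zeta> ^ n * ((b - a) * (hs_norm x * hs_norm y)))"
    using \<zeta> by (intro summable_mult2 summable_geometric) simp
  show "norm (\<zeta> ^ n * segment_kernel T a b n x y) \<le> cmod \<zeta> ^ n * ((b - a) * (hs_norm x * hs_norm y))" for n
    unfolding norm_mult norm_power by (intro mult_left_mono segment_kernel_bound x y) simp
qed

text \<open>The truncated inequality is integrated over s while the sums are finite; only afterwards
  K tends to infinity, and the error decays like \<open>cmod \<zeta> ^ (2 * K)\<close>.\<close>

lemma segment_kernel_herglotz:
  assumes y: "hilbert_schmidt y" and \<zeta>: "cmod \<zeta> < 1"
  shows "2 * Re (\<Sum>n. \<zeta> ^ n * segment_kernel T a b n y y) - Re (segment_kernel T a b 0 y y) \<ge> 0"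
proof (rule LIMSEQ_le_const)
  define w where "w = integral {a..b} (\<lambda>s. 1 - s :: real)"
  define C where "C = 1 + 1 / (1 - (cmod \<zeta>)\<^sup>2)"
  have w: "((\<lambda>s. 1 - s) has_integral w) {a..b}"
    unfolding w_def by (intro integrable_integral integrable_continuous_real continuous_intros)
  have q0: "Re (segment_kernel T a b 0 y y) = w * (hs_norm y)\<^sup>2"
    unfolding segment_kernel_0 hs_inner_self[OF y] w_def by simp
  have trunc: "2 * Re (\<Sum>n<K. \<zeta> ^ n * segment_kernel T a b n y y) - Re (segment_kernel T a b 0 y y)
      \<ge> - (w * (C * (cmod \<zeta> ^ K * hs_norm y)\<^sup>2))" for K
  proof (rule has_integral_le)
    let ?h = "\<lambda>s n. hs_inner (power_deriv (T s) y (Suc n)) y / (of_nat n + 1)"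
    have "((\<lambda>s. \<Sum>n<K. \<zeta> ^ n * (of_real (1 - s) * ?h s n)) has_integral (\<Sum>n<K. \<zeta> ^ n * segment_kernel T a b n y y)) {a..b}"
      by (intro has_integral_sum has_integral_mult_right segment_kernel_has_integral y) auto
    from has_integral_linear[OF this bounded_linear_Re]
    have 1: "((\<lambda>s. Re (\<Sum>n<K. \<zeta> ^ n * (of_real (1 - s) * ?h s n))) has_integral Re (\<Sum>n<K. \<zeta> ^ n * segment_kernel T a b n y y)) {a..b}"
      by (simp only: o_def)
    show "((\<lambda>s. 2 * Re (\<Sum>n<K. \<zeta> ^ n * (of_real (1 - s) * ?h s n)) - (1 - s) * (hs_norm y)\<^sup>2) has_integral
      (2 * Re (\<Sum>n<K. \<zeta> ^ n * segment_kernel T a b n y y) - Re (segment_kernel T a b 0 y y))) {a..b}"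
      unfolding q0 by (intro has_integral_diff has_integral_mult_right 1 has_integral_mult_left w)
    show "((\<lambda>s. - ((1 - s) * (C * (cmod \<zeta> ^ K * hs_norm y)\<^sup>2))) has_integral - (w * (C * (cmod \<zeta> ^ K * hs_norm y)\<^sup>2))) {a..b}"
      by (intro has_integral_neg has_integral_mult_left w)
    fix s assume "s \<in> {a..b}"
    then have s: "s \<in> {0..1}" using ab by auto
    have "- (C * (cmod \<zeta> ^ K * hs_norm y)\<^sup>2) \<le> 2 * Re (\<Sum>n<K. \<zeta> ^ n * ?h s n) - (hs_norm y)\<^sup>2"
      unfolding C_def by (rule herglotz_power_deriv[OF T_lin[OF s] T_norm[OF s] y \<zeta>])
    then have "(1 - s) * - (C * (cmod \<zeta> ^ K * hs_norm y)\<^sup>2) \<le> (1 - s) * (2 * Re (\<Sum>n<K. \<zeta> ^ n * ?h s n) - (hs_norm y)\<^sup>2)"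
      using s by (intro mult_left_mono) auto
    also have "\<dots> = 2 * ((1 - s) * Re (\<Sum>n<K. \<zeta> ^ n * ?h s n)) - (1 - s) * (hs_norm y)\<^sup>2"
      by (simp only: right_diff_distrib mult.left_commute)
    also have "(1 - s) * Re (\<Sum>n<K. \<zeta> ^ n * ?h s n) = Re (of_real (1 - s) * (\<Sum>n<K. \<zeta> ^ n * ?h s n))"
      by (simp only: Re_complex_of_real Im_complex_of_real times_complex.simps mult_zero_left diff_zero)
    also have "of_real (1 - s) * (\<Sum>n<K. \<zeta> ^ n * ?h s n) = (\<Sum>n<K. \<zeta> ^ n * (of_real (1 - s) * ?h s n))"
      by (simp only: sum_distrib_left mult.left_commute)
    finally show "- ((1 - s) * (C * (cmod \<zeta> ^ K * hs_norm y)\<^sup>2))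
        \<le> 2 * Re (\<Sum>n<K. \<zeta> ^ n * (of_real (1 - s) * ?h s n)) - (1 - s) * (hs_norm y)\<^sup>2"
      by (simp only: mult_minus_right)
  qed
  have "(\<lambda>K. cmod \<zeta> ^ K) \<longlonglongrightarrow> 0" using \<zeta> by (intro LIMSEQ_realpow_zero) simp_all
  then have err: "(\<lambda>K. w * (C * (cmod \<zeta> ^ K * hs_norm y)\<^sup>2)) \<longlonglongrightarrow> w * (C * (0 * hs_norm y)\<^sup>2)"
    by (intro tendsto_mult tendsto_power tendsto_const)
  have "(\<lambda>K. \<Sum>n<K. \<zeta> ^ n * segment_kernel T a b n y y) \<longlonglongrightarrow> (\<Sum>n. \<zeta> ^ n * segment_kernel T a b n y y)"
    by (rule summable_LIMSEQ[OF segment_kernel_power_summable[OF y y \<zeta>]])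
  then have "(\<lambda>K. 2 * Re (\<Sum>n<K. \<zeta> ^ n * segment_kernel T a b n y y) - Re (segment_kernel T a b 0 y y) + w * (C * (cmod \<zeta> ^ K * hs_norm y)\<^sup>2))
    \<longlonglongrightarrow> 2 * Re (\<Sum>n. \<zeta> ^ n * segment_kernel T a b n y y) - Re (segment_kernel T a b 0 y y) + w * (C * (0 * hs_norm y)\<^sup>2)"
    by (intro tendsto_intros err)
  then show "(\<lambda>K. 2 * Re (\<Sum>n<K. \<zeta> ^ n * segment_kernel T a b n y y) - Re (segment_kernel T a b 0 y y) + w * (C * (cmod \<zeta> ^ K * hs_norm y)\<^sup>2))
    \<longlonglongrightarrow> 2 * Re (\<Sum>n. \<zeta> ^ n * segment_kernel T a b n y y) - Re (segment_kernel T a b 0 y y)"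
    by simp
  show "\<exists>N. \<forall>K\<ge>N. 0 \<le> 2 * Re (\<Sum>n<K. \<zeta> ^ n * segment_kernel T a b n y y) - Re (segment_kernel T a b 0 y y) + w * (C * (cmod \<zeta> ^ K * hs_norm y)\<^sup>2)"
  proof (intro exI allI impI)
    fix K
    show "0 \<le> 2 * Re (\<Sum>n<K. \<zeta> ^ n * segment_kernel T a b n y y) - Re (segment_kernel T a b 0 y y) + w * (C * (cmod \<zeta> ^ K * hs_norm y)\<^sup>2)"
      using trunc[of K] by linarith
  qed
qed

text \<open>The expression inside \<open>cmod\<close> is the sesquilinear form whose diagonal is
  nonnegative by \<open>segment_kernel_herglotz\<close>. It is evaluated at c x - d y with |c|^2 =
  \<open>\<mu>\<close> and |d|^2 = 1 / \<open>\<mu>\<close>, the phase of d being matched to G so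
  that the cross terms become - 2 |G|.\<close>

lemma segment_kernel_cauchy_schwarz:
  assumes x: "hilbert_schmidt x" and y: "hilbert_schmidt y" and \<zeta>: "cmod \<zeta> < 1" and \<mu>: "\<mu> > 0"
  defines "H \<equiv> \<lambda>x y. \<Sum>n. \<zeta> ^ n * segment_kernel T a b n x y"
  shows "2 * cmod (H x y + cnj (H y x) - segment_kernel T a b 0 x y) \<le>
     \<mu> * (2 * Re (H x x) - Re (segment_kernel T a b 0 x x)) +
     (2 * Re (H y y) - Re (segment_kernel T a b 0 y y)) / \<mu>"
proof -
  let ?k = "segment_kernel T a b"
  define G where "G = H x y + cnj (H y x) - ?k 0 x y"
  \<comment> \<open>Since \<open>sgn 0 = 0\<close>, the case G = 0 is set apart to keep the modulus
    1.\<close>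
  define \<omega> where "\<omega> = (if G = 0 then 1 else sgn G)"
  have \<omega>: "cnj \<omega> * G = of_real (cmod G)" "cmod \<omega> = 1"
  proof -
    have "cnj (sgn G) * G = of_real (cmod G)" if "G \<noteq> 0"
    proof -
      have "cnj (sgn G) * G = (G * cnj G) / of_real (cmod G)" by (simp add: sgn_eq)
      also have "G * cnj G = of_real (cmod G) * of_real (cmod G)"
        by (simp flip: complex_norm_square power2_eq_square)
      finally show ?thesis using that by simp
    qed
    then show "cnj \<omega> * G = of_real (cmod G)" "cmod \<omega> = 1"
      by (auto simp: \<omega>_def norm_sgn)
  qed
  define \<alpha> where "\<alpha> = sqrt \<mu>"
  have \<alpha>: "\<alpha> > 0" "\<alpha>\<^sup>2 = \<mu>" using \<mu> by (auto simp: \<alpha>_def)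
  define c where "c = complex_of_real \<alpha>"
  define d where "d = \<omega> / complex_of_real \<alpha>"
  define z where "z = scale_op c x - scale_op d y"
  have cx: "hilbert_schmidt (scale_op c x)" and dy: "hilbert_schmidt (scale_op d y)"
    by (intro hilbert_schmidt_scale x y)+
  have z: "hilbert_schmidt z" unfolding z_def by (intro hilbert_schmidt_diff cx dy)
  have kz: "?k n z z = c * cnj c * ?k n x x - c * cnj d * ?k n x y - d * cnj c * ?k n y x + d * cnj d * ?k n y y" for n
  proof -
    have "?k n z z = ?k n (scale_op c x) z - ?k n (scale_op d y) z"
      using segment_kernel_diff_left[OF cx dy z] by (simp add: z_def)
    also have "\<dots> = c * ?k n x z - d * ?k n y z" by (simp only: segment_kernel_scale_left)
    also have "\<dots> = c * (cnj c * ?k n x x - cnj d * ?k n x y) - d * (cnj c * ?k n y x - cnj d * ?k n y y)"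
      unfolding z_def segment_kernel_diff_right[OF x cx dy] segment_kernel_diff_right[OF y cx dy]
        segment_kernel_scale_right ..
    finally show ?thesis by (simp add: algebra_simps)
  qed
  have cc: "c * cnj c = of_real \<mu>" "c * cnj d = cnj \<omega>" "d * cnj c = \<omega>" "d * cnj d = of_real (1 / \<mu>)"
  proof -
    show "c * cnj c = of_real \<mu>" unfolding c_def \<alpha>(2)[symmetric] by (simp add: power2_eq_square)
    show "c * cnj d = cnj \<omega>" "d * cnj c = \<omega>" unfolding c_def d_def using \<alpha>(1) by auto
    have "d * cnj d = (\<omega> * cnj \<omega>) / of_real (\<alpha>\<^sup>2)" by (simp add: d_def power2_eq_square)
    also have "\<omega> * cnj \<omega> = 1" using \<omega>(2) by (simp flip: complex_norm_square)
    finally show "d * cnj d = of_real (1 / \<mu>)" by (simp add: \<alpha>(2))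
  qed
  note sm = segment_kernel_power_summable[OF _ _ \<zeta>]
  have Hz: "H z z = of_real \<mu> * H x x - cnj \<omega> * H x y - \<omega> * H y x + of_real (1 / \<mu>) * H y y"
  proof -
    have "(\<lambda>n. \<zeta> ^ n * ?k n z z) sums (of_real \<mu> * H x x - cnj \<omega> * H x y - \<omega> * H y x + of_real (1 / \<mu>) * H y y)"
    proof -
      have "\<zeta> ^ n * ?k n z z = of_real \<mu> * (\<zeta> ^ n * ?k n x x) - cnj \<omega> * (\<zeta> ^ n * ?k n x y) - \<omega> * (\<zeta> ^ n * ?k n y x) + of_real (1 / \<mu>) * (\<zeta> ^ n * ?k n y y)" for n
        unfolding kz cc by (simp only: ring_distribs mult_ac)
      then show ?thesis
        unfolding H_def
        by (simp only:) (intro sums_add sums_diff sums_mult summable_sums sm x y)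
    qed
    then show ?thesis unfolding H_def by (rule sums_unique[symmetric])
  qed
  have "?k 0 y x = cnj (?k 0 x y)"
    unfolding segment_kernel_0 using hs_inner_commute[of y x] by simp
  then have k: "Re (\<omega> * ?k 0 y x) = Re (cnj \<omega> * ?k 0 x y)" by simp
  have 1: "Re (H z z) = \<mu> * Re (H x x) - Re (cnj \<omega> * H x y) - Re (\<omega> * H y x) + Re (H y y) / \<mu>"
    unfolding Hz by simp
  have 2: "Re (?k 0 z z) = \<mu> * Re (?k 0 x x) - 2 * Re (cnj \<omega> * ?k 0 x y) + Re (?k 0 y y) / \<mu>"
    using k unfolding kz[of 0] cc by simp
  have 3: "Re (cnj \<omega> * G) = Re (cnj \<omega> * H x y) + Re (\<omega> * H y x) - Re (cnj \<omega> * ?k 0 x y)"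
    unfolding G_def by (simp add: algebra_simps)
  have "2 * Re (H z z) - Re (?k 0 z z) = \<mu> * (2 * Re (H x x) - Re (?k 0 x x)) +
      (2 * Re (H y y) - Re (?k 0 y y)) / \<mu> - 2 * Re (cnj \<omega> * G)"
    unfolding 1 2 3 diff_divide_distrib right_diff_distrib
    by (simp only: algebra_simps times_divide_eq_right)
  moreover have "2 * Re (H z z) - Re (?k 0 z z) \<ge> 0"
    unfolding H_def by (rule segment_kernel_herglotz[OF z \<zeta>])
  ultimately show ?thesis unfolding \<omega>(1) G_def[symmetric] by simp
qed

end

section \<open>Fourier coefficients of integrable functions\<close>

lemma AE_summable_norm:
  fixes f :: "nat \<Rightarrow> 'a \<Rightarrow> complex"
  assumes f: "\<And>n. integrable M (f n)" and sum: "summable (\<lambda>n. \<integral>x. cmod (f n x) \<partial>M)"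
  shows "AE x in M. summable (\<lambda>n. cmod (f n x))"
proof -
  note meas = borel_measurable_integrable[OF f]
  have "(\<integral>\<^sup>+x. (\<Sum>n. ennreal (cmod (f n x))) \<partial>M) = (\<Sum>n. \<integral>\<^sup>+x. ennreal (cmod (f n x)) \<partial>M)"
    using meas by (intro nn_integral_suminf) measurable
  also have "\<dots> = (\<Sum>n. ennreal (\<integral>x. cmod (f n x) \<partial>M))"
    by (intro suminf_cong nn_integral_eq_integral integrable_norm f) auto
  also have "\<dots> \<noteq> \<infinity>"
    using sum by (simp add: ennreal_suminf_neq_top)
  finally have "AE x in M. (\<Sum>n. ennreal (cmod (f n x))) \<noteq> \<infinity>"
    using meas by (intro nn_integral_PInf_AE) measurable
  then show ?thesis
    by eventually_elim (auto intro: summable_suminf_not_top)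
qed

text \<open>The weight \<open>\<phi>\<close> is kept general because the series is later paired both
  with characters and with the conjugate of its own sum.\<close>

lemma L1_series:
  fixes f :: "nat \<Rightarrow> 'a \<Rightarrow> complex"
  assumes f: "\<And>n. integrable M (f n)" and sum: "summable (\<lambda>n. \<integral>x. cmod (f n x) \<partial>M)"
  defines "g \<equiv> \<lambda>x. \<Sum>n. f n x"
  shows "integrable M g" "(\<integral>x. cmod (g x) \<partial>M) \<le> (\<Sum>n. \<integral>x. cmod (f n x) \<partial>M)"
    and "\<And>\<phi>. \<phi> \<in> borel_measurable M \<Longrightarrow> (\<And>x. cmod (\<phi> x) \<le> 1) \<Longrightarrow>
      (\<lambda>n. \<integral>x. \<phi> x * f n x \<partial>M) sums (\<integral>x. \<phi> x * g x \<partial>M)"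
proof -
  note AE = AE_summable_norm[OF f sum]
  show g: "integrable M g" unfolding g_def by (rule integrable_suminf[OF f AE sum])
  have n: "integrable M (\<lambda>x. \<Sum>n. cmod (f n x))"
    using integrable_suminf[of M "\<lambda>n x. cmod (f n x)"] f AE sum by auto
  have "(\<integral>x. cmod (g x) \<partial>M) \<le> (\<integral>x. (\<Sum>n. cmod (f n x)) \<partial>M)"
  proof (rule integral_mono_AE)
    show "AE x in M. cmod (g x) \<le> (\<Sum>n. cmod (f n x))"
      using AE unfolding g_def by eventually_elim (rule summable_norm)
  qed (use g n in auto)
  also have "\<dots> = (\<Sum>n. \<integral>x. cmod (f n x) \<partial>M)"
    using integral_suminf[of M "\<lambda>n x. cmod (f n x)"] f AE sum by auto
  finally show "(\<integral>x. cmod (g x) \<partial>M) \<le> (\<Sum>n. \<integral>x. cmod (f n x) \<partial>M)" .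
  fix \<phi> :: "'a \<Rightarrow> complex" assume \<phi>: "\<phi> \<in> borel_measurable M" "\<And>x. cmod (\<phi> x) \<le> 1"
  have le: "cmod (\<phi> x * f n x) \<le> cmod (f n x)" for n x
    using mult_right_mono[OF \<phi>(2)[of x] norm_ge_zero[of "f n x"]] by (simp add: norm_mult)
  have i: "integrable M (\<lambda>x. \<phi> x * f n x)" for n
    using borel_measurable_integrable[OF f] \<phi>(1) le by (intro Bochner_Integration.integrable_bound[OF f]) auto
  have AE': "AE x in M. summable (\<lambda>n. cmod (\<phi> x * f n x))"
    using AE by eventually_elim (rule summable_comparison_test', assumption, use le in auto)
  have sum': "summable (\<lambda>n. \<integral>x. cmod (\<phi> x * f n x) \<partial>M)"
    by (rule summable_comparison_test'[OF sum]) (auto intro!: integral_mono integrable_norm i f le)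
  have "(\<lambda>n. \<integral>x. \<phi> x * f n x \<partial>M) sums (\<integral>x. (\<Sum>n. \<phi> x * f n x) \<partial>M)"
    by (rule sums_integral[OF i AE' sum'])
  also have "(\<integral>x. (\<Sum>n. \<phi> x * f n x) \<partial>M) = (\<integral>x. \<phi> x * g x \<partial>M)"
  proof (rule integral_cong_AE)
    show "AE x in M. (\<Sum>n. \<phi> x * f n x) = \<phi> x * g x"
      using AE unfolding g_def by eventually_elim (simp add: suminf_mult summable_norm_cancel)
  qed (use g f \<phi>(1) in \<open>auto intro!: borel_measurable_times borel_measurable_suminf borel_measurable_integrable\<close>)
  finally show "(\<lambda>n. \<integral>x. \<phi> x * f n x \<partial>M) sums (\<integral>x. \<phi> x * g x \<partial>M)" .
qed

abbreviation circle_measure :: "real measure" where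
  "circle_measure \<equiv> lebesgue_on {0..2 * pi}"

lemma circle_integrable_continuous:
  "continuous_on UNIV f \<Longrightarrow> integrable circle_measure (f :: real \<Rightarrow> 'b::euclidean_space)"
  by (rule continuous_imp_integrable_real) (rule continuous_on_subset, auto)

lemma cis_measurable [measurable]: "(\<lambda>t. cis (c * t)) \<in> borel_measurable circle_measure"
  by (rule borel_measurable_integrable, rule circle_integrable_continuous) (intro continuous_intros)

lemma integral_circle_const: "(\<integral>t. c \<partial>circle_measure) = of_real (2 * pi) * (c :: complex)"
proof -
  have "(\<integral>t. c \<partial>circle_measure) = integral {0..2 * pi} (\<lambda>t. c)"
    by (rule lebesgue_integral_eq_integral) (auto intro: circle_integrable_continuous continuous_intros)
  then show ?thesis by (simp add: scaleR_conv_of_real)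
qed

lemma integral_circle_const_real: "(\<integral>t. c \<partial>circle_measure) = 2 * pi * (c :: real)"
proof -
  have "(\<integral>t. c \<partial>circle_measure) = integral {0..2 * pi} (\<lambda>t. c)"
    by (rule lebesgue_integral_eq_integral) (auto intro: circle_integrable_continuous continuous_intros)
  then show ?thesis by simp
qed

lemma integral_cis:
  "(\<integral>t. cis (of_int k * t) \<partial>circle_measure) = (if k = 0 then of_real (2 * pi) else 0)"
proof (cases "k = 0")
  case True
  then show ?thesis using integral_circle_const[of 1] by simp
next
  case False
  define F where "F = (\<lambda>t. cis (of_int k * t) / (\<i> * of_int k))"
  have "((\<lambda>t. cis (of_int k * t)) has_integral (F (2 * pi) - F 0)) {0..2 * pi}"
  proof (rule fundamental_theorem_of_calculus)
    fix t :: real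
    have "((\<lambda>z. exp (\<i> * of_int k * z) / (\<i> * of_int k)) has_field_derivative exp (\<i> * of_int k * of_real t))
        (at (of_real t))"
      using False by (auto intro!: derivative_eq_intros)
    from has_vector_derivative_real_field[OF this, of "{0..2 * pi}"]
    show "(F has_vector_derivative cis (of_int k * t)) (at t within {0..2 * pi})"
      by (simp add: F_def cis_conv_exp mult.assoc)
  qed simp
  moreover have "cis (of_int k * (2 * pi)) = 1"
    using cis_multiple_2pi[of "of_int k"] by (simp add: mult_ac)
  then have "F (2 * pi) - F 0 = 0" by (simp add: F_def)
  ultimately have "integral {0..2 * pi} (\<lambda>t. cis (of_int k * t)) = 0"
    by (simp add: integral_unique)
  moreover have "(\<integral>t. cis (of_int k * t) \<partial>circle_measure) = integral {0..2 * pi} (\<lambda>t. cis (of_int k * t))"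
    by (rule lebesgue_integral_eq_integral) (auto intro!: circle_integrable_continuous continuous_intros)
  ultimately show ?thesis using False by simp
qed

section \<open>Moment sequences of functions on the circle\<close>

abbreviation circle_norm :: "(real \<Rightarrow> complex) \<Rightarrow> real" where
  "circle_norm g \<equiv> \<integral>t. cmod (g t) \<partial>circle_measure"

text \<open>This is \<open>2 * pi\<close> times the Fourier coefficient of index - n; the sign fits
  the moments against \<open>z ^ n\<close>.\<close>

abbreviation circle_coeff :: "(real \<Rightarrow> complex) \<Rightarrow> nat \<Rightarrow> complex" where
  "circle_coeff g n \<equiv> \<integral>t. cis (real n * t) * g t \<partial>circle_measure"

abbreviation circle_represents :: "real \<Rightarrow> (nat \<Rightarrow> complex) \<Rightarrow> (real \<Rightarrow> complex) \<Rightarrow> bool" where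
  "circle_represents M c g \<equiv> integrable circle_measure g \<and> circle_norm g \<le> M \<and> (\<forall>n. circle_coeff g n = c n)"

text \<open>Abel means: \<open>c\<close> behaves like the nonnegative Fourier coefficients of a measure of mass \<open>\<le> M\<close>.\<close>

definition circle_bounded :: "real \<Rightarrow> (nat \<Rightarrow> complex) \<Rightarrow> bool" where
  "circle_bounded M c \<longleftrightarrow> (\<forall>r. 0 \<le> r \<longrightarrow> r < 1 \<longrightarrow> (\<exists>g. circle_represents M (\<lambda>n. of_real r ^ n * c n) g))"

lemma cis_mult_integrable:
  "integrable circle_measure g \<Longrightarrow> integrable circle_measure (\<lambda>t. cis (c * t) * g t)"
  by (rule Bochner_Integration.integrable_bound[of _ g]) (auto simp: norm_mult)

lemma circle_boundedE:
  assumes "circle_bounded M c" "0 \<le> r" "r < 1"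
  obtains g where "integrable circle_measure g" "circle_norm g \<le> M"
     "\<And>n. circle_coeff g n = of_real r ^ n * c n"
  using assms unfolding circle_bounded_def by blast

lemma circle_bounded_add:
  assumes "circle_bounded M1 c" "circle_bounded M2 d"
  shows "circle_bounded (M1 + M2) (\<lambda>n. c n + d n)"
  unfolding circle_bounded_def
proof (intro allI impI)
  fix r :: real assume r: "0 \<le> r" "r < 1"
  obtain g where g: "integrable circle_measure g" "circle_norm g \<le> M1"
     "\<And>n. circle_coeff g n = of_real r ^ n * c n"
    using circle_boundedE[OF assms(1) r] by blast
  obtain h where h: "integrable circle_measure h" "circle_norm h \<le> M2"
     "\<And>n. circle_coeff h n = of_real r ^ n * d n"
    using circle_boundedE[OF assms(2) r] by blast
  show "\<exists>g. circle_represents (M1 + M2) (\<lambda>n. of_real r ^ n * (c n + d n)) g"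
  proof (intro exI conjI allI)
    show "integrable circle_measure (\<lambda>t. g t + h t)" using g h by simp
    have "(\<integral>t. cmod (g t + h t) \<partial>circle_measure) \<le> (\<integral>t. cmod (g t) + cmod (h t) \<partial>circle_measure)"
      using g h by (intro integral_mono) (auto intro: norm_triangle_ineq)
    also have "\<dots> = circle_norm g + circle_norm h"
      using g h by (intro Bochner_Integration.integral_add) auto
    finally show "(\<integral>t. cmod (g t + h t) \<partial>circle_measure) \<le> M1 + M2" using g(2) h(2) by linarith
    show "(\<integral>t. cis (real n * t) * (g t + h t) \<partial>circle_measure) = of_real r ^ n * (c n + d n)" for n
      using cis_mult_integrable[OF g(1), of "real n"] cis_mult_integrable[OF h(1), of "real n"]
      by (simp add: distrib_left g(3) h(3))
  qed
qed

lemma circle_bounded_uminus: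
  assumes "circle_bounded M c" shows "circle_bounded M (\<lambda>n. - c n)"
  unfolding circle_bounded_def
proof (intro allI impI)
  fix r :: real assume r: "0 \<le> r" "r < 1"
  obtain g where g: "integrable circle_measure g" "circle_norm g \<le> M"
     "\<And>n. circle_coeff g n = of_real r ^ n * c n"
    using circle_boundedE[OF assms r] by blast
  show "\<exists>g. circle_represents M (\<lambda>n. of_real r ^ n * - c n) g"
    by (rule exI[of _ "\<lambda>t. - g t"]) (use g in simp)
qed

lemma circle_bounded_diff:
  "circle_bounded M1 c \<Longrightarrow> circle_bounded M2 d \<Longrightarrow> circle_bounded (M1 + M2) (\<lambda>n. c n - d n)"
  using circle_bounded_add[OF _ circle_bounded_uminus] by fastforce

lemma circle_bounded_mono: "circle_bounded M c \<Longrightarrow> M \<le> M' \<Longrightarrow> circle_bounded M' c"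
  unfolding circle_bounded_def by (meson order_trans)

lemma circle_coefficient_le:
  assumes "integrable circle_measure g"
  shows "cmod (\<integral>t. cis (c * t) * g t \<partial>circle_measure) \<le> circle_norm g"
  using integral_norm_bound[of circle_measure "\<lambda>t. cis (c * t) * g t"] by (simp add: norm_mult)

text \<open>Convergence in the norm of functionals controls each single moment; the bound survives
  the passage from r < 1 to 1.\<close>

lemma circle_bounded_coefficient:
  assumes "circle_bounded M c" shows "cmod (c n) \<le> M"
proof (rule field_le_epsilon)
  have le: "r ^ n * cmod (c n) \<le> M" if r: "0 \<le> r" "r < 1" for r
  proof -
    obtain g where g: "integrable circle_measure g" "circle_norm g \<le> M"
       "\<And>n. circle_coeff g n = of_real r ^ n * c n"
      using circle_boundedE[OF assms r] by blast
    show ?thesis using circle_coefficient_le[OF g(1), of "real n"] g(2) r unfolding g(3) by (simp add: norm_mult norm_power)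
  qed
  have "((\<lambda>r. r ^ n * cmod (c n)) \<longlongrightarrow> 1 ^ n * cmod (c n)) (at_left (1::real))" by (intro tendsto_intros)
  moreover have "\<forall>\<^sub>F r in at_left (1::real). r ^ n * cmod (c n) \<le> M"
    using eventually_at_left_real[of 0 1] by (rule eventually_mono) (use le in auto)
  ultimately have "1 ^ n * cmod (c n) \<le> M"
    by (intro tendsto_upperbound[of _ _ "at_left (1::real)"]) auto
  then show "cmod (c n) \<le> M + e" if "e > 0" for e using that by simp
qed

lemma abel_series:
  fixes a :: "nat \<Rightarrow> complex"
  assumes a: "\<And>n. cmod (a n) \<le> B" and r: "0 \<le> r" "r < 1"
  defines "H \<equiv> \<lambda>t. \<Sum>n. (of_real r * cis (- t)) ^ n * a n"
  shows abel_series_integrable: "integrable circle_measure H"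
    and abel_series_sums: "\<And>\<phi>. \<phi> \<in> borel_measurable circle_measure \<Longrightarrow> (\<And>t. cmod (\<phi> t) \<le> 1) \<Longrightarrow>
      (\<lambda>n. of_real r ^ n * a n * (\<integral>t. \<phi> t * cis (- (real n * t)) \<partial>circle_measure)) sums (\<integral>t. \<phi> t * H t \<partial>circle_measure)"
proof -
  define f where "f = (\<lambda>n t. of_real r ^ n * a n * cis (- (real n * t)))"
  have B: "B \<ge> 0" using a[of 0] norm_ge_zero order_trans by blast
  have H: "H = (\<lambda>t. \<Sum>n. f n t)"
  proof (intro ext)
    fix t
    have "cis (- t) ^ n = cis (- (real n * t))" for n using Complex.DeMoivre[of "- t" n] by simp
    then show "H t = (\<Sum>n. f n t)" unfolding H_def f_def by (simp add: power_mult_distrib mult_ac)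
  qed
  have f: "integrable circle_measure (f n)" for n
    unfolding f_def by (intro circle_integrable_continuous continuous_intros)
  have n: "(\<integral>t. cmod (f n t) \<partial>circle_measure) = 2 * pi * (r ^ n * cmod (a n))" for n
    unfolding f_def norm_mult norm_cis mult_1_right using r by (subst integral_circle_const_real) (simp add: norm_power)
  have s: "summable (\<lambda>n. \<integral>t. cmod (f n t) \<partial>circle_measure)"
    unfolding n
  proof (intro summable_mult summable_comparison_test'[OF summable_mult2[OF summable_geometric, of r B]])
    show "norm (r ^ n * cmod (a n)) \<le> r ^ n * B" for n using a[of n] r by (simp add: norm_mult mult_left_mono)
  qed (use r in auto)
  note L = L1_series[OF f s]
  show "integrable circle_measure H" unfolding H by (rule L(1))
  fix \<phi> :: "real \<Rightarrow> complex" assume \<phi>: "\<phi> \<in> borel_measurable circle_measure" "\<And>t. cmod (\<phi> t) \<le> 1"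
  have "(\<integral>t. \<phi> t * f n t \<partial>circle_measure) = of_real r ^ n * a n * (\<integral>t. \<phi> t * cis (- (real n * t)) \<partial>circle_measure)" for n
  proof -
    have "(\<lambda>t. \<phi> t * f n t) = (\<lambda>t. (of_real r ^ n * a n) * (\<phi> t * cis (- (real n * t))))"
      unfolding f_def by (simp add: mult_ac)
    then show ?thesis by (simp only: integral_mult_right_zero)
  qed
  then show "(\<lambda>n. of_real r ^ n * a n * (\<integral>t. \<phi> t * cis (- (real n * t)) \<partial>circle_measure)) sums (\<integral>t. \<phi> t * H t \<partial>circle_measure)"
    using L(3)[OF \<phi>] unfolding H by simp
qed

text \<open>Powers of \<open>cis (- t)\<close> are the ones that pair with
  \<open>cis (n * t)\<close> for n \<open>\<ge>\<close> 0, and characters of negative index see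
  nothing of the series.\<close>

lemma abel_series_coefficient:
  fixes a :: "nat \<Rightarrow> complex"
  assumes a: "\<And>n. cmod (a n) \<le> B" and r: "0 \<le> r" "r < 1"
  shows "(\<integral>t. cis (of_int k * t) * (\<Sum>n. (of_real r * cis (- t)) ^ n * a n) \<partial>circle_measure) =
    (if k \<ge> 0 then of_real (2 * pi) * of_real r ^ nat k * a (nat k) else 0)"
proof -
  have i: "(\<integral>t. cis (of_int k * t) * cis (- (real n * t)) \<partial>circle_measure) = (if k = int n then of_real (2 * pi) else 0)" for n
  proof -
    have "cis (of_int k * t) * cis (- (real n * t)) = cis (of_int (k - int n) * t)" for t
      by (simp add: cis_mult left_diff_distrib)
    then show ?thesis by (simp only: integral_cis) auto
  qed
  have "(\<lambda>n. of_real r ^ n * a n * (if k = int n then of_real (2 * pi) else 0)) sums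
      (\<integral>t. cis (of_int k * t) * (\<Sum>n. (of_real r * cis (- t)) ^ n * a n) \<partial>circle_measure)"
    using abel_series_sums[OF a r, of "\<lambda>t. cis (of_int k * t)"] unfolding i by simp
  moreover have "(\<lambda>n. of_real r ^ n * a n * (if k = int n then of_real (2 * pi) else 0)) sums
      (if k \<ge> 0 then of_real (2 * pi) * of_real r ^ nat k * a (nat k) else 0)"
  proof (cases "k \<ge> 0")
    case True
    have "(\<lambda>n. of_real r ^ n * a n * (if k = int n then of_real (2 * pi) else 0)) =
        (\<lambda>n. if n = nat k then of_real r ^ n * a n * of_real (2 * pi) else 0)"
      using True by (auto simp: fun_eq_iff)
    then show ?thesis using True sums_single[of "nat k" "\<lambda>n. of_real r ^ n * a n * of_real (2 * pi)"] by (simp add: mult_ac)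
  next
    case False
    then have "(\<lambda>n. of_real r ^ n * a n * (if k = int n then of_real (2 * pi) else 0)) = (\<lambda>n. 0)" by (auto simp: fun_eq_iff)
    then show ?thesis using False by simp
  qed
  ultimately show ?thesis by (rule sums_unique2)
qed

text \<open>The density is the Abel mean of \<open>xy\<close> completed to a kernel that the
  hypothesis controls pointwise. The added terms leave the moments intact:
  \<open>cnj (K yx t)\<close> has frequencies \<open>\<ge>\<close> 0 and pairs only with n = 0,
  where it cancels \<open>xy 0\<close>. The integrals of the dominating kernels are read off from
  \<open>xx 0\<close> and \<open>yy 0\<close>.\<close>

lemma circle_bounded_herglotz:
  fixes xx xy yx yy :: "nat \<Rightarrow> complex" and \<mu> :: real
  defines "H \<equiv> \<lambda>a \<zeta>. \<Sum>n. \<zeta> ^ n * a n"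
  assumes b: "\<And>n. cmod (xx n) \<le> B" "\<And>n. cmod (xy n) \<le> B" "\<And>n. cmod (yx n) \<le> B" "\<And>n. cmod (yy n) \<le> B"
    and 0: "yx 0 = cnj (xy 0)"
    and cs: "\<And>\<zeta>. cmod \<zeta> < 1 \<Longrightarrow> 2 * cmod (H xy \<zeta> + cnj (H yx \<zeta>) - xy 0) \<le>
       \<mu> * (2 * Re (H xx \<zeta>) - Re (xx 0)) + (2 * Re (H yy \<zeta>) - Re (yy 0)) / \<mu>"
  shows "circle_bounded ((\<mu> * Re (xx 0) + Re (yy 0) / \<mu>) / 2) xy"
  unfolding circle_bounded_def
proof (intro allI impI)
  fix r :: real assume r: "0 \<le> r" "r < 1"
  define K where "K = (\<lambda>a t. \<Sum>n. (of_real r * cis (- t)) ^ n * a n)"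
  have K: "K a t = H a (of_real r * cis (- t))" for a t by (simp add: K_def H_def)
  define G where "G = (\<lambda>t. K xy t + cnj (K yx t) - xy 0)"
  define g where "g = (\<lambda>t. G t / of_real (2 * pi))"
  have iK: "integrable circle_measure (K xx)" "integrable circle_measure (K xy)" "integrable circle_measure (K yx)" "integrable circle_measure (K yy)"
    unfolding K_def by (rule abel_series_integrable[OF b(1) r] abel_series_integrable[OF b(2) r]
      abel_series_integrable[OF b(3) r] abel_series_integrable[OF b(4) r])+
  have c: "integrable circle_measure (\<lambda>t. c)" for c :: complex by (intro circle_integrable_continuous continuous_intros)
  have cr: "integrable circle_measure (\<lambda>t. c)" for c :: real by (intro circle_integrable_continuous continuous_intros)
  have iG: "integrable circle_measure G" unfolding G_def using iK c by auto
  then have ig: "integrable circle_measure g" unfolding g_def by auto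
  have K0: "(\<integral>t. K xx t \<partial>circle_measure) = of_real (2 * pi) * xx 0" "(\<integral>t. K yy t \<partial>circle_measure) = of_real (2 * pi) * yy 0"
    using abel_series_coefficient[OF b(1) r, of 0] abel_series_coefficient[OF b(4) r, of 0] by (simp_all add: K_def)
  have P: "integrable circle_measure (\<lambda>t. 2 * Re (K xx t) - Re (xx 0))" "integrable circle_measure (\<lambda>t. 2 * Re (K yy t) - Re (yy 0))"
    using iK cr by (auto intro!: Bochner_Integration.integrable_diff integrable_mult_right integrable_Re)
  have P0: "(\<integral>t. 2 * Re (K xx t) - Re (xx 0) \<partial>circle_measure) = 2 * pi * Re (xx 0)"
    "(\<integral>t. 2 * Re (K yy t) - Re (yy 0) \<partial>circle_measure) = 2 * pi * Re (yy 0)"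
  proof -
    have *: "(\<integral>t. 2 * Re (f t) - d \<partial>circle_measure) = 2 * Re (\<integral>t. f t \<partial>circle_measure) - 2 * pi * d"
      if "integrable circle_measure f" for f :: "real \<Rightarrow> complex" and d :: real
    proof -
      have "(\<integral>t. 2 * Re (f t) - d \<partial>circle_measure) = (\<integral>t. 2 * Re (f t) \<partial>circle_measure) - (\<integral>t. d \<partial>circle_measure)"
        by (intro Bochner_Integration.integral_diff cr integrable_mult_right integrable_Re that)
      then show ?thesis unfolding integral_circle_const_real using that by simp
    qed
    show "(\<integral>t. 2 * Re (K xx t) - Re (xx 0) \<partial>circle_measure) = 2 * pi * Re (xx 0)"
      "(\<integral>t. 2 * Re (K yy t) - Re (yy 0) \<partial>circle_measure) = 2 * pi * Re (yy 0)"
      unfolding *[OF iK(1)] *[OF iK(4)] K0 by simp_all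
  qed
  have "2 * circle_norm G = (\<integral>t. 2 * cmod (G t) \<partial>circle_measure)" by simp
  also have "\<dots> \<le> (\<integral>t. \<mu> * (2 * Re (K xx t) - Re (xx 0)) + (2 * Re (K yy t) - Re (yy 0)) / \<mu> \<partial>circle_measure)"
  proof (rule integral_mono)
    show "2 * cmod (G t) \<le> \<mu> * (2 * Re (K xx t) - Re (xx 0)) + (2 * Re (K yy t) - Re (yy 0)) / \<mu>" for t
      unfolding G_def K by (rule cs) (use r in \<open>simp add: norm_mult\<close>)
  qed (use iG P in auto)
  also have "\<dots> = \<mu> * (2 * pi * Re (xx 0)) + (2 * pi * Re (yy 0)) / \<mu>"
    using P by (subst Bochner_Integration.integral_add) (auto simp only: integral_mult_right_zero integral_divide_zero P0 intro!: integrable_mult_right integrable_divide)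
  finally have nG: "2 * circle_norm G \<le> \<mu> * (2 * pi * Re (xx 0)) + (2 * pi * Re (yy 0)) / \<mu>" .
  show "\<exists>g. circle_represents ((\<mu> * Re (xx 0) + Re (yy 0) / \<mu>) / 2) (\<lambda>n. of_real r ^ n * xy n) g"
  proof (intro exI conjI allI)
    show "integrable circle_measure g" by (rule ig)
    have "circle_norm g = circle_norm G / (2 * pi)"
      by (simp add: g_def norm_divide)
    also have "\<dots> \<le> (\<mu> * Re (xx 0) + Re (yy 0) / \<mu>) / 2"
    proof -
      have "\<mu> * (2 * pi * Re (xx 0)) + (2 * pi * Re (yy 0)) / \<mu> = 2 * (pi * (\<mu> * Re (xx 0) + Re (yy 0) / \<mu>))"
        by (simp add: algebra_simps)
      then have "circle_norm G \<le> pi * (\<mu> * Re (xx 0) + Re (yy 0) / \<mu>)" using nG by linarith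
      from divide_right_mono[OF this, of "2 * pi"] show ?thesis by simp
    qed
    finally show "circle_norm g \<le> (\<mu> * Re (xx 0) + Re (yy 0) / \<mu>) / 2" .
    fix n
    have 1: "(\<integral>t. cis (real n * t) * K xy t \<partial>circle_measure) = of_real (2 * pi) * of_real r ^ n * xy n"
      using abel_series_coefficient[OF b(2) r, of "int n"] by (simp add: K_def)
    have "(\<integral>t. cis (real n * t) * cnj (K yx t) \<partial>circle_measure) = cnj (\<integral>t. cis (of_int (- int n) * t) * K yx t \<partial>circle_measure)"
      by (subst Bochner_Integration.integral_cnj[symmetric]) (simp add: cis_cnj)
    also have "\<dots> = (if n = 0 then of_real (2 * pi) * xy 0 else 0)"
      unfolding K_def abel_series_coefficient[OF b(3) r] using 0 by auto
    finally have 2: "(\<integral>t. cis (real n * t) * cnj (K yx t) \<partial>circle_measure) = (if n = 0 then of_real (2 * pi) * xy 0 else 0)" .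
    have 3: "(\<integral>t. cis (real n * t) * xy 0 \<partial>circle_measure) = (if n = 0 then of_real (2 * pi) * xy 0 else 0)"
      using integral_cis[of "int n"] by simp
    have "circle_coeff G n =
        (\<integral>t. cis (real n * t) * K xy t + cis (real n * t) * cnj (K yx t) - cis (real n * t) * xy 0 \<partial>circle_measure)"
      by (simp add: G_def algebra_simps)
    also have "\<dots> = of_real (2 * pi) * of_real r ^ n * xy n"
      using cis_mult_integrable[OF iK(2), of "real n"] cis_mult_integrable[of "\<lambda>t. cnj (K yx t)" "real n"]
        cis_mult_integrable[OF c, of "real n" "xy 0"] iK(3) 1 2 3 by simp
    finally show "circle_coeff g n = of_real r ^ n * xy n"
      by (simp add: g_def)
  qed
qed

text \<open>Square summable moments belong to a square integrable function, and for arc length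
  normalised to mass 1 the L^1 norm is at most the L^2 norm.\<close>

lemma circle_bounded_square_summable:
  assumes s: "summable (\<lambda>n. (cmod (h n))\<^sup>2)" and d: "(\<Sum>n. (cmod (h n))\<^sup>2) \<le> d\<^sup>2" and "d > 0"
  shows "circle_bounded d h"
  unfolding circle_bounded_def
proof (intro allI impI)
  fix r :: real assume r: "0 \<le> r" "r < 1"
  have B: "cmod (h n) \<le> d" for n
  proof -
    have "(cmod (h n))\<^sup>2 \<le> (\<Sum>n. (cmod (h n))\<^sup>2)" using sum_le_suminf[OF s, of "{n}"] by simp
    then have "(cmod (h n))\<^sup>2 \<le> d\<^sup>2" using d by linarith
    then show ?thesis by (rule power2_le_imp_le) (use \<open>d > 0\<close> in simp)
  qed
  define H where "H = (\<lambda>t. \<Sum>n. (of_real r * cis (- t)) ^ n * h n)"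
  have iH: "integrable circle_measure H" unfolding H_def by (rule abel_series_integrable[OF B r])
  have coef: "circle_coeff H n = of_real (2 * pi) * of_real r ^ n * h n" for n
    using abel_series_coefficient[OF B r, of "int n"] by (simp add: H_def)
  \<comment> \<open>A crude pointwise bound on H, so that the conjugate of H divided by C is an
    admissible weight in \<open>abel_series_sums\<close>; pairing it with H gives Parseval's
    identity up to the factor C.\<close>
  define C where "C = d / (1 - r) + 1"
  have C: "C > 0" using \<open>d > 0\<close> r by (simp add: C_def add_pos_nonneg add_nonneg_pos)
  have HC: "cmod (H t) \<le> C" for t
  proof -
    have g: "(\<lambda>n. r ^ n * d) sums (1 / (1 - r) * d)" using r by (intro sums_mult2 geometric_sums) auto
    have "cmod (H t) \<le> (\<Sum>n. r ^ n * d)"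
      unfolding H_def
    proof (rule norm_suminf_le)
      show "cmod ((of_real r * cis (- t)) ^ n * h n) \<le> r ^ n * d" for n
        using B[of n] r by (simp add: norm_mult norm_power mult_left_mono)
    qed (rule sums_summable[OF g])
    then show ?thesis using sums_unique[OF g] by (simp add: C_def)
  qed
  have mH: "H \<in> borel_measurable circle_measure" using iH by (rule borel_measurable_integrable)
  define \<phi> where "\<phi> = (\<lambda>t. cnj (H t) / of_real C)"
  have \<phi>: "\<phi> \<in> borel_measurable circle_measure" "\<And>t. cmod (\<phi> t) \<le> 1"
  proof -
    have "cnj \<in> borel_measurable borel" by (intro borel_measurable_continuous_onI continuous_intros)
    from measurable_compose[OF mH this] show "\<phi> \<in> borel_measurable circle_measure"
      unfolding \<phi>_def by (intro borel_measurable_divide borel_measurable_const)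
    show "cmod (\<phi> t) \<le> 1" for t using HC[of t] C by (simp add: \<phi>_def norm_divide)
  qed
  have i1: "(\<integral>t. \<phi> t * cis (- (real n * t)) \<partial>circle_measure) = of_real (2 * pi) * of_real r ^ n * cnj (h n) / of_real C" for n
  proof -
    have "(\<integral>t. \<phi> t * cis (- (real n * t)) \<partial>circle_measure) = cnj (circle_coeff H n) / of_real C"
      unfolding \<phi>_def by (subst Bochner_Integration.integral_cnj[symmetric]) (simp add: cis_cnj mult_ac)
    then show ?thesis by (simp add: coef)
  qed
  have s1: "(\<lambda>n. of_real r ^ n * h n * (of_real (2 * pi) * of_real r ^ n * cnj (h n) / of_real C)) sums (\<integral>t. \<phi> t * H t \<partial>circle_measure)"
    using abel_series_sums[of h d r, OF B r \<phi>] unfolding i1 by (simp only: H_def)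
  have \<phi>H: "(\<integral>t. \<phi> t * H t \<partial>circle_measure) = of_real (\<integral>t. (cmod (H t))\<^sup>2 \<partial>circle_measure) / of_real C"
  proof -
    have "\<phi> t * H t = of_real ((cmod (H t))\<^sup>2) / of_real C" for t
      by (simp add: \<phi>_def mult.commute flip: complex_norm_square)
    then show ?thesis by (simp only: integral_divide_zero integral_complex_of_real)
  qed
  have scaled: "of_real C * (of_real r ^ n * h n * (of_real (2 * pi) * of_real r ^ n * cnj (h n) / of_real C)) =
      complex_of_real (2 * pi * ((r\<^sup>2) ^ n * (cmod (h n))\<^sup>2))" for n
    unfolding of_real_mult[of "2 * pi"] of_real_mult[of "(r\<^sup>2) ^ n"] complex_norm_square
    using C by (simp add: power2_eq_square power_mult_distrib mult_ac)
  have "of_real C * (\<integral>t. \<phi> t * H t \<partial>circle_measure) = complex_of_real (\<integral>t. (cmod (H t))\<^sup>2 \<partial>circle_measure)"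
    unfolding \<phi>H using C by simp
  with sums_mult[OF s1, of "of_real C"]
  have "(\<lambda>n. of_real (2 * pi * ((r\<^sup>2) ^ n * (cmod (h n))\<^sup>2))) sums complex_of_real (\<integral>t. (cmod (H t))\<^sup>2 \<partial>circle_measure)"
    unfolding scaled by metis
  then have s2: "(\<lambda>n. 2 * pi * ((r\<^sup>2) ^ n * (cmod (h n))\<^sup>2)) sums (\<integral>t. (cmod (H t))\<^sup>2 \<partial>circle_measure)"
    by (simp only: sums_of_real_iff)
  have H2: "(\<integral>t. (cmod (H t))\<^sup>2 \<partial>circle_measure) \<le> 2 * pi * d\<^sup>2"
  proof -
    have "(r\<^sup>2) ^ n * (cmod (h n))\<^sup>2 \<le> 1 * (cmod (h n))\<^sup>2" for n
      using r by (intro mult_right_mono power_le_one) (auto simp: abs_square_le_1)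
    then have "(\<integral>t. (cmod (H t))\<^sup>2 \<partial>circle_measure) \<le> (\<Sum>n. 2 * pi * (cmod (h n))\<^sup>2)"
      using s2 s by (intro sums_le[OF _ s2 summable_sums]) (auto intro: summable_mult)
    also have "\<dots> = 2 * pi * (\<Sum>n. (cmod (h n))\<^sup>2)" by (rule suminf_mult[OF s])
    also have "\<dots> \<le> 2 * pi * d\<^sup>2" using d by (intro mult_left_mono) auto
    finally show ?thesis .
  qed
  have iH2: "integrable circle_measure (\<lambda>t. (cmod (H t))\<^sup>2)"
  proof (rule Bochner_Integration.integrable_bound[of _ "\<lambda>t. C * cmod (H t)"])
    show "integrable circle_measure (\<lambda>t. C * cmod (H t))" using iH by auto
    show "AE t in circle_measure. norm ((cmod (H t))\<^sup>2) \<le> norm (C * cmod (H t))"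
      using HC C by (intro AE_I2) (auto simp: power2_eq_square abs_mult intro!: mult_right_mono)
  qed (use mH in measurable)
  define g where "g = (\<lambda>t. H t / of_real (2 * pi))"
  show "\<exists>g. circle_represents d (\<lambda>n. of_real r ^ n * h n) g"
  proof (intro exI conjI allI)
    show "integrable circle_measure g" using iH by (simp add: g_def)
    show "circle_coeff g n = of_real r ^ n * h n" for n
      using coef[of n] by (simp add: g_def)
    \<comment> \<open>Stands in for the Cauchy-Schwarz inequality of integrals: the right-hand side
      integrates to at most \<open>2 * pi * d\<close>.\<close>
    have "cmod (H t) \<le> (d + (cmod (H t))\<^sup>2 / d) / 2" for t
    proof -
      have "0 \<le> (cmod (H t) - d)\<^sup>2" by simp
      then show ?thesis using \<open>d > 0\<close> by (simp add: field_simps power2_eq_square)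
    qed
    then have "circle_norm H \<le> (\<integral>t. (d + (cmod (H t))\<^sup>2 / d) / 2 \<partial>circle_measure)"
      using iH iH2 by (intro integral_mono) (auto intro!: circle_integrable_continuous continuous_intros)
    also have "\<dots> = (2 * pi * d + (\<integral>t. (cmod (H t))\<^sup>2 \<partial>circle_measure) / d) / 2"
    proof -
      have "(\<integral>t. d + (cmod (H t))\<^sup>2 / d \<partial>circle_measure) =
          (\<integral>t. d \<partial>circle_measure) + (\<integral>t. (cmod (H t))\<^sup>2 / d \<partial>circle_measure)"
      proof (rule Bochner_Integration.integral_add)
        show "integrable circle_measure (\<lambda>t. d)" by (intro circle_integrable_continuous continuous_intros)
        show "integrable circle_measure (\<lambda>t. (cmod (H t))\<^sup>2 / d)" using iH2 by simp
      qed
      then show ?thesis unfolding integral_circle_const_real by simp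
    qed
    also have "\<dots> \<le> (2 * pi * d + 2 * pi * d\<^sup>2 / d) / 2"
      using H2 \<open>d > 0\<close> by (simp add: divide_right_mono)
    also have "\<dots> = 2 * pi * d" using \<open>d > 0\<close> by (simp add: power2_eq_square)
    finally show "circle_norm g \<le> d" by (simp add: g_def norm_divide field_simps)
  qed
qed

text \<open>An Abel mean has the right norm but moments \<open>r ^ n * h n\<close>. Only finitely
  many defects \<open>(1 - r ^ n) * h n\<close> occur, and for r close to 1 a trigonometric
  polynomial of norm at most \<open>\<epsilon>\<close> supplies them.\<close>

lemma circle_bounded_finite_support:
  assumes c: "circle_bounded M h" and fin: "\<And>n. n \<ge> K \<Longrightarrow> h n = 0" and \<epsilon>: "\<epsilon> > 0"
  shows "\<exists>g. circle_represents (M + \<epsilon>) h g"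
proof -
  have "((\<lambda>r. \<Sum>n<K. (1 - r ^ n) * cmod (h n)) \<longlongrightarrow> (\<Sum>n<K. (1 - 1 ^ n) * cmod (h n))) (at_left (1::real))"
    by (intro tendsto_intros)
  then have "\<forall>\<^sub>F r in at_left (1::real). (\<Sum>n<K. (1 - r ^ n) * cmod (h n)) < \<epsilon>"
    by (rule order_tendstoD) (use \<epsilon> in simp)
  moreover have "\<forall>\<^sub>F r in at_left (1::real). r \<in> {0<..<1}" by (rule eventually_at_left_real) simp
  ultimately have "\<exists>r. (\<Sum>n<K. (1 - r ^ n) * cmod (h n)) < \<epsilon> \<and> r \<in> {0<..<1::real}"
    by (intro eventually_happens'[of "at_left (1::real)"] eventually_conj) auto
  then obtain r where "(\<Sum>n<K. (1 - r ^ n) * cmod (h n)) < \<epsilon>" "r \<in> {0<..<1::real}" by blast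
  then have r: "0 \<le> r" "r < 1" "(\<Sum>n<K. (1 - r ^ n) * cmod (h n)) < \<epsilon>" by auto
  obtain g where g: "integrable circle_measure g" "circle_norm g \<le> M"
     "\<And>n. circle_coeff g n = of_real r ^ n * h n"
    using circle_boundedE[OF c r(1,2)] by blast
  define p where "p = (\<lambda>t. \<Sum>n<K. of_real ((1 - r ^ n) / (2 * pi)) * h n * cis (- (real n * t)))"
  have ip: "integrable circle_measure p" unfolding p_def by (intro circle_integrable_continuous continuous_intros)
  have "cmod (p t) \<le> \<epsilon> / (2 * pi)" for t
  proof -
    have "cmod (p t) \<le> (\<Sum>n<K. cmod (of_real ((1 - r ^ n) / (2 * pi)) * h n * cis (- (real n * t))))"
      unfolding p_def by (rule norm_sum)
    also have "\<dots> = (\<Sum>n<K. (1 - r ^ n) * cmod (h n)) / (2 * pi)"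
      using r by (simp add: norm_mult norm_divide sum_divide_distrib power_le_one del: of_real_diff of_real_power)
    also have "\<dots> \<le> \<epsilon> / (2 * pi)" using r(3) by (intro divide_right_mono) auto
    finally show ?thesis .
  qed
  then have "circle_norm p \<le> (\<integral>t. \<epsilon> / (2 * pi) \<partial>circle_measure)"
    using ip by (intro integral_mono) (auto intro!: circle_integrable_continuous continuous_intros)
  then have np: "circle_norm p \<le> \<epsilon>" unfolding integral_circle_const_real by simp
  have cp: "circle_coeff p n = (1 - of_real r ^ n) * h n" for n
  proof -
    have *: "cis (real n * t) * (x * cis (- (real m * t))) = x * cis (of_int (int n - int m) * t)" for x m t
      by (simp add: mult.left_commute[of "cis (real n * t)"] cis_mult left_diff_distrib)
    have "circle_coeff p n =
       (\<integral>t. (\<Sum>m<K. of_real ((1 - r ^ m) / (2 * pi)) * h m * cis (of_int (int n - int m) * t)) \<partial>circle_measure)"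
      unfolding p_def sum_distrib_left by (simp only: *)
    also have "\<dots> = (\<Sum>m<K. of_real ((1 - r ^ m) / (2 * pi)) * h m * (\<integral>t. cis (of_int (int n - int m) * t) \<partial>circle_measure))"
      by (subst Bochner_Integration.integral_sum)
         (auto intro!: circle_integrable_continuous continuous_intros)
    also have "\<dots> = (\<Sum>m<K. if m = n then (1 - of_real r ^ m) * h m else 0)"
      unfolding integral_cis by (intro sum.cong) auto
    also have "\<dots> = (1 - of_real r ^ n) * h n" using fin[of n] by auto
    finally show ?thesis .
  qed
  show ?thesis
  proof (intro exI conjI allI)
    show "integrable circle_measure (\<lambda>t. g t + p t)" using g ip by simp
    have "(\<integral>t. cmod (g t + p t) \<partial>circle_measure) \<le> (\<integral>t. cmod (g t) + cmod (p t) \<partial>circle_measure)"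
      using g ip by (intro integral_mono) (auto intro: norm_triangle_ineq)
    also have "\<dots> = circle_norm g + circle_norm p"
      using g ip by (intro Bochner_Integration.integral_add) auto
    finally show "(\<integral>t. cmod (g t + p t) \<partial>circle_measure) \<le> M + \<epsilon>" using g(2) np by linarith
    show "(\<integral>t. cis (real n * t) * (g t + p t) \<partial>circle_measure) = h n" for n
      using cis_mult_integrable[OF g(1), of "real n"] cis_mult_integrable[OF ip, of "real n"]
      by (simp add: distrib_left g(3) cp) (simp add: algebra_simps)
  qed
qed

text \<open>The bound passes from measures to integrable functions because the sequence is a limit, in the
  norm of the functionals it defines, of trigonometric polynomials; the representing functions of
  the successive differences have summable norms.\<close>

lemma circle_bounded_representable:
  assumes c: "circle_bounded M c"
    and approx: "\<And>\<epsilon>. \<epsilon> > 0 \<Longrightarrow> \<exists>h K. (\<forall>n\<ge>K. h n = 0) \<and> circle_bounded \<epsilon> (\<lambda>n. c n - h n)"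
    and \<epsilon>: "\<epsilon> > 0"
  shows "\<exists>g. circle_represents (M + \<epsilon>) c g"
proof -
  \<comment> \<open>For k > 0 the k-th difference costs e_k + e_(k-1) from the approximation and e_k
    from \<open>circle_bounded_finite_support\<close>, that is 4 e_k in all; with the factor 1/8 the
    whole series stays within M + \<open>\<epsilon>\<close>.\<close>
  define e where "e = (\<lambda>k::nat. \<epsilon> / 8 * (1 / 2) ^ k)"
  have e: "e k > 0" for k using \<epsilon> by (simp add: e_def)
  have "\<exists>h K. (\<forall>n\<ge>K. h n = 0) \<and> circle_bounded (e k) (\<lambda>n. c n - h n)" for k
    by (rule approx[OF e])
  then obtain h K where h: "\<And>k n. n \<ge> K k \<Longrightarrow> h k n = 0" "\<And>k. circle_bounded (e k) (\<lambda>n. c n - h k n)"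
    by metis
  \<comment> \<open>The case k = 0 is separate: as \<open>0 - 1 = 0\<close>, the general formula
    would give 0 and lose the first term.\<close>
  define D where "D = (\<lambda>k n. if k = 0 then h 0 n else h k n - h (k - 1) n)"
  define m where "m = (\<lambda>k. if k = 0 then M + e 0 else e k + e (k - 1))"
  have D: "circle_bounded (m k) (D k)" for k
  proof (cases k)
    case 0
    then show ?thesis using circle_bounded_diff[OF c h(2)[of 0]] by (simp add: D_def m_def)
  next
    case (Suc j)
    then show ?thesis
      using circle_bounded_diff[OF h(2)[of j] h(2)[of "Suc j"]] by (simp add: D_def m_def add.commute)
  qed
  have "\<exists>g. circle_represents (m k + e k) (D k) g" for k
    by (rule circle_bounded_finite_support[OF D, of "max (K k) (K (k - 1))"]) (use h(1) e in \<open>auto simp: D_def\<close>)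
  then have "\<forall>k. \<exists>g. circle_represents (m k + e k) (D k) g" ..
  then obtain g where "\<forall>k. circle_represents (m k + e k) (D k) (g k)"
    by (rule choice[THEN exE])
  then have g: "\<And>k. integrable circle_measure (g k)" "\<And>k. circle_norm (g k) \<le> m k + e k"
     "\<And>k n. circle_coeff (g k) n = D k n"
    by blast+
  have gb: "circle_norm (g k) \<le> (if k = 0 then M else 0) + \<epsilon> / 2 * (1/2) ^ k" for k
    using g(2)[of k] \<epsilon> by (cases k) (auto simp: m_def e_def)
  have bs: "(\<lambda>k. (if k = 0 then M else 0) + \<epsilon> / 2 * (1/2) ^ k) sums (M + \<epsilon> / 2 * 2)"
    using sums_single[of 0 "\<lambda>k. M"] geometric_sums[of "1/2::real"] by (intro sums_add sums_mult) auto
  have s: "summable (\<lambda>k. \<integral>t. cmod (g k t) \<partial>circle_measure)"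
    by (rule summable_comparison_test'[OF sums_summable[OF bs], of 0]) (use gb in auto)
  note L = L1_series[OF g(1) s]
  show ?thesis
  proof (intro exI conjI allI)
    show "integrable circle_measure (\<lambda>t. \<Sum>k. g k t)" by (rule L(1))
    have "(\<integral>t. cmod (\<Sum>k. g k t) \<partial>circle_measure) \<le> (\<Sum>k. \<integral>t. cmod (g k t) \<partial>circle_measure)" by (rule L(2))
    also have "\<dots> \<le> M + \<epsilon> / 2 * 2"
      by (rule sums_le[OF gb summable_sums[OF s] bs])
    finally show "(\<integral>t. cmod (\<Sum>k. g k t) \<partial>circle_measure) \<le> M + \<epsilon>" by simp
    fix n
    have "(\<lambda>k. D k n) sums (\<integral>t. cis (real n * t) * (\<Sum>k. g k t) \<partial>circle_measure)"
      using L(3)[of "\<lambda>t. cis (real n * t)"] by (simp add: g(3))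
    moreover have "(\<lambda>k. D k n) sums c n"
    proof -
      have "(\<Sum>k<Suc j. D k n) = h j n" for j
        by (induction j) (auto simp: D_def)
      moreover have "(\<lambda>j. h j n) \<longlonglongrightarrow> c n"
      proof (rule LIMSEQ_I)
        fix d :: real assume "d > 0"
        have "e \<longlonglongrightarrow> \<epsilon> / 8 * 0" unfolding e_def by (intro tendsto_intros) auto
        then obtain N where N: "\<And>j. j \<ge> N \<Longrightarrow> e j < d"
          using \<open>d > 0\<close> order_tendstoD(2)[of e "\<epsilon> / 8 * 0" sequentially d] unfolding eventually_sequentially by auto
        show "\<exists>N. \<forall>j\<ge>N. norm (h j n - c n) < d"
        proof (intro exI allI impI)
          fix j assume "j \<ge> N"
          then show "norm (h j n - c n) < d"
            using circle_bounded_coefficient[OF h(2)[of j], of n] N[of j] by (simp add: norm_minus_commute)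
        qed
      qed
      ultimately have "(\<lambda>j. \<Sum>k<Suc j. D k n) \<longlonglongrightarrow> c n" by (simp only:)
      then show ?thesis unfolding sums_def by (rule LIMSEQ_imp_Suc)
    qed
    ultimately show "(\<integral>t. cis (real n * t) * (\<Sum>k. g k t) \<partial>circle_measure) = c n" by (rule sums_unique2)
  qed
qed

section \<open>Absolute continuity\<close>

context
  fixes V :: "'a::complex_hilbert_space \<Rightarrow>\<^sub>L 'a"
  assumes V: "hilbert_schmidt V" and V2: "norm V \<le> 2"
begin

private abbreviation "W \<equiv> adjoint_op V"

text \<open>As \<open>norm V \<le> 2\<close>, the factor 1/4 makes P, Z and \<open>Z'\<close>
  positive contractions.\<close>

private definition "P \<equiv> (1/4) *\<^sub>R (W o\<^sub>L V)"
private definition "Z \<equiv> id_blinfun - P"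
private definition "Z' \<equiv> id_blinfun - (1/4) *\<^sub>R (V o\<^sub>L W)"

private lemma clV: "complex_linear V" and clW: "complex_linear W"
  using hilbert_schmidt_complex_linear[OF V] complex_linear_adjoint by auto

private lemma norm_compose_quarter:
  "norm ((1/4) *\<^sub>R (W o\<^sub>L V)) \<le> 1" "norm ((1/4) *\<^sub>R (V o\<^sub>L W)) \<le> 1"
proof -
  have W2: "norm W \<le> 2" using norm_adjoint_le[OF clV] V2 by linarith
  have "norm W * norm V \<le> 2 * 2" using V2 W2 by (intro mult_mono) auto
  then have "norm (W o\<^sub>L V) \<le> 4" "norm (V o\<^sub>L W) \<le> 4"
    using norm_blinfun_compose[of W V] norm_blinfun_compose[of V W] by (simp_all add: mult.commute)
  then show "norm ((1/4) *\<^sub>R (W o\<^sub>L V)) \<le> 1" "norm ((1/4) *\<^sub>R (V o\<^sub>L W)) \<le> 1" by auto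
qed

private lemma positive_P: "positive_op P"
  unfolding P_def by (intro positive_op_scaleR positive_op_adjoint_compose clV) simp

private lemma Z: "positive_op Z" "Re (cinner (Z x) x) \<le> (norm x)\<^sup>2"
  using positive_op_one_minus[OF positive_P] norm_compose_quarter(1) by (auto simp: Z_def P_def)

private lemma Z'_contraction: "norm (Z' x) \<le> norm x"
proof -
  have "positive_op ((1/4) *\<^sub>R (adjoint_op W o\<^sub>L W))"
    by (intro positive_op_scaleR positive_op_adjoint_compose clW) simp
  then have p: "positive_op ((1/4) *\<^sub>R (V o\<^sub>L W))" by (simp add: adjoint_adjoint[OF clV])
  have Z': "positive_op Z'" "\<And>x. Re (cinner (Z' x) x) \<le> (norm x)\<^sup>2"
    unfolding Z'_def using positive_op_one_minus[OF p norm_compose_quarter(2)] by auto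
  have "(norm (Z' x))\<^sup>2 \<le> (norm x)\<^sup>2"
    using positive_contraction_norm_square[OF Z', of x] Z'(2)[of x] by linarith
  then show ?thesis by (rule power2_le_imp_le) simp
qed

private lemma V_Z: "V (Z x) = Z' (V x)"
  by (simp add: Z_def Z'_def P_def blinfun.bilinear_simps)

text \<open>The intertwining V Z = \<open>Z'\<close> V moves the powers to the other side of V,
  where they act as contractions. This domination is what allows convergence in the Hilbert-Schmidt
  norm.\<close>

private lemma norm_V_power_Z_le: "norm (V (power_op Z k x)) \<le> norm (V x)"
proof (induction k)
  case (Suc k)
  have "norm (V (power_op Z (Suc k) x)) \<le> norm (V (power_op Z k x))"
    by (simp add: power_op_Suc V_Z Z'_contraction)
  then show ?case using Suc by linarith
qed simp

text \<open>\<open>(norm (V z))\<^sup>2\<close> is 4 times the quantity that vanishes along orbits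
  in \<open>positive_contraction_orbit\<close>.\<close>

private lemma V_power_Z_tendsto: "(\<lambda>k. (norm (V (power_op Z k x)))\<^sup>2) \<longlonglongrightarrow> 0"
proof -
  have eq: "(norm (V z))\<^sup>2 = 4 * ((norm z)\<^sup>2 - Re (cinner (Z z) z))" for z
    by (simp add: Z_def P_def blinfun.bilinear_simps cinner_diff_left cinner_scaleR_left cinner_self
        flip: cinner_adjoint_right[OF clV])
  have "(\<lambda>k. 4 * ((norm (power_op Z k x))\<^sup>2 - Re (cinner (Z (power_op Z k x)) (power_op Z k x)))) \<longlonglongrightarrow> 4 * 0"
    unfolding power_op_apply by (intro tendsto_mult tendsto_const positive_contraction_orbit[OF Z])
  then show ?thesis unfolding eq by simp
qed

text \<open>Dominated convergence over the basis: finitely many vectors converge one by one, and the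
  others together contribute at most \<open>\<epsilon> / 2\<close> uniformly in k.\<close>

private lemma hs_norm_V_power_Z_tendsto: "(\<lambda>k. (hs_norm (V o\<^sub>L power_op Z k))\<^sup>2) \<longlonglongrightarrow> 0"
proof (rule LIMSEQ_I)
  fix \<epsilon> :: real assume \<epsilon>: "\<epsilon> > 0"
  have hs: "hilbert_schmidt (V o\<^sub>L power_op Z k)" for k
    using positive_op_complex_linear[OF Z(1)] by (intro hilbert_schmidt_compose_right V) auto
  obtain F where F: "finite F" "F \<subseteq> some_onb" "dist (\<Sum>e\<in>F. (norm (V e))\<^sup>2) ((hs_norm V)\<^sup>2) \<le> \<epsilon> / 2"
    using has_sum_finite_approximation[OF hs_norm_has_sum[OF V], of "\<epsilon> / 2"] \<epsilon> by auto
  have "(\<lambda>k. \<Sum>e\<in>F. (norm (V (power_op Z k e)))\<^sup>2) \<longlonglongrightarrow> (\<Sum>e\<in>F. 0)"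
    by (intro tendsto_sum V_power_Z_tendsto)
  then have "\<forall>\<^sub>F k in sequentially. (\<Sum>e\<in>F. (norm (V (power_op Z k e)))\<^sup>2) < \<epsilon> / 2"
    by (rule order_tendstoD(2)) (use \<epsilon> in simp)
  then obtain K where K: "\<And>k. k \<ge> K \<Longrightarrow> (\<Sum>e\<in>F. (norm (V (power_op Z k e)))\<^sup>2) < \<epsilon> / 2"
    unfolding eventually_sequentially by blast
  have "(hs_norm (V o\<^sub>L power_op Z k))\<^sup>2 < \<epsilon>" if k: "k \<ge> K" for k
  proof -
    let ?f = "\<lambda>e. (norm ((V o\<^sub>L power_op Z k) e))\<^sup>2"
    have "(hs_norm (V o\<^sub>L power_op Z k))\<^sup>2 \<le> (\<Sum>e\<in>F. ?f e) + \<epsilon> / 2"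
    proof (rule has_sum_le_finite_sums[OF hs_norm_has_sum[OF hs]])
      fix G :: "'a set" assume G: "finite G" "G \<subseteq> some_onb"
      have "(\<Sum>e\<in>G. ?f e) \<le> (\<Sum>e\<in>F \<union> (G - F). ?f e)" using F G by (intro sum_mono2) auto
      also have "\<dots> = (\<Sum>e\<in>F. ?f e) + (\<Sum>e\<in>G - F. ?f e)" using F G by (intro sum.union_disjoint) auto
      also have "(\<Sum>e\<in>G - F. ?f e) \<le> (\<Sum>e\<in>G - F. (norm (V e))\<^sup>2)"
        by (intro sum_mono) (simp add: power_mono norm_V_power_Z_le)
      also have "(\<Sum>e\<in>G - F. (norm (V e))\<^sup>2) \<le> \<epsilon> / 2"
      proof -
        have "(\<Sum>e\<in>F. (norm (V e))\<^sup>2) + (\<Sum>e\<in>G - F. (norm (V e))\<^sup>2) = (\<Sum>e\<in>F \<union> (G - F). (norm (V e))\<^sup>2)"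
          using F G by (intro sum.union_disjoint[symmetric]) auto
        also have "\<dots> \<le> (hs_norm V)\<^sup>2" using F G by (intro hs_norm_finite_sum V) auto
        finally show ?thesis using F(3) unfolding dist_real_def by linarith
      qed
      finally show "(\<Sum>e\<in>G. ?f e) \<le> (\<Sum>e\<in>F. ?f e) + \<epsilon> / 2" by simp
    qed
    also have "\<dots> < \<epsilon>" using K[OF k] by simp
    finally show ?thesis .
  qed
  then show "\<exists>K. \<forall>k\<ge>K. norm ((hs_norm (V o\<^sub>L power_op Z k))\<^sup>2 - 0) < \<epsilon>" by auto
qed

text \<open>R is a truncated Neumann series for a regularised inverse of V: since 1 - Z = P has the
  right factor V, so has 1 - Z^k, and V - V R V = V Z^k. No bound on R is claimed; it may grow as d
  shrinks, which is harmless because R is fixed before n varies.\<close>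

lemma hilbert_schmidt_sandwich_approx:
  assumes d: "d > 0"
  shows "\<exists>R. complex_linear R \<and> hs_norm (V - (V o\<^sub>L (R o\<^sub>L V))) < d"
proof -
  have "\<forall>\<^sub>F k in sequentially. (hs_norm (V o\<^sub>L power_op Z k))\<^sup>2 < d\<^sup>2"
    by (rule order_tendstoD(2)[OF hs_norm_V_power_Z_tendsto]) (use d in simp)
  then obtain k where "(hs_norm (V o\<^sub>L power_op Z k))\<^sup>2 < d\<^sup>2" unfolding eventually_sequentially by blast
  then have k: "hs_norm (V o\<^sub>L power_op Z k) < d" by (rule power2_less_imp_less) (use d in simp)
  have "\<exists>R. complex_linear R \<and> (\<forall>x. x - R (V x) = power_op Z k x)"
  proof (induction k)
    case 0
    show ?case by (intro exI[of _ 0]) simp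
  next
    case (Suc k)
    then obtain R where R: "complex_linear R" "\<And>x. x - R (V x) = power_op Z k x" by blast
    show ?case
    proof (intro exI[of _ "(1/4) *\<^sub>R W + (Z o\<^sub>L R)"] conjI allI)
      show "complex_linear ((1/4) *\<^sub>R W + (Z o\<^sub>L R))"
        using clW R(1) positive_op_complex_linear[OF Z(1)] by auto
      fix x
      have "x - ((1/4) *\<^sub>R W + (Z o\<^sub>L R)) (V x) = Z x - Z (R (V x))"
        by (simp add: Z_def P_def blinfun.bilinear_simps)
      also have "\<dots> = power_op Z (Suc k) x"
        by (simp add: power_op_Suc flip: R(2) blinfun.diff_right)
      finally show "x - ((1/4) *\<^sub>R W + (Z o\<^sub>L R)) (V x) = power_op Z (Suc k) x" .
    qed
  qed
  then obtain R where R: "complex_linear R" "\<And>x. x - R (V x) = power_op Z k x" by blast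
  have "V - (V o\<^sub>L (R o\<^sub>L V)) = V o\<^sub>L power_op Z k"
    by (intro blinfun_eqI) (simp add: blinfun.diff_left flip: R(2) blinfun.diff_right)
  then show ?thesis using R(1) k by auto
qed

end

text \<open>Strict convexity of the ball: strictly inside the segment, \<open>1 - T\<^sub>s\<^sup>* T\<^sub>s \<ge> s (1 - s) V\<^sup>* V\<close>, so that the
  orbit of \<open>T\<^sub>s\<close> is square summable in the direction of \<open>V\<close>. This is where singular measures are excluded.\<close>

lemma convex_combination_norm_square:
  fixes u v :: "'a::complex_inner_space"
  shows "s * (1 - s) * (norm (v - u))\<^sup>2 = (1 - s) * (norm u)\<^sup>2 + s * (norm v)\<^sup>2 - (norm (u + s *\<^sub>R (v - u)))\<^sup>2"
proof -
  have "(norm (u + s *\<^sub>R (v - u)))\<^sup>2 = (norm u)\<^sup>2 + 2 * (s * Re (cinner u (v - u))) + s\<^sup>2 * (norm (v - u))\<^sup>2"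
    by (simp add: norm_add_square cinner_scaleR_right power_mult_distrib)
  moreover have "(norm v)\<^sup>2 = (norm u)\<^sup>2 + 2 * Re (cinner u (v - u)) + (norm (v - u))\<^sup>2"
    using norm_add_square[of u "v - u"] by simp
  ultimately show ?thesis by (simp add: algebra_simps power2_eq_square)
qed

section \<open>Decay of the moments inside the segment\<close>

context
  fixes N N\<^sub>0 V :: "'a::complex_hilbert_space \<Rightarrow>\<^sub>L 'a" and T :: "real \<Rightarrow> 'a \<Rightarrow>\<^sub>L 'a"
  assumes N: "complex_linear N" "norm N \<le> 1" and N0: "complex_linear N\<^sub>0" "norm N\<^sub>0 \<le> 1"
    and Vdef: "V = N - N\<^sub>0" and V: "hilbert_schmidt V"
    and T_def: "T = segment_op N\<^sub>0 V"
begin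

lemmas segment_linear = segment_complex_linear[OF N N0 Vdef V T_def]
lemmas segment_norm_le = segment_contraction[OF N N0 Vdef V T_def]

lemma segment_lipschitz: "norm (T s - T r) \<le> norm V * \<bar>s - r\<bar>"
  unfolding segment_diff[OF N N0 Vdef V T_def] by (simp add: mult.commute)

lemma segment_smooth_step:
  assumes s: "s \<in> {0..1}"
  shows "s * (1 - s) * (norm (V x))\<^sup>2 \<le> (norm x)\<^sup>2 - (norm (T s x))\<^sup>2"
proof -
  have le: "norm (N x) \<le> norm x" "norm (N\<^sub>0 x) \<le> norm x"
    using norm_blinfun[of N x] norm_blinfun[of N\<^sub>0 x] mult_right_mono[OF N(2) norm_ge_zero[of x]]
      mult_right_mono[OF N0(2) norm_ge_zero[of x]] by linarith+
  have "(1 - s) * (norm (N\<^sub>0 x))\<^sup>2 + s * (norm (N x))\<^sup>2 \<le> (1 - s) * (norm x)\<^sup>2 + s * (norm x)\<^sup>2"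
    using s le by (intro add_mono mult_left_mono power_mono) auto
  moreover have "T s x = N\<^sub>0 x + s *\<^sub>R (N x - N\<^sub>0 x)" "V x = N x - N\<^sub>0 x"
    by (simp_all add: T_def segment_op_def Vdef blinfun.bilinear_simps)
  then have "s * (1 - s) * (norm (V x))\<^sup>2 = (1 - s) * (norm (N\<^sub>0 x))\<^sup>2 + s * (norm (N x))\<^sup>2 - (norm (T s x))\<^sup>2"
    by (simp only: convex_combination_norm_square)
  moreover have "(1 - s) * (norm x)\<^sup>2 + s * (norm x)\<^sup>2 = (norm x)\<^sup>2" by (simp add: algebra_simps)
  ultimately show ?thesis by linarith
qed

lemma segment_smooth:
  assumes s: "s \<in> {0..1}"
  shows "s * (1 - s) * (\<Sum>j<n. (norm (V (power_op (T s) j x)))\<^sup>2) \<le> (norm x)\<^sup>2"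
proof -
  have "s * (1 - s) * (\<Sum>j<n. (norm (V (power_op (T s) j x)))\<^sup>2) \<le> (norm x)\<^sup>2 - (norm (power_op (T s) n x))\<^sup>2"
  proof (induction n)
    case (Suc n)
    then show ?case
      using segment_smooth_step[OF s, of "power_op (T s) n x"] by (simp add: distrib_left power_op_Suc)
  qed simp
  then show ?thesis by (smt (verit) zero_le_power2)
qed

text \<open>The bound \<open>(norm x)\<^sup>2\<close> of \<open>segment_smooth\<close> is summed
  over a basis at \<open>x = V e\<close>, where the sum is \<open>(hs_norm V)\<^sup>2\<close>; this
  is the purpose of the right-hand factor V.\<close>

lemma segment_smooth_hs:
  assumes s: "s \<in> {0..1}"
  shows "s * (1 - s) * (\<Sum>j<n. (hs_norm (V o\<^sub>L (power_op (T s) j o\<^sub>L V)))\<^sup>2) \<le> (hs_norm V)\<^sup>2"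
proof -
  have hs: "hilbert_schmidt (V o\<^sub>L (power_op (T s) j o\<^sub>L V))" for j
    using segment_linear by (intro hilbert_schmidt_compose_left hilbert_schmidt_complex_linear[OF V] V) auto
  have "((\<lambda>e. \<Sum>j<n. (norm ((V o\<^sub>L (power_op (T s) j o\<^sub>L V)) e))\<^sup>2) has_sum
     (\<Sum>j<n. (hs_norm (V o\<^sub>L (power_op (T s) j o\<^sub>L V)))\<^sup>2)) some_onb"
    by (intro has_sum_finite_sum hs_norm_has_sum hs) auto
  from has_sum_cmult_right[OF this, of "s * (1 - s)"]
  show ?thesis
    by (rule has_sum_mono[OF _ hs_norm_has_sum[OF V]]) (use segment_smooth[OF s] in simp)
qed

text \<open>Rotating the first V to the end turns X T^j X T^l into (R V T^j V) (R V T^l V), two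
  factors of the same kind. Then 2 a b <= a^2 + b^2 reduces the n + 1 terms to one square sum,
  bounded uniformly in n.\<close>

lemma sandwich_inner_bound:
  assumes R: "complex_linear R" and s: "s \<in> {0..1}"
  defines "X \<equiv> V o\<^sub>L (R o\<^sub>L V)"
  shows "s * (1 - s) * cmod (hs_inner (power_deriv (T s) X (Suc n)) (adjoint_op X)) \<le> (norm R)\<^sup>2 * (hs_norm V)\<^sup>2"
proof -
  note clV = hilbert_schmidt_complex_linear[OF V]
  have RV: "hilbert_schmidt (R o\<^sub>L V)" by (rule hilbert_schmidt_compose_left(1)[OF R V])
  have X: "hilbert_schmidt X" unfolding X_def by (rule hilbert_schmidt_compose_left(1)[OF clV RV])
  have clT: "complex_linear (power_op (T s) j)" for j using segment_linear by auto
  let ?S = "\<lambda>j. hs_norm (V o\<^sub>L (power_op (T s) j o\<^sub>L V))"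
  let ?Y = "\<lambda>j. R o\<^sub>L (V o\<^sub>L (power_op (T s) j o\<^sub>L V))"
  have hs: "hilbert_schmidt (V o\<^sub>L (power_op (T s) j o\<^sub>L V))" for j
    by (intro hilbert_schmidt_compose_left clV clT V)
  have Y: "hilbert_schmidt (?Y j)" "hs_norm (?Y j) \<le> norm R * ?S j" for j
    using hilbert_schmidt_compose_left[OF R hs] by auto
  have tj: "cmod (hs_inner (power_op (T s) j o\<^sub>L (X o\<^sub>L power_op (T s) l)) (adjoint_op X)) \<le> (norm R)\<^sup>2 * (((?S j)\<^sup>2 + (?S l)\<^sup>2) / 2)" for j l
  proof -
    let ?Q = "(?Y j) o\<^sub>L ((R o\<^sub>L V) o\<^sub>L power_op (T s) l)"
    have Q: "hilbert_schmidt ?Q"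
      using hilbert_schmidt_compose_right(1)[OF clT RV] hilbert_schmidt_complex_linear[OF Y(1)]
      by (rule hilbert_schmidt_compose_left(1)[rotated])
    have "hs_inner (power_op (T s) j o\<^sub>L (X o\<^sub>L power_op (T s) l)) (adjoint_op X) = trace_op (X o\<^sub>L (power_op (T s) j o\<^sub>L (X o\<^sub>L power_op (T s) l)))"
      by (rule trace_compose[OF X, symmetric])
    also have "X o\<^sub>L (power_op (T s) j o\<^sub>L (X o\<^sub>L power_op (T s) l)) = V o\<^sub>L ?Q"
      unfolding X_def by (simp only: blinfun_compose_assoc)
    also have "trace_op (V o\<^sub>L ?Q) = trace_op (?Q o\<^sub>L V)" by (rule trace_compose_commute[OF V Q])
    also have "?Q o\<^sub>L V = ?Y j o\<^sub>L ?Y l" by (simp only: blinfun_compose_assoc)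
    also have "cmod (trace_op (?Y j o\<^sub>L ?Y l)) \<le> hs_norm (?Y j) * hs_norm (?Y l)"
      by (rule trace_compose_bound[OF Y(1) Y(1)])
    also have "\<dots> \<le> (norm R * ?S j) * (norm R * ?S l)" by (intro mult_mono Y(2)) auto
    also have "\<dots> = (norm R)\<^sup>2 * (?S j * ?S l)" by (simp add: power2_eq_square mult_ac)
    also have "\<dots> \<le> (norm R)\<^sup>2 * (((?S j)\<^sup>2 + (?S l)\<^sup>2) / 2)"
      using sum_squares_bound[of "?S j" "?S l"] by (intro mult_left_mono) auto
    finally show ?thesis .
  qed
  have "hs_inner (power_deriv (T s) X (Suc n)) (adjoint_op X) =
      (\<Sum>j\<le>n. hs_inner (power_op (T s) j o\<^sub>L (X o\<^sub>L power_op (T s) (n - j))) (adjoint_op X))"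
    unfolding power_deriv_Suc_sum
    by (intro hs_inner_sum_left hs_norm_power_conjugation segment_linear segment_norm_le s X hilbert_schmidt_adjoint)
  then have "cmod (hs_inner (power_deriv (T s) X (Suc n)) (adjoint_op X)) \<le>
      (\<Sum>j\<le>n. (norm R)\<^sup>2 * (((?S j)\<^sup>2 + (?S (n - j))\<^sup>2) / 2))"
    by (simp only:) (intro sum_norm_le tj)
  also have "\<dots> = (norm R)\<^sup>2 * (((\<Sum>j\<le>n. (?S j)\<^sup>2) + (\<Sum>j\<le>n. (?S (n - j))\<^sup>2)) / 2)"
    by (simp only: sum_distrib_left[symmetric] sum_divide_distrib[symmetric] sum.distrib)
  also have "(\<Sum>j\<le>n. (?S (n - j))\<^sup>2) = (\<Sum>j\<le>n. (?S j)\<^sup>2)"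
    using sum.nat_diff_reindex[of "\<lambda>j. (?S j)\<^sup>2" "Suc n"] by (simp add: lessThan_Suc_atMost)
  finally have "cmod (hs_inner (power_deriv (T s) X (Suc n)) (adjoint_op X)) \<le> (norm R)\<^sup>2 * (\<Sum>j<Suc n. (?S j)\<^sup>2)"
    by (simp add: lessThan_Suc_atMost del: power_deriv.simps)
  then have "s * (1 - s) * cmod (hs_inner (power_deriv (T s) X (Suc n)) (adjoint_op X)) \<le> s * (1 - s) * ((norm R)\<^sup>2 * (\<Sum>j<Suc n. (?S j)\<^sup>2))"
    using s by (intro mult_left_mono) auto
  also have "\<dots> = (norm R)\<^sup>2 * (s * (1 - s) * (\<Sum>j<Suc n. (?S j)\<^sup>2))" by (simp only: mult_ac)
  also have "\<dots> \<le> (norm R)\<^sup>2 * (hs_norm V)\<^sup>2" by (intro mult_left_mono segment_smooth_hs s) auto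
  finally show ?thesis .
qed

text \<open>The bound on the n + 1 terms together is uniform in n, so the normalisation by n + 1
  becomes decay. The weight 1 - s absorbs the singularity at s = 1, and
  \<open>\<delta> \<le> s\<close> the one at 0.\<close>

lemma sandwich_kernel_decay:
  assumes R: "complex_linear R" and \<delta>: "0 < \<delta>" "\<delta> \<le> 1"
  defines "X \<equiv> V o\<^sub>L (R o\<^sub>L V)"
  shows "cmod (segment_kernel T \<delta> 1 n X (adjoint_op X)) \<le> ((norm R)\<^sup>2 * (hs_norm V)\<^sup>2 / \<delta>) / (real n + 1)"
proof -
  note clV = hilbert_schmidt_complex_linear[OF V]
  have X: "hilbert_schmidt X" unfolding X_def
    by (intro hilbert_schmidt_compose_left(1) clV R V)
  let ?C = "((norm R)\<^sup>2 * (hs_norm V)\<^sup>2 / \<delta>) / (real n + 1)"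
  have "cmod (segment_kernel T \<delta> 1 n X (adjoint_op X)) \<le> ?C * measure lborel (cbox \<delta> 1)"
  proof (rule has_integral_bound)
    show "((\<lambda>s. of_real (1 - s) * (hs_inner (power_deriv (T s) X (Suc n)) (adjoint_op X) / (of_nat n + 1))) has_integral
        segment_kernel T \<delta> 1 n X (adjoint_op X)) (cbox \<delta> 1)"
      unfolding interval_cbox[symmetric]
      using \<delta> by (intro segment_kernel_has_integral[OF segment_linear segment_norm_le segment_lipschitz] X hilbert_schmidt_adjoint) auto
    fix s assume "s \<in> cbox \<delta> 1"
    then have s: "s \<in> {0..1}" "\<delta> \<le> s" using \<delta> by auto
    let ?h = "cmod (hs_inner (power_deriv (T s) X (Suc n)) (adjoint_op X))"
    have n1: "cmod (complex_of_nat n + 1) = real n + 1"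
      using norm_of_nat[of "Suc n", where 'a = complex] by (simp add: add.commute)
    have "\<delta> * ((1 - s) * ?h) \<le> s * ((1 - s) * ?h)" using s by (intro mult_right_mono mult_nonneg_nonneg) auto
    also have "\<dots> = s * (1 - s) * ?h" by (simp only: mult.assoc)
    also have "\<dots> \<le> (norm R)\<^sup>2 * (hs_norm V)\<^sup>2"
      unfolding X_def by (rule sandwich_inner_bound[OF R s(1)])
    finally have "(1 - s) * ?h \<le> (norm R)\<^sup>2 * (hs_norm V)\<^sup>2 / \<delta>"
      using \<delta> by (simp only: pos_le_divide_eq mult.commute[of _ \<delta>])
    then have "(1 - s) * ?h / (real n + 1) \<le> ?C" by (intro divide_right_mono) auto
    moreover have "cmod (of_real (1 - s) * (hs_inner (power_deriv (T s) X (Suc n)) (adjoint_op X) / (of_nat n + 1))) =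
        (1 - s) * ?h / (real n + 1)"
      using s(1) by (simp only: norm_mult norm_divide n1 norm_of_real) simp
    ultimately show "cmod (of_real (1 - s) * (hs_inner (power_deriv (T s) X (Suc n)) (adjoint_op X) / (of_nat n + 1))) \<le> ?C"
      by (simp only:)
  qed (use \<delta> in auto)
  also have "\<dots> \<le> ?C * 1" using \<delta> by (intro mult_left_mono) auto
  finally show ?thesis by simp
qed

text \<open>Positive bounds p and q in place of the norms themselves keep the balancing weight
  defined when x or y is 0.\<close>

lemma segment_kernel_circle_bounded:
  assumes x: "hilbert_schmidt x" "hs_norm x \<le> p" and y: "hilbert_schmidt y" "hs_norm y \<le> q"
    and pq: "p > 0" "q > 0" and ab: "0 \<le> a" "a \<le> b" "b \<le> 1"
  shows "circle_bounded (integral {a..b} (\<lambda>s. 1 - s) * (p * q)) (\<lambda>n. segment_kernel T a b n x y)"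
proof -
  let ?k = "segment_kernel T a b"
  define w where "w = integral {a..b} (\<lambda>s. 1 - s :: real)"
  have w: "w \<ge> 0"
    unfolding w_def using ab by (intro integral_nonneg integrable_continuous_real continuous_intros) auto
  \<comment> \<open>The minimiser of \<open>\<mu> * p\<^sup>2 + q\<^sup>2 / \<mu>\<close>, with
    value \<open>2 * (p * q)\<close>.\<close>
  define \<mu> where "\<mu> = q / p"
  have \<mu>: "\<mu> > 0" using pq by (simp add: \<mu>_def)
  note K = segment_linear segment_norm_le segment_lipschitz ab
  define B where "B = hs_norm x * hs_norm x + hs_norm x * hs_norm y + hs_norm y * hs_norm x + hs_norm y * hs_norm y"
  have kb: "cmod (?k n u v) \<le> hs_norm u * hs_norm v" if "hilbert_schmidt u" "hilbert_schmidt v" for n u v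
  proof -
    have "cmod (?k n u v) \<le> (b - a) * (hs_norm u * hs_norm v)"
      by (rule segment_kernel_bound[OF K that]) auto
    also have "\<dots> \<le> 1 * (hs_norm u * hs_norm v)" using ab by (intro mult_right_mono) auto
    finally show ?thesis by simp
  qed
  have B: "hs_norm x * hs_norm x \<le> B" "hs_norm x * hs_norm y \<le> B" "hs_norm y * hs_norm x \<le> B" "hs_norm y * hs_norm y \<le> B"
    by (simp_all add: B_def)
  have k0: "?k 0 u v = of_real w * hs_inner u v" for u v
    unfolding w_def by (rule segment_kernel_0[OF K]) auto
  have "circle_bounded ((\<mu> * Re (?k 0 x x) + Re (?k 0 y y) / \<mu>) / 2) (\<lambda>n. ?k n x y)"
  proof (rule circle_bounded_herglotz[where xx = "\<lambda>n. ?k n x x" and yx = "\<lambda>n. ?k n y x" and yy = "\<lambda>n. ?k n y y" and B = B])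
    show "cmod (?k n x x) \<le> B" "cmod (?k n x y) \<le> B" "cmod (?k n y x) \<le> B" "cmod (?k n y y) \<le> B" for n
      using kb[OF x(1) x(1), of n] kb[OF x(1) y(1), of n] kb[OF y(1) x(1), of n] kb[OF y(1) y(1), of n] B by linarith+
    show "?k 0 y x = cnj (?k 0 x y)" unfolding k0 using hs_inner_commute[of y x] by simp
    show "2 * cmod ((\<Sum>n. \<zeta> ^ n * ?k n x y) + cnj (\<Sum>n. \<zeta> ^ n * ?k n y x) - ?k 0 x y) \<le>
       \<mu> * (2 * Re (\<Sum>n. \<zeta> ^ n * ?k n x x) - Re (?k 0 x x)) + (2 * Re (\<Sum>n. \<zeta> ^ n * ?k n y y) - Re (?k 0 y y)) / \<mu>"
      if "cmod \<zeta> < 1" for \<zeta>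
      by (rule segment_kernel_cauchy_schwarz[OF K x(1) y(1) that \<mu>]) auto
  qed
  moreover have "(\<mu> * Re (?k 0 x x) + Re (?k 0 y y) / \<mu>) / 2 \<le> w * (p * q)"
  proof -
    have "Re (?k 0 x x) \<le> w * p\<^sup>2" "Re (?k 0 y y) \<le> w * q\<^sup>2"
      unfolding k0 hs_inner_self[OF x(1)] hs_inner_self[OF y(1)]
      using w x(2) y(2) by (auto intro!: mult_left_mono power_mono)
    then have "\<mu> * Re (?k 0 x x) + Re (?k 0 y y) / \<mu> \<le> \<mu> * (w * p\<^sup>2) + (w * q\<^sup>2) / \<mu>"
      using \<mu> by (intro add_mono mult_left_mono divide_right_mono) auto
    also have "\<dots> = 2 * (w * (p * q))" using pq by (simp add: \<mu>_def power2_eq_square)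
    finally show ?thesis by simp
  qed
  ultimately show ?thesis unfolding w_def by (rule circle_bounded_mono)
qed

lemma weight_integral: "a \<le> b \<Longrightarrow> integral {a..b} (\<lambda>s. 1 - s) = (b - a) - (b\<^sup>2 - a\<^sup>2) / (2::real)"
  using has_integral_diff[OF has_integral_const_real[of "1::real" a b] ident_has_integral[of a b]]
  by (simp add: integral_unique)

lemma weight_integral_le:
  assumes "0 \<le> a" "a \<le> b" "b \<le> (1::real)" shows "integral {a..b} (\<lambda>s. 1 - s) \<le> b - a"
proof -
  have "a\<^sup>2 \<le> b\<^sup>2" using assms by (intro power_mono) auto
  then show ?thesis using weight_integral[OF assms(2)] by simp
qed

lemma segment_kernel_split:
  assumes x: "hilbert_schmidt x" and y: "hilbert_schmidt y" and \<delta>: "0 \<le> \<delta>" "\<delta> \<le> 1"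
  shows "segment_kernel T 0 1 n x y = segment_kernel T 0 \<delta> n x y + segment_kernel T \<delta> 1 n x y"
  unfolding segment_kernel_def
  by (rule Henstock_Kurzweil_Integration.integral_combine[symmetric, OF \<delta>])
    (rule segment_kernel_integrable[OF segment_linear segment_norm_le segment_lipschitz _ _ _ x y]; simp)

lemma inverse_square_tail:
  assumes "\<epsilon> > 0"
  shows "\<exists>K. \<forall>h. (\<forall>n. cmod (h n) \<le> C / (real n + 1)) \<longrightarrow> (\<forall>n<K. h n = 0) \<longrightarrow> circle_bounded \<epsilon> h"
proof -
  let ?b = "\<lambda>n. (C / (real n + 1))\<^sup>2"
  have "summable (\<lambda>n. inverse ((real (Suc n))\<^sup>2))"
    using inverse_power_summable[of 2, where 'a = real] summable_Suc_iff[of "\<lambda>n. inverse ((real n)\<^sup>2)"] by simp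
  then have "summable (\<lambda>n. C\<^sup>2 * inverse ((real (Suc n))\<^sup>2))" by (rule summable_mult)
  then have b: "summable ?b"
    by (rule summable_cong[THEN iffD1, rotated]) (auto simp: power_divide field_simps)
  obtain K where K: "norm (\<Sum>i. ?b (i + K)) < \<epsilon>\<^sup>2"
    using suminf_exist_split[OF _ b, of "\<epsilon>\<^sup>2"] assms by auto
  have "circle_bounded \<epsilon> h" if h: "\<And>n. cmod (h n) \<le> C / (real n + 1)" "\<And>n. n < K \<Longrightarrow> h n = 0" for h
  proof (rule circle_bounded_square_summable)
    have le: "(cmod (h n))\<^sup>2 \<le> ?b n" for n using h(1)[of n] by (intro power_mono) auto
    show s: "summable (\<lambda>n. (cmod (h n))\<^sup>2)"
      by (rule summable_comparison_test'[OF b, of 0]) (use le in simp)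
    have "(\<Sum>n. (cmod (h n))\<^sup>2) = (\<Sum>n. (cmod (h (n + K)))\<^sup>2)"
      using suminf_split_initial_segment[OF s, of K] h(2) by simp
    also have "\<dots> \<le> (\<Sum>i. ?b (i + K))"
      by (intro suminf_le le summable_ignore_initial_segment s b)
    also have "\<dots> \<le> \<epsilon>\<^sup>2" using K by simp
    finally show "(\<Sum>n. (cmod (h n))\<^sup>2) \<le> \<epsilon>\<^sup>2" .
  qed (rule assms)
  then show ?thesis by blast
qed

text \<open>The errors are the piece s < \<open>\<delta>\<close>, the replacement of V by X in the
  left slot, that of the adjoint in the right slot, and the tail of the moments of X. Their shares
  \<open>\<epsilon> / 4\<close>, \<open>\<epsilon> / 6\<close>, \<open>\<epsilon> / 3\<close> and
  \<open>\<epsilon> / 4\<close> add up to \<open>\<epsilon>\<close>.\<close>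

lemma segment_kernel_approx:
  assumes v: "hs_norm V > 0" and \<epsilon>: "\<epsilon> > 0"
  shows "\<exists>h K. (\<forall>n\<ge>K. h n = 0) \<and> circle_bounded \<epsilon> (\<lambda>n. segment_kernel T 0 1 n V (adjoint_op V) - h n)"
proof -
  define v where "v = hs_norm V"
  have v0: "v > 0" using v by (simp add: v_def)
  define \<delta> where "\<delta> = min 1 (\<epsilon> / (4 * v\<^sup>2))"
  have \<delta>: "0 < \<delta>" "\<delta> \<le> 1" "\<delta> * (v * v) \<le> \<epsilon> / 4"
  proof -
    show "0 < \<delta>" "\<delta> \<le> 1" using \<epsilon> v0 by (auto simp: \<delta>_def)
    have "\<delta> * v\<^sup>2 \<le> \<epsilon> / (4 * v\<^sup>2) * v\<^sup>2" by (intro mult_right_mono) (auto simp: \<delta>_def)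
    then show "\<delta> * (v * v) \<le> \<epsilon> / 4" using v0 by (simp add: power2_eq_square)
  qed
  \<comment> \<open>The bound v keeps \<open>hs_norm X \<le> 2 * v\<close>, so the two replacements
    cost at most d v and 2 v d.\<close>
  define d where "d = min v (\<epsilon> / (6 * v))"
  have d: "d > 0" "d \<le> v" "d * v \<le> \<epsilon> / 6"
  proof -
    show "d > 0" "d \<le> v" using \<epsilon> v0 by (auto simp: d_def)
    have "d * v \<le> \<epsilon> / (6 * v) * v" using v0 by (intro mult_right_mono) (auto simp: d_def)
    then show "d * v \<le> \<epsilon> / 6" using v0 by simp
  qed
  have "norm V \<le> 2" unfolding Vdef using N(2) N0(2) norm_triangle_ineq4[of N N\<^sub>0] by linarith
  then obtain R where R: "complex_linear R" "hs_norm (V - (V o\<^sub>L (R o\<^sub>L V))) < d"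
    using hilbert_schmidt_sandwich_approx[OF V _ d(1)] by blast
  define X where "X = V o\<^sub>L (R o\<^sub>L V)"
  note clV = hilbert_schmidt_complex_linear[OF V]
  have X: "hilbert_schmidt X" unfolding X_def by (intro hilbert_schmidt_compose_left(1) clV R V)
  have D: "hilbert_schmidt (V - X)" "hs_norm (V - X) \<le> d"
    using hilbert_schmidt_diff[OF V X] R(2) by (auto simp: X_def)
  have nX: "hs_norm X \<le> 2 * v"
    using hs_norm_add_le[OF V hilbert_schmidt_scaleR[OF D(1), of "-1"]] hs_norm_scaleR[of "-1" "V - X"] D(2) d(2)
    by (simp add: v_def)
  let ?W = "adjoint_op V" and ?Y = "adjoint_op X"
  have W: "hilbert_schmidt ?W" "hs_norm ?W \<le> v" using hilbert_schmidt_adjoint[OF V] by (auto simp: v_def)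
  have Y: "hilbert_schmidt ?Y" using hilbert_schmidt_adjoint[OF X] by auto
  have WY: "?W - ?Y = adjoint_op (V - X)"
    by (simp add: adjoint_diff clV hilbert_schmidt_complex_linear[OF X])
  have E: "hilbert_schmidt (?W - ?Y)" "hs_norm (?W - ?Y) \<le> d"
    unfolding WY using hilbert_schmidt_adjoint[OF D(1)] D(2) by auto
  define C where "C = (norm R)\<^sup>2 * (hs_norm V)\<^sup>2 / \<delta>"
  define h where "h = (\<lambda>n. segment_kernel T \<delta> 1 n X ?Y)"
  have h: "cmod (h n) \<le> C / (real n + 1)" for n
    unfolding h_def X_def C_def by (rule sandwich_kernel_decay[OF R(1) \<delta>(1,2)])
  have C0: "C / (real n + 1) \<ge> 0" for n using h[of n] norm_ge_zero order_trans by blast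
  obtain K where K: "\<And>g. (\<And>n. cmod (g n) \<le> C / (real n + 1)) \<Longrightarrow> (\<And>n. n < K \<Longrightarrow> g n = 0) \<Longrightarrow> circle_bounded (\<epsilon> / 4) g"
    using inverse_square_tail[of "\<epsilon> / 4" C] \<epsilon> by (metis divide_pos_pos zero_less_numeral)
  define h0 where "h0 = (\<lambda>n. if n < K then h n else 0)"
  have 1: "circle_bounded (integral {0..\<delta>} (\<lambda>s. 1 - s) * (v * v)) (\<lambda>n. segment_kernel T 0 \<delta> n V ?W)"
    using \<delta> v0 by (intro segment_kernel_circle_bounded V W) (auto simp: v_def)
  have 2: "circle_bounded (integral {\<delta>..1} (\<lambda>s. 1 - s) * (d * v)) (\<lambda>n. segment_kernel T \<delta> 1 n (V - X) ?W)"
    using \<delta> v0 d by (intro segment_kernel_circle_bounded D W) auto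
  have 3: "circle_bounded (integral {\<delta>..1} (\<lambda>s. 1 - s) * ((2 * v) * d)) (\<lambda>n. segment_kernel T \<delta> 1 n X (?W - ?Y))"
    using \<delta> v0 d by (intro segment_kernel_circle_bounded X nX E) auto
  have 4: "circle_bounded (\<epsilon> / 4) (\<lambda>n. h n - h0 n)"
    by (rule K) (use h C0 in \<open>auto simp: h0_def\<close>)
  have w1: "integral {0..\<delta>} (\<lambda>s. 1 - s) \<le> \<delta>" and w2: "integral {\<delta>..1} (\<lambda>s. 1 - s) \<le> 1"
    using weight_integral_le[of 0 \<delta>] weight_integral_le[of \<delta> 1] \<delta> by auto
  have "circle_bounded (\<delta> * (v * v)) (\<lambda>n. segment_kernel T 0 \<delta> n V ?W)"
    by (rule circle_bounded_mono[OF 1]) (use w1 in \<open>auto intro!: mult_right_mono\<close>)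
  then have 1: "circle_bounded (\<epsilon> / 4) (\<lambda>n. segment_kernel T 0 \<delta> n V ?W)" using \<delta>(3) by (rule circle_bounded_mono)
  have "integral {\<delta>..1} (\<lambda>s. 1 - s) * (d * v) \<le> 1 * (d * v)" using w2 d v0 by (intro mult_right_mono) auto
  then have 2: "circle_bounded (\<epsilon> / 6) (\<lambda>n. segment_kernel T \<delta> 1 n (V - X) ?W)"
    using d(3) by (intro circle_bounded_mono[OF 2]) linarith
  have "integral {\<delta>..1} (\<lambda>s. 1 - s) * ((2 * v) * d) \<le> 1 * ((2 * v) * d)" using w2 d v0 by (intro mult_right_mono) auto
  then have 3: "circle_bounded (\<epsilon> / 3) (\<lambda>n. segment_kernel T \<delta> 1 n X (?W - ?Y))"
    using d(3) by (intro circle_bounded_mono[OF 3]) (simp add: mult_ac)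
  note all = circle_bounded_add[OF circle_bounded_add[OF 1 2] circle_bounded_add[OF 3 4]]
  note K' = segment_linear segment_norm_le segment_lipschitz less_imp_le[OF \<delta>(1)] \<delta>(2) order_refl
  have "segment_kernel T \<delta> 1 n (V - X) ?W = segment_kernel T \<delta> 1 n V ?W - segment_kernel T \<delta> 1 n X ?W"
    and "segment_kernel T \<delta> 1 n X (?W - ?Y) = segment_kernel T \<delta> 1 n X ?W - segment_kernel T \<delta> 1 n X ?Y" for n
    by (rule segment_kernel_diff_left[OF K' V X W(1)]; simp)
      (rule segment_kernel_diff_right[OF K' X W(1) Y]; simp)
  then have "segment_kernel T 0 \<delta> n V ?W + segment_kernel T \<delta> 1 n (V - X) ?W +
      (segment_kernel T \<delta> 1 n X (?W - ?Y) + (h n - h0 n)) = segment_kernel T 0 1 n V ?W - h0 n" for n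
    unfolding segment_kernel_split[OF V W(1) less_imp_le[OF \<delta>(1)] \<delta>(2)] h_def by simp
  with all have "circle_bounded (\<epsilon> / 4 + \<epsilon> / 6 + (\<epsilon> / 3 + \<epsilon> / 4)) (\<lambda>n. segment_kernel T 0 1 n V ?W - h0 n)" by simp
  then have "circle_bounded \<epsilon> (\<lambda>n. segment_kernel T 0 1 n V ?W - h0 n)" by (rule circle_bounded_mono) simp
  moreover have "\<forall>n\<ge>K. h0 n = 0" by (simp add: h0_def)
  ultimately show ?thesis by blast
qed

lemma segment_kernel_representable:
  assumes \<epsilon>: "\<epsilon> > 0"
  shows "\<exists>g. circle_represents ((1/2 + \<epsilon>) * (hs_norm V)\<^sup>2) (\<lambda>n. segment_kernel T 0 1 n V (adjoint_op V)) g"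
proof (cases "hs_norm V = 0")
  \<comment> \<open>The allowance \<open>\<epsilon> * (hs_norm V)\<^sup>2\<close> is 0 here, which
    leaves no room for approximation; but all moments vanish.\<close>
  case True
  have "cmod (segment_kernel T 0 1 n V (adjoint_op V)) \<le> (1 - 0) * (hs_norm V * hs_norm (adjoint_op V))" for n
    by (rule segment_kernel_bound[OF segment_linear segment_norm_le segment_lipschitz _ _ _ V hilbert_schmidt_adjoint(1)[OF V]]) auto
  then show ?thesis using True by (intro exI[of _ "\<lambda>_. 0"]) simp
next
  case False
  then have v: "hs_norm V > 0" using hs_norm_nonneg[of V] by linarith
  have "circle_bounded (integral {0..1} (\<lambda>s. 1 - s) * (hs_norm V * hs_norm V)) (\<lambda>n. segment_kernel T 0 1 n V (adjoint_op V))"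
    using v hilbert_schmidt_adjoint[OF V] by (intro segment_kernel_circle_bounded V) auto
  then have c: "circle_bounded ((1/2) * (hs_norm V)\<^sup>2) (\<lambda>n. segment_kernel T 0 1 n V (adjoint_op V))"
    by (simp add: weight_integral power2_eq_square)
  have "(1/2) * (hs_norm V)\<^sup>2 + \<epsilon> * (hs_norm V)\<^sup>2 = (1/2 + \<epsilon>) * (hs_norm V)\<^sup>2" by (simp add: algebra_simps)
  then show ?thesis
    using circle_bounded_representable[OF c segment_kernel_approx[OF v], of "\<epsilon> * (hs_norm V)\<^sup>2"] v \<epsilon> by simp
qed

end

section \<open>The trace formula\<close>

definition power_remainder :: "('a::complex_hilbert_space \<Rightarrow>\<^sub>L 'a) \<Rightarrow> ('a \<Rightarrow>\<^sub>L 'a) \<Rightarrow> nat \<Rightarrow> 'a \<Rightarrow>\<^sub>L 'a" where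
  "power_remainder N N\<^sub>0 n = power_op N n - power_op N\<^sub>0 n - power_deriv N\<^sub>0 (N - N\<^sub>0) n"

lemma power_remainder_small [simp]: "power_remainder N N\<^sub>0 0 = 0" "power_remainder N N\<^sub>0 (Suc 0) = 0"
  by (auto intro!: blinfun_eqI simp: power_remainder_def power_op_Suc blinfun.bilinear_simps)

context
  fixes N N\<^sub>0 V :: "'a::complex_hilbert_space \<Rightarrow>\<^sub>L 'a"
  assumes N: "complex_linear N" "norm N \<le> 1" and N0: "complex_linear N\<^sub>0" "norm N\<^sub>0 \<le> 1"
    and Vdef: "V = N - N\<^sub>0" and V: "hilbert_schmidt V"
begin

lemma trace_bounded_power_remainder: "trace_bounded (power_remainder N N\<^sub>0 n)"
  unfolding power_remainder_def
  by (rule power_remainder_trace_bounded[OF N N0]) (use V Vdef in simp)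

text \<open>The factor n + 2 comes from Taylor's formula and n + 1 undoes the normalisation in
  \<open>segment_kernel\<close>; their product is what two differentiations of
  \<open>z ^ (n + 2)\<close> produce, so it is absorbed in the second derivative of p.\<close>

lemma trace_power_remainder:
  "trace_op (power_remainder N N\<^sub>0 (n + 2)) =
     of_nat ((n + 2) * (n + 1)) * segment_kernel (segment_op N\<^sub>0 V) 0 1 n V (adjoint_op V)"
proof -
  let ?T = "segment_op N\<^sub>0 V"
  let ?h = "\<lambda>s. hs_inner (power_deriv (?T s) V (Suc n)) (adjoint_op V)"
  have "((\<lambda>s. of_real (1 - s) * (of_nat (Suc n + 1) * trace_op (V o\<^sub>L power_deriv (?T s) V (Suc n)))) has_integral
     trace_op (power_remainder N N\<^sub>0 (Suc n + 1))) {0..1}"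
    unfolding power_remainder_def Vdef[symmetric] by (rule trace_power_remainder_integral[OF N N0 Vdef V refl])
  moreover have "((\<lambda>s. of_nat ((n + 2) * (n + 1)) * (of_real (1 - s) * (?h s / (of_nat n + 1)))) has_integral
      of_nat ((n + 2) * (n + 1)) * segment_kernel ?T 0 1 n V (adjoint_op V)) {0..1}"
    by (intro has_integral_mult_right
        segment_kernel_has_integral[OF segment_linear[OF N N0 Vdef V refl] segment_norm_le[OF N N0 Vdef V refl]
          segment_lipschitz[OF N N0 Vdef V refl] _ _ _ V hilbert_schmidt_adjoint(1)[OF V]]) auto
  moreover have "of_real (1 - s) * (of_nat (Suc n + 1) * trace_op (V o\<^sub>L power_deriv (?T s) V (Suc n))) =
      of_nat ((n + 2) * (n + 1)) * (of_real (1 - s) * (?h s / (of_nat n + 1)))" for s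
  proof -
    have "complex_of_nat n + 1 \<noteq> 0" by (metis of_nat_Suc add.commute of_nat_neq_0)
    moreover have "complex_of_nat ((n + 2) * (n + 1)) = of_nat (Suc n + 1) * (of_nat n + 1)"
      by (simp add: algebra_simps)
    ultimately show ?thesis
      unfolding trace_compose[OF V] by (simp del: power_deriv.simps of_nat_mult)
  qed
  ultimately show ?thesis by (simp add: has_integral_unique)
qed

lemma poly_path_has_derivative:
  "(poly_path p N\<^sub>0 V has_vector_derivative (\<Sum>i\<le>degree p. scale_op (coeff p i) (power_deriv N\<^sub>0 V i))) (at 0 within S)"
proof -
  have scale: "bounded_linear (scale_op c :: ('a \<Rightarrow>\<^sub>L 'a) \<Rightarrow> 'a \<Rightarrow>\<^sub>L 'a)" for c
    unfolding scale_op_def by (rule bounded_bilinear.bounded_linear_right[OF bounded_bilinear_blinfun_compose])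
  have "((\<lambda>s. \<Sum>i\<le>degree p. scale_op (coeff p i) (power_op (N\<^sub>0 + s *\<^sub>R V) i)) has_vector_derivative
      (\<Sum>i\<le>degree p. scale_op (coeff p i) (power_deriv N\<^sub>0 V i))) (at 0 within S)"
    by (intro has_vector_derivative_sum bounded_linear.has_vector_derivative[OF scale] power_path_has_derivative)
  then show ?thesis by (simp add: poly_path_def[abs_def] poly_op_def)
qed

lemma taylor_remainder_eq:
  "taylor_remainder p N N\<^sub>0 = (\<Sum>i\<le>degree p. scale_op (coeff p i) (power_remainder N N\<^sub>0 i))"
proof -
  have "vector_derivative (poly_path p N\<^sub>0 (N - N\<^sub>0)) (at 0 within {0..1}) =
      (\<Sum>i\<le>degree p. scale_op (coeff p i) (power_deriv N\<^sub>0 V i))"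
    unfolding Vdef[symmetric]
    using vector_derivative_within_cbox[of 0 1 0, OF _ _ poly_path_has_derivative] by simp
  moreover have "scale_op c (power_remainder N N\<^sub>0 i) = scale_op c (power_op N i) - scale_op c (power_op N\<^sub>0 i) - scale_op c (power_deriv N\<^sub>0 V i)" for c i
    by (intro blinfun_eqI) (simp add: power_remainder_def scale_op_apply Vdef[symmetric] blinfun.diff_left scaleC_diff_right)
  ultimately show ?thesis
    by (simp add: taylor_remainder_def poly_op_def sum_subtractf)
qed

lemma taylor_remainder_trace_class: "trace_class (taylor_remainder p N N\<^sub>0)"
  unfolding taylor_remainder_eq
  by (intro trace_class_trace_bounded trace_bounded_sum trace_bounded_scale trace_bounded_power_remainder)

lemma trace_taylor_remainder:
  "trace_op (taylor_remainder p N N\<^sub>0) = (\<Sum>n\<le>degree p. coeff (pderiv (pderiv p)) n *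
     segment_kernel (segment_op N\<^sub>0 V) 0 1 n V (adjoint_op V))"
proof -
  let ?t = "\<lambda>i. coeff p i * trace_op (power_remainder N N\<^sub>0 i)"
  have "trace_op (taylor_remainder p N N\<^sub>0) = (\<Sum>i\<le>degree p. ?t i)"
    unfolding taylor_remainder_eq
    by (subst trace_op_sum) (auto intro: trace_bounded_scale trace_bounded_power_remainder simp: trace_op_scale)
  \<comment> \<open>Two zero coefficients are appended at the top so that, once the terms 0 and 1
    are dropped by \<open>power_remainder_small\<close>, the shifted sum again runs to
    \<open>degree p\<close>.\<close>
  also have "\<dots> = (\<Sum>i\<le>Suc (Suc (degree p)). ?t i)"
    by (intro sum.mono_neutral_left) (auto simp: coeff_eq_0)
  also have "\<dots> = (\<Sum>n\<le>degree p. ?t (n + 2))"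
    by (simp only: sum.atMost_Suc_shift) simp
  also have "\<dots> = (\<Sum>n\<le>degree p. coeff (pderiv (pderiv p)) n * segment_kernel (segment_op N\<^sub>0 V) 0 1 n V (adjoint_op V))"
    unfolding trace_power_remainder by (intro sum.cong refl) (simp add: coeff_pderiv algebra_simps)
  finally show ?thesis .
qed

end

section \<open>Passage from the parameter interval to the circle\<close>

lemma set_integral_circle:
  fixes f :: "real \<Rightarrow> 'b::{banach, second_countable_topology}"
  shows "(LINT t:{0..2*pi}|lebesgue. f t) = (\<integral>t. f t \<partial>circle_measure)"
  by (simp add: set_lebesgue_integral_def integral_restrict_space)

lemma L1_circle_iff: "L1_circle f \<longleftrightarrow> integrable circle_measure (\<lambda>t. f (cis t))"
  by (simp add: L1_circle_def set_integrable_def integrable_restrict_space)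

text \<open>The factor \<open>1 / (\<i> z)\<close> turns the complex line element into arc length; the value at \<open>2 \<pi>\<close>, where the
  angle jumps back to 0, is a null set.\<close>

definition circle_function :: "(real \<Rightarrow> complex) \<Rightarrow> complex \<Rightarrow> complex" where
  "circle_function g z = g (Arg2pi z) / (\<i> * z)"

lemma circle_function_cis:
  "0 \<le> t \<Longrightarrow> t < 2 * pi \<Longrightarrow> circle_function g (cis t) = g t / (\<i> * cis t)"
  unfolding circle_function_def cis_conv_exp using Arg2pi_exp[of "\<i> * of_real t"] by (simp add: Arg2pi_unique[of 1])

lemma AE_circle_function: "AE t in circle_measure. circle_function g (cis t) = g t / (\<i> * cis t)"
proof -
  have "{2 * pi} \<in> null_sets lebesgue" by (simp flip: negligible_iff_null_sets)
  then have "AE t in lebesgue. t \<notin> {2 * pi}" by (rule AE_not_in)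
  then have "AE t in lebesgue. t \<in> {0..2 * pi} \<longrightarrow> circle_function g (cis t) = g t / (\<i> * cis t)"
    by eventually_elim (auto intro!: circle_function_cis)
  then show ?thesis by (simp add: AE_restrict_space_iff)
qed

lemma circle_function_integrable:
  assumes g: "integrable circle_measure g"
  shows "L1_circle (circle_function g)" "L1_norm_circle (circle_function g) = circle_norm g"
proof -
  have m: "(\<lambda>t. g t / (\<i> * cis t)) \<in> borel_measurable circle_measure"
    using borel_measurable_integrable[OF g] cis_measurable[of 1] by (intro borel_measurable_divide borel_measurable_times) auto
  have gi: "integrable circle_measure (\<lambda>t. g t / (\<i> * cis t))"
    by (rule Bochner_Integration.integrable_bound[OF g m]) (simp add: norm_divide norm_mult)
  \<comment> \<open>Measurability of the composition with \<open>Arg2pi\<close> is inherited from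
    the explicit quotient, from which it differs at \<open>2 * pi\<close> at most.\<close>
  have mf: "(\<lambda>t. circle_function g (cis t)) \<in> borel_measurable circle_measure"
  proof (rule measurable_discrete_difference[OF m, of "{2 * pi}"])
    show "g t / (\<i> * cis t) = circle_function g (cis t)"
      if "t \<in> space circle_measure" "t \<notin> {2 * pi}" for t
      using that by (intro circle_function_cis[symmetric]) auto
    show "{t} \<in> sets circle_measure" if "t \<in> {2 * pi}" for t
      using that by (auto simp: sets_restrict_space_iff)
  qed auto
  show "L1_circle (circle_function g)"
    unfolding L1_circle_iff using integrable_cong_AE[OF mf m AE_circle_function] gi by blast
  have "(\<integral>t. cmod (circle_function g (cis t)) \<partial>circle_measure) = circle_norm g"
  proof (rule integral_cong_AE)
    show "AE t in circle_measure. cmod (circle_function g (cis t)) = cmod (g t)"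
      using AE_circle_function[of g] by eventually_elim (simp add: norm_divide norm_mult)
  qed (use mf borel_measurable_integrable[OF g] in auto)
  then show "L1_norm_circle (circle_function g) = circle_norm g"
    by (simp add: L1_norm_circle_def set_integral_circle)
qed

lemma circle_function_integral:
  assumes g: "integrable circle_measure g" and d: "degree p \<le> d"
  shows "circle_integral (\<lambda>z. poly p z * circle_function g z) =
    (\<Sum>n\<le>d. coeff p n * circle_coeff g n)"
proof -
  have mc: "(\<lambda>t. cis t) \<in> borel_measurable circle_measure" using cis_measurable[of 1] by simp
  have mf: "(\<lambda>t. circle_function g (cis t)) \<in> borel_measurable circle_measure"
    using circle_function_integrable(1)[OF g] unfolding L1_circle_iff by (rule borel_measurable_integrable)
  have mp: "(\<lambda>t. poly p (cis t)) \<in> borel_measurable circle_measure"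
    by (intro borel_measurable_integrable circle_integrable_continuous continuous_intros)
  have "circle_integral (\<lambda>z. poly p z * circle_function g z) =
      (\<integral>t. poly p (cis t) * circle_function g (cis t) * (\<i> * cis t) \<partial>circle_measure)"
    by (simp add: circle_integral_def set_integral_circle)
  also have "\<dots> = (\<integral>t. poly p (cis t) * g t \<partial>circle_measure)"
  proof (rule integral_cong_AE)
    show "AE t in circle_measure. poly p (cis t) * circle_function g (cis t) * (\<i> * cis t) = poly p (cis t) * g t"
      using AE_circle_function[of g] by eventually_elim (simp add: cis_neq_zero)
  qed (use mf mp mc borel_measurable_integrable[OF g] in \<open>auto intro!: borel_measurable_times\<close>)
  also have "\<dots> = (\<integral>t. (\<Sum>n\<le>d. coeff p n * (cis (real n * t) * g t)) \<partial>circle_measure)"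
  proof (intro Bochner_Integration.integral_cong refl)
    fix t
    have "poly p (cis t) = (\<Sum>n\<le>degree p. coeff p n * cis (real n * t))"
      by (simp add: poly_altdef Complex.DeMoivre)
    also have "\<dots> = (\<Sum>n\<le>d. coeff p n * cis (real n * t))"
      using d by (intro sum.mono_neutral_left) (auto simp: coeff_eq_0)
    finally show "poly p (cis t) * g t = (\<Sum>n\<le>d. coeff p n * (cis (real n * t) * g t))"
      by (simp add: sum_distrib_right mult.assoc)
  qed
  also have "\<dots> = (\<Sum>n\<le>d. coeff p n * circle_coeff g n)"
    using cis_mult_integrable[OF g] by (subst Bochner_Integration.integral_sum) auto
  finally show ?thesis .
qed

text \<open>The line element supplies one more factor z, so the moment of order n sits at index - (n
  + 1): the moments are, up to a constant, exactly the Fourier coefficients of negative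
  index.\<close>

lemma circle_integral_monom:
  "circle_integral (\<lambda>z. z ^ n * f z) = \<i> * (2 * pi) * fourier_coeff f (- int (Suc n))"
proof -
  have "f (cis t) * cis (- (of_int (- int (Suc n)) * t)) = cis t ^ n * f (cis t) * cis t" for t
  proof -
    have "cis (- (of_int (- int (Suc n)) * t)) = cis (real (Suc n) * t)"
      by (rule arg_cong[of _ _ cis]) (simp add: algebra_simps)
    also have "\<dots> = cis t ^ Suc n" by (rule Complex.DeMoivre[symmetric])
    finally show ?thesis by (simp only: power_Suc2 mult_ac)
  qed
  then have "fourier_coeff f (- int (Suc n)) = (\<integral>t. cis t ^ n * f (cis t) * cis t \<partial>circle_measure) / (2 * pi)"
    unfolding fourier_coeff_def set_integral_circle by (simp only:)
  moreover have "circle_integral (\<lambda>z. z ^ n * f z) = (\<integral>t. \<i> * (cis t ^ n * f (cis t) * cis t) \<partial>circle_measure)"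
    unfolding circle_integral_def set_integral_circle by (simp only: mult_ac)
  ultimately show ?thesis by simp
qed

text \<open>Every \<open>z ^ n\<close> is the second derivative of a polynomial, so two solutions
  have the same moments, and these are all the coefficients that must vanish for the difference to
  be analytic.\<close>

lemma trace_formula_unique:
  assumes 1: "L1_circle \<eta>\<^sub>1" "trace_formula N N\<^sub>0 \<eta>\<^sub>1" and 2: "L1_circle \<eta>\<^sub>2" "trace_formula N N\<^sub>0 \<eta>\<^sub>2"
  shows "H1_circle (\<lambda>z. \<eta>\<^sub>1 z - \<eta>\<^sub>2 z)"
  unfolding H1_circle_def
proof (intro conjI allI impI)
  have i: "integrable circle_measure (\<lambda>t. \<eta>\<^sub>1 (cis t))" "integrable circle_measure (\<lambda>t. \<eta>\<^sub>2 (cis t))"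
    using 1 2 by (simp_all add: L1_circle_iff)
  then show "L1_circle (\<lambda>z. \<eta>\<^sub>1 z - \<eta>\<^sub>2 z)" by (simp add: L1_circle_iff)
  fix k :: int assume "k < 0"
  then obtain n where k: "k = - int (Suc n)" using negD by blast
  define p where "p = monom (1 / (of_nat (Suc n) * of_nat (Suc (Suc n))) :: complex) (Suc (Suc n))"
  have pz: "poly (pderiv (pderiv p)) z = z ^ n" for z
  proof -
    have "complex_of_nat (Suc n) \<noteq> 0" "complex_of_nat (Suc (Suc n)) \<noteq> 0" by (simp_all only: of_nat_eq_0_iff)
    then show ?thesis unfolding p_def pderiv_monom by (simp add: poly_monom del: of_nat_Suc)
  qed
  have "circle_integral (\<lambda>z. z ^ n * \<eta>\<^sub>1 z) = circle_integral (\<lambda>z. z ^ n * \<eta>\<^sub>2 z)"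
    using 1(2) 2(2) unfolding trace_formula_def pz[symmetric] by metis
  then have eq: "fourier_coeff \<eta>\<^sub>1 k = fourier_coeff \<eta>\<^sub>2 k" unfolding circle_integral_monom k by simp
  have ic: "integrable circle_measure (\<lambda>t. \<eta>\<^sub>1 (cis t) * cis (- (of_int k * t)))"
    "integrable circle_measure (\<lambda>t. \<eta>\<^sub>2 (cis t) * cis (- (of_int k * t)))"
    using cis_mult_integrable[OF i(1), of "- of_int k"] cis_mult_integrable[OF i(2), of "- of_int k"]
    by (simp_all add: mult.commute)
  have "fourier_coeff (\<lambda>z. \<eta>\<^sub>1 z - \<eta>\<^sub>2 z) k = fourier_coeff \<eta>\<^sub>1 k - fourier_coeff \<eta>\<^sub>2 k"
    unfolding fourier_coeff_def set_integral_circle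
    by (simp only: left_diff_distrib Bochner_Integration.integral_diff[OF ic] diff_divide_distrib)
  then show "fourier_coeff (\<lambda>z. \<eta>\<^sub>1 z - \<eta>\<^sub>2 z) k = 0" using eq by simp
qed

theorem theorem5p1:
  fixes N N\<^sub>0 V :: "'a::complex_hilbert_space \<Rightarrow>\<^sub>L 'a"
  assumes "infinite_dimensional TYPE('a)" and "separable_space (euclidean :: 'a topology)"
    and "complex_linear N" and "complex_linear N\<^sub>0"
    and "norm N \<le> 1" and "norm N\<^sub>0 \<le> 1"
    and "normal_op N\<^sub>0"
    and "V = N - N\<^sub>0" and "hilbert_schmidt V"
  shows "(\<forall>p. poly_path p N\<^sub>0 V differentiable (at 0 within {0..1}) \<and>
              trace_class (taylor_remainder p N N\<^sub>0)) \<and>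
         (\<exists>\<eta>. L1_circle \<eta> \<and> trace_formula N N\<^sub>0 \<eta>) \<and>
         (\<forall>\<eta>\<^sub>1 \<eta>\<^sub>2. L1_circle \<eta>\<^sub>1 \<and> trace_formula N N\<^sub>0 \<eta>\<^sub>1 \<and>
                  L1_circle \<eta>\<^sub>2 \<and> trace_formula N N\<^sub>0 \<eta>\<^sub>2 \<longrightarrow>
                  H1_circle (\<lambda>z. \<eta>\<^sub>1 z - \<eta>\<^sub>2 z)) \<and>
         (\<forall>\<epsilon>>0. \<exists>\<eta>. L1_circle \<eta> \<and> trace_formula N N\<^sub>0 \<eta> \<and>
                  L1_norm_circle \<eta> \<le> (1/2 + \<epsilon>) * (hs_norm V)\<^sup>2)"
proof -
  note N = assms(3,5) and N0 = assms(4,6) and V = assms(8,9)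
  have \<eta>: "\<exists>\<eta>. L1_circle \<eta> \<and> trace_formula N N\<^sub>0 \<eta> \<and> L1_norm_circle \<eta> \<le> (1/2 + \<epsilon>) * (hs_norm V)\<^sup>2"
    if "\<epsilon> > 0" for \<epsilon>
  proof -
    obtain g where g: "integrable circle_measure g"
      "circle_norm g \<le> (1/2 + \<epsilon>) * (hs_norm V)\<^sup>2"
      "\<And>n. circle_coeff g n = segment_kernel (segment_op N\<^sub>0 V) 0 1 n V (adjoint_op V)"
      using segment_kernel_representable[OF N N0 V refl \<open>\<epsilon> > 0\<close>] by blast
    have "trace_formula N N\<^sub>0 (circle_function g)"
      unfolding trace_formula_def
    proof
      fix p :: "complex poly"
      have "degree (pderiv (pderiv p)) \<le> degree p"
        by (simp add: degree_pderiv)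
      from circle_function_integral[OF g(1) this]
      show "trace_op (taylor_remainder p N N\<^sub>0) = circle_integral (\<lambda>z. poly (pderiv (pderiv p)) z * circle_function g z)"
        unfolding trace_taylor_remainder[OF N N0 V] g(3) by simp
    qed
    then show ?thesis
      using circle_function_integrable[OF g(1)] g(2) by (intro exI[of _ "circle_function g"]) simp
  qed
  have "poly_path p N\<^sub>0 V differentiable (at 0 within {0..1})" for p
    by (rule differentiableI_vector[OF poly_path_has_derivative[OF N N0 V]])
  moreover have "trace_class (taylor_remainder p N N\<^sub>0)" for p
    by (rule taylor_remainder_trace_class[OF N N0 V])
  moreover have "\<exists>\<eta>. L1_circle \<eta> \<and> trace_formula N N\<^sub>0 \<eta>" using \<eta>[of 1] by auto
  ultimately show ?thesis using \<eta> trace_formula_unique by blast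
qed

end
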